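(* Let $q\in\mathbb C^\times$ be not a root of unity. Then for all $i,j,i',j'\in\mathbb N$ the following isomorphisms hold in the Drinfeld center $\mathcal Z(\mathbf{TL}(q;\mathbb C))$ of the Temperley--Lieb category: $$M_{i,j}\otimes M_{i',j'}\cong W_{i,j}\otimes W_{i',j'}\cong\bigoplus_{m=0}^{\min(i,i')}\ \bigoplus_{n=0}^{\min(j,j')}M_{i+i'-2m,\;j+j'-2n},$$ $$W_{i,j}\otimes M_{i',j'}\cong\bigoplus_{m=0}^{\min(i,i')}\ \bigoplus_{n=0}^{\min(j,j')}W_{i+i'-2m,\;j+j'-2n}.$$
   Context: Temperley--Lieb category. For an algebraically closed field $K$ and $q\in K^\times$ put $[2]_q=q+q^{-1}$. Let $\widetilde{\mathbf{TL}}(q;K)$ be the strict $K$-linear monoidal category with objects $\underline 0,\underline 1,\underline 2,\dots$, $\underline m\otimes\underline n=\underline{m+n}$, unit $\underline 0$, whose morphisms are generated by $\mathrm{cup}:\underline 0\to\underline 2$ and $\mathrm{cap}:\underline 2\to\underline 0$ subject to $(\mathrm{cap}\otimes\mathrm{id}_{\underline 1})(\mathrm{id}_{\underline 1}\otimes\mathrm{cup})=\mathrm{id}_{\underline 1}=(\mathrm{id}_{\underline 1}\otimes\mathrm{cap})(\mathrm{cup}\otimes\mathrm{id}_{\underline 1})$ and $\mathrm{cap}\circ\mathrm{cup}=-[2]_q\,\mathrm{id}_{\underline 0}$. $\mathbf{TL}(q;K)$ is its Cauchy completion (formally adjoin finite direct sums, then split idempotents). Put $T_0=\underline 0$, $T_1=\underline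 1$, and for $n\ge2$ let $T_n$ be the unique (up to isomorphism) indecomposable summand of $\underline n$ that is not a summand of $\underline{n-2}$. For $q$ not a root of unity, $\mathbf{TL}(q;K)$ is semisimple with simple objects $T_0,T_1,T_2,\dots$. Braidings. The braidings $\sigma$ of $\mathbf{TL}(q;K)$ are determined by $\sigma_{\underline 1,\underline 1}=a\,\mathrm{id}_{\underline 2}+a^{-1}\,\mathrm{cup}\circ\mathrm{cap}$ with $a\in K^\times$, $a^2+a^{-2}=[2]_q$; one of these is fixed. Drinfeld center. A half-braiding on $X\in\mathcal C$ is a natural isomorphism $\varphi:X\otimes-\Rightarrow -\otimes X$ with $\varphi_{Y\otimes Z}=(\mathrm{id}_Y\otimes\varphi_Z)(\varphi_Y\otimes\mathrm{id}_Z)$ (associators suppressed). $\mathcal Z(\mathcal C)$ has objects $(X,\varphi)$ and as morphisms those morphisms of $\mathcal C$ compatible with half-braidings; $(X,\varphi)\otimes(X',\varphi')=(X\otimes X',(\varphi\otimes\mathrm{id}_{X'})(\mathrm{id}_X\otimes\varphi'))$. Objects. $M_{i,j}=(T_i\otimes T_j,\ (\sigma_{T_i,-}\otimes\mathrm{id}_{T_j})\circ(\mathrm{id}_{T_i}\otimes\sigma_{-,T_j}^{-1}))$ and $W_{i,j}=M_{i,j}\otimes(\underline 0,\xi)$, where $\xi$ is the half-braiding on the unit with $\xi_{T_n}=(-1)^n r^{-1}l:\underline 0\otimes T_n\to T_n\otimes\underline 0$ ($l,r$ the unitors). *)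

theory Defs
  imports Complex_Main "HOL-Library.FuncSet"
begin

section \<open>Strict linear monoidal categories\<close>

text \<open>
  The record only collects the data; the categories built below from the Temperley--Lieb
  category are strict monoidal, so associators and unitors are identities and never appear.
  \<open>csum C X Y fs\<close> is the sum of the list \<open>fs\<close> of morphisms from \<open>X\<close> to \<open>Y\<close>.
\<close>

record ('o, 'm, 'k) lincat =
  Ob :: "'o set"
  Hom :: "'o \<Rightarrow> 'o \<Rightarrow> 'm set"
  idm :: "'o \<Rightarrow> 'm"
  cmp :: "'m \<Rightarrow> 'm \<Rightarrow> 'm"  (infixl "\<cdot>\<index>" 70)
  zero :: "'o \<Rightarrow> 'o \<Rightarrow> 'm"
  add :: "'m \<Rightarrow> 'm \<Rightarrow> 'm"
  scale :: "'k \<Rightarrow> 'm \<Rightarrow> 'm"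
  unit :: 'o
  tensO :: "'o \<Rightarrow> 'o \<Rightarrow> 'o"  (infixr "\<odot>\<index>" 75)
  tensM :: "'m \<Rightarrow> 'm \<Rightarrow> 'm"  (infixr "\<otimes>\<index>" 75)

definition csum :: "('o, 'm, 'k) lincat \<Rightarrow> 'o \<Rightarrow> 'o \<Rightarrow> 'm list \<Rightarrow> 'm" where
  "csum C X Y fs = foldr (add C) fs (zero C X Y)"

definition inverse_pair :: "('o, 'm, 'k) lincat \<Rightarrow> 'o \<Rightarrow> 'o \<Rightarrow> 'm \<Rightarrow> 'm \<Rightarrow> bool" where
  "inverse_pair C X Y f g \<longleftrightarrow> f \<in> Hom C X Y \<and> g \<in> Hom C Y X \<and>
     g \<cdot>\<^bsub>C\<^esub> f = idm C X \<and> f \<cdot>\<^bsub>C\<^esub> g = idm C Y"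

definition is_iso :: "('o, 'm, 'k) lincat \<Rightarrow> 'o \<Rightarrow> 'o \<Rightarrow> 'm \<Rightarrow> bool" where
  "is_iso C X Y f \<longleftrightarrow> (\<exists>g. inverse_pair C X Y f g)"

definition inv_mor :: "('o, 'm, 'k) lincat \<Rightarrow> 'o \<Rightarrow> 'o \<Rightarrow> 'm \<Rightarrow> 'm" where
  "inv_mor C X Y f = (THE g. inverse_pair C X Y f g)"

definition isomorphic :: "('o, 'm, 'k) lincat \<Rightarrow> 'o \<Rightarrow> 'o \<Rightarrow> bool" where
  "isomorphic C X Y \<longleftrightarrow> X \<in> Ob C \<and> Y \<in> Ob C \<and> (\<exists>f. is_iso C X Y f)"

text \<open>\<open>D\<close> is a biproduct of the list \<open>As\<close> of objects.\<close>

definition is_direct_sum :: "('o, 'm, 'k) lincat \<Rightarrow> 'o \<Rightarrow> 'o list \<Rightarrow> bool" where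
  "is_direct_sum C D As \<longleftrightarrow> D \<in> Ob C \<and> set As \<subseteq> Ob C \<and>
     (\<exists>\<iota> \<pi>. (\<forall>k<length As. \<iota> k \<in> Hom C (As ! k) D \<and> \<pi> k \<in> Hom C D (As ! k)) \<and>
        (\<forall>k<length As. \<forall>l<length As.
           \<pi> k \<cdot>\<^bsub>C\<^esub> \<iota> l = (if k = l then idm C (As ! k) else zero C (As ! l) (As ! k))) \<and>
        csum C D D [\<iota> k \<cdot>\<^bsub>C\<^esub> \<pi> k. k \<leftarrow> [0..<length As]] = idm C D)"

definition iso_direct_sum :: "('o, 'm, 'k) lincat \<Rightarrow> 'o \<Rightarrow> 'o list \<Rightarrow> bool" where
  "iso_direct_sum C X As \<longleftrightarrow> (\<exists>D. is_direct_sum C D As \<and> isomorphic C X D)"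

definition is_summand :: "('o, 'm, 'k) lincat \<Rightarrow> 'o \<Rightarrow> 'o \<Rightarrow> bool" where
  "is_summand C X Y \<longleftrightarrow> (\<exists>Z. is_direct_sum C Y [X, Z])"

definition is_zero_ob :: "('o, 'm, 'k) lincat \<Rightarrow> 'o \<Rightarrow> bool" where
  "is_zero_ob C X \<longleftrightarrow> idm C X = zero C X X"

definition indecomposable :: "('o, 'm, 'k) lincat \<Rightarrow> 'o \<Rightarrow> bool" where
  "indecomposable C X \<longleftrightarrow> X \<in> Ob C \<and> \<not> is_zero_ob C X \<and>
     (\<forall>A B. is_direct_sum C X [A, B] \<longrightarrow> is_zero_ob C A \<or> is_zero_ob C B)"

section \<open>Cauchy completion\<close>

text \<open>
  In the constructions below a morphism records its source, its target and the underlying data,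
  so that hom-sets of different pairs of objects are disjoint.
\<close>

datatype ('o, 'd) arr = Arr (src: 'o) (tgt: 'o) (dat: 'd)

text \<open>
  Formal finite direct sums: the list \<open>[X\<^sub>0, \<dots>, X\<^sub>k]\<close> stands for the direct sum of its entries, and
  morphisms are matrices, entry \<open>(i, j)\<close> going from summand \<open>j\<close> of the source to summand \<open>i\<close> of
  the target. Tensor products order the summands lexicographically (Kronecker product of
  matrices), which makes the tensor product strictly associative and unital if that of \<open>C\<close> is.
\<close>

abbreviation mat_index :: "'o list \<Rightarrow> 'o list \<Rightarrow> (nat \<times> nat) set" where
  "mat_index X Y \<equiv> {..<length Y} \<times> {..<length X}"

definition additive_completion ::
  "('o, 'm, 'k) lincat \<Rightarrow> ('o list, ('o list, nat \<times> nat \<Rightarrow> 'm) arr, 'k) lincat" where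
  "additive_completion C = \<lparr>
     Ob = lists (Ob C),
     Hom = (\<lambda>X Y. Arr X Y ` (PiE (mat_index X Y) (\<lambda>(i, j). Hom C (X ! j) (Y ! i)))),
     idm = (\<lambda>X. Arr X X (\<lambda>(i, j)\<in>mat_index X X.
        if i = j then idm C (X ! i) else zero C (X ! j) (X ! i))),
     cmp = (\<lambda>g f. Arr (src f) (tgt g) (\<lambda>(i, j)\<in>mat_index (src f) (tgt g).
        csum C (src f ! j) (tgt g ! i)
          [dat g (i, l) \<cdot>\<^bsub>C\<^esub> dat f (l, j). l \<leftarrow> [0..<length (tgt f)]])),
     zero = (\<lambda>X Y. Arr X Y (\<lambda>(i, j)\<in>mat_index X Y. zero C (X ! j) (Y ! i))),
     add = (\<lambda>f g. Arr (src f) (tgt f) (\<lambda>p\<in>mat_index (src f) (tgt f).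
        add C (dat f p) (dat g p))),
     scale = (\<lambda>c f. Arr (src f) (tgt f) (\<lambda>p\<in>mat_index (src f) (tgt f). scale C c (dat f p))),
     unit = [unit C],
     tensO = (\<lambda>X Y. [x \<odot>\<^bsub>C\<^esub> y. x \<leftarrow> X, y \<leftarrow> Y]),
     tensM = (\<lambda>f g.
        let S = [x \<odot>\<^bsub>C\<^esub> y. x \<leftarrow> src f, y \<leftarrow> src g];
            T = [x \<odot>\<^bsub>C\<^esub> y. x \<leftarrow> tgt f, y \<leftarrow> tgt g];
            s = length (src g); t = length (tgt g)
        in Arr S T (\<lambda>(i, j)\<in>mat_index S T.
             dat f (i div t, j div s) \<otimes>\<^bsub>C\<^esub> dat g (i mod t, j mod s))) \<rparr>"

text \<open>The object \<open>(X, e)\<close> is the formal image of the idempotent \<open>e\<close> on \<open>X\<close>.\<close>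

definition idempotent_completion ::
  "('o, 'm, 'k) lincat \<Rightarrow> ('o \<times> 'm, ('o \<times> 'm, 'm) arr, 'k) lincat" where
  "idempotent_completion C = \<lparr>
     Ob = {(X, e). X \<in> Ob C \<and> e \<in> Hom C X X \<and> e \<cdot>\<^bsub>C\<^esub> e = e},
     Hom = (\<lambda>A B. Arr A B `
        {f \<in> Hom C (fst A) (fst B). f \<cdot>\<^bsub>C\<^esub> snd A = f \<and> snd B \<cdot>\<^bsub>C\<^esub> f = f}),
     idm = (\<lambda>A. Arr A A (snd A)),
     cmp = (\<lambda>g f. Arr (src f) (tgt g) (dat g \<cdot>\<^bsub>C\<^esub> dat f)),
     zero = (\<lambda>A B. Arr A B (zero C (fst A) (fst B))),
     add = (\<lambda>f g. Arr (src f) (tgt f) (add C (dat f) (dat g))),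
     scale = (\<lambda>c f. Arr (src f) (tgt f) (scale C c (dat f))),
     unit = (unit C, idm C (unit C)),
     tensO = (\<lambda>A B. (fst A \<odot>\<^bsub>C\<^esub> fst B, snd A \<otimes>\<^bsub>C\<^esub> snd B)),
     tensM = (\<lambda>f g. Arr
        (fst (src f) \<odot>\<^bsub>C\<^esub> fst (src g), snd (src f) \<otimes>\<^bsub>C\<^esub> snd (src g))
        (fst (tgt f) \<odot>\<^bsub>C\<^esub> fst (tgt g), snd (tgt f) \<otimes>\<^bsub>C\<^esub> snd (tgt g))
        (dat f \<otimes>\<^bsub>C\<^esub> dat g)) \<rparr>"

type_synonym 'o cauchy_ob1 = "'o list"
type_synonym ('o, 'm) cauchy_mor1 = "('o list, nat \<times> nat \<Rightarrow> 'm) arr"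
type_synonym ('o, 'm) cauchy_ob = "'o cauchy_ob1 \<times> ('o, 'm) cauchy_mor1"
type_synonym ('o, 'm) cauchy_mor = "(('o, 'm) cauchy_ob, ('o, 'm) cauchy_mor1) arr"

definition cauchy_completion ::
  "('o, 'm, 'k) lincat \<Rightarrow> (('o, 'm) cauchy_ob, ('o, 'm) cauchy_mor, 'k) lincat" where
  "cauchy_completion C = idempotent_completion (additive_completion C)"

text \<open>The canonical functor from \<open>C\<close> to its Cauchy completion, on objects and on morphisms
  from \<open>X\<close> to \<open>Y\<close>.\<close>

definition cauchy_ob :: "('o, 'm, 'k) lincat \<Rightarrow> 'o \<Rightarrow> ('o, 'm) cauchy_ob" where
  "cauchy_ob C X = ([X], idm (additive_completion C) [X])"

definition cauchy_mor :: "('o, 'm, 'k) lincat \<Rightarrow> 'o \<Rightarrow> 'o \<Rightarrow> 'm \<Rightarrow> ('o, 'm) cauchy_mor" where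
  "cauchy_mor C X Y f = Arr (cauchy_ob C X) (cauchy_ob C Y)
     (Arr [X] [Y] (\<lambda>p\<in>{(0, 0)}. f))"

section \<open>Half-braidings, Drinfeld center and braidings\<close>

definition half_braiding :: "('o, 'm, 'k) lincat \<Rightarrow> 'o \<Rightarrow> ('o \<Rightarrow> 'm) \<Rightarrow> bool" where
  "half_braiding C X \<phi> \<longleftrightarrow> X \<in> Ob C \<and> \<phi> \<in> extensional (Ob C) \<and>
     (\<forall>Y\<in>Ob C. is_iso C (X \<odot>\<^bsub>C\<^esub> Y) (Y \<odot>\<^bsub>C\<^esub> X) (\<phi> Y)) \<and>
     (\<forall>Y\<in>Ob C. \<forall>Z\<in>Ob C. \<forall>f\<in>Hom C Y Z.
        \<phi> Z \<cdot>\<^bsub>C\<^esub> (idm C X \<otimes>\<^bsub>C\<^esub> f) = (f \<otimes>\<^bsub>C\<^esub> idm C X) \<cdot>\<^bsub>C\<^esub> \<phi> Y) \<and>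
     (\<forall>Y\<in>Ob C. \<forall>Z\<in>Ob C.
        \<phi> (Y \<odot>\<^bsub>C\<^esub> Z) = (idm C Y \<otimes>\<^bsub>C\<^esub> \<phi> Z) \<cdot>\<^bsub>C\<^esub> (\<phi> Y \<otimes>\<^bsub>C\<^esub> idm C Z))"

definition drinfeld_center ::
  "('o, 'm, 'k) lincat \<Rightarrow> ('o \<times> ('o \<Rightarrow> 'm), ('o \<times> ('o \<Rightarrow> 'm), 'm) arr, 'k) lincat" where
  "drinfeld_center C = \<lparr>
     Ob = {(X, \<phi>). half_braiding C X \<phi>},
     Hom = (\<lambda>A B. Arr A B ` {f \<in> Hom C (fst A) (fst B). \<forall>Y\<in>Ob C.
        (idm C Y \<otimes>\<^bsub>C\<^esub> f) \<cdot>\<^bsub>C\<^esub> snd A Y = snd B Y \<cdot>\<^bsub>C\<^esub> (f \<otimes>\<^bsub>C\<^esub> idm C Y)}),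
     idm = (\<lambda>A. Arr A A (idm C (fst A))),
     cmp = (\<lambda>g f. Arr (src f) (tgt g) (dat g \<cdot>\<^bsub>C\<^esub> dat f)),
     zero = (\<lambda>A B. Arr A B (zero C (fst A) (fst B))),
     add = (\<lambda>f g. Arr (src f) (tgt f) (add C (dat f) (dat g))),
     scale = (\<lambda>c f. Arr (src f) (tgt f) (scale C c (dat f))),
     unit = (unit C, \<lambda>Y\<in>Ob C. idm C Y),
     tensO = (\<lambda>A B. (fst A \<odot>\<^bsub>C\<^esub> fst B, \<lambda>Y\<in>Ob C.
        (snd A Y \<otimes>\<^bsub>C\<^esub> idm C (fst B)) \<cdot>\<^bsub>C\<^esub> (idm C (fst A) \<otimes>\<^bsub>C\<^esub> snd B Y))),
     tensM = (\<lambda>f g.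
        let T = (\<lambda>A B. (fst A \<odot>\<^bsub>C\<^esub> fst B, \<lambda>Y\<in>Ob C.
              (snd A Y \<otimes>\<^bsub>C\<^esub> idm C (fst B)) \<cdot>\<^bsub>C\<^esub> (idm C (fst A) \<otimes>\<^bsub>C\<^esub> snd B Y)))
        in Arr (T (src f) (src g)) (T (tgt f) (tgt g)) (dat f \<otimes>\<^bsub>C\<^esub> dat g)) \<rparr>"

definition braiding :: "('o, 'm, 'k) lincat \<Rightarrow> ('o \<Rightarrow> 'o \<Rightarrow> 'm) \<Rightarrow> bool" where
  "braiding C \<sigma> \<longleftrightarrow>
     (\<forall>X\<in>Ob C. \<forall>Y\<in>Ob C. is_iso C (X \<odot>\<^bsub>C\<^esub> Y) (Y \<odot>\<^bsub>C\<^esub> X) (\<sigma> X Y)) \<and>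
     (\<forall>X\<in>Ob C. \<forall>X'\<in>Ob C. \<forall>Y\<in>Ob C. \<forall>Y'\<in>Ob C. \<forall>f\<in>Hom C X X'. \<forall>g\<in>Hom C Y Y'.
        \<sigma> X' Y' \<cdot>\<^bsub>C\<^esub> (f \<otimes>\<^bsub>C\<^esub> g) = (g \<otimes>\<^bsub>C\<^esub> f) \<cdot>\<^bsub>C\<^esub> \<sigma> X Y) \<and>
     (\<forall>X\<in>Ob C. \<forall>Y\<in>Ob C. \<forall>Z\<in>Ob C.
        \<sigma> X (Y \<odot>\<^bsub>C\<^esub> Z) = (idm C Y \<otimes>\<^bsub>C\<^esub> \<sigma> X Z) \<cdot>\<^bsub>C\<^esub> (\<sigma> X Y \<otimes>\<^bsub>C\<^esub> idm C Z)) \<and>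
     (\<forall>X\<in>Ob C. \<forall>Y\<in>Ob C. \<forall>Z\<in>Ob C.
        \<sigma> (X \<odot>\<^bsub>C\<^esub> Y) Z = (\<sigma> X Z \<otimes>\<^bsub>C\<^esub> idm C Y) \<cdot>\<^bsub>C\<^esub> (idm C X \<otimes>\<^bsub>C\<^esub> \<sigma> Y Z))"

section \<open>The Temperley--Lieb category\<close>

text \<open>
  The strict linear monoidal category presented by cup and cap: morphisms are formal expressions,
  typed by \<open>tl_typed\<close>, modulo the congruence \<open>tl_eq\<close> generated by the axioms of a strict linear
  monoidal category and the defining relations.
\<close>

datatype 'k tl_expr =
    TId nat
  | TCup
  | TCap
  | TComp "'k tl_expr" "'k tl_expr"  (infixl "\<bullet>\<^sub>T" 70)
  | TTens "'k tl_expr" "'k tl_expr"  (infixl "\<otimes>\<^sub>T" 75)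
  | TZero nat nat
  | TAdd "'k tl_expr" "'k tl_expr"  (infixl "+\<^sub>T" 65)
  | TScale 'k "'k tl_expr"  (infixr "*\<^sub>T" 72)

inductive tl_typed :: "'k tl_expr \<Rightarrow> nat \<Rightarrow> nat \<Rightarrow> bool" where
  "tl_typed (TId n) n n"
| "tl_typed TCup 0 2"
| "tl_typed TCap 2 0"
| "tl_typed f l m \<Longrightarrow> tl_typed g m n \<Longrightarrow> tl_typed (g \<bullet>\<^sub>T f) l n"
| "tl_typed f m n \<Longrightarrow> tl_typed g m' n' \<Longrightarrow> tl_typed (f \<otimes>\<^sub>T g) (m + m') (n + n')"
| "tl_typed (TZero m n) m n"
| "tl_typed f m n \<Longrightarrow> tl_typed g m n \<Longrightarrow> tl_typed (f +\<^sub>T g) m n"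
| "tl_typed f m n \<Longrightarrow> tl_typed (c *\<^sub>T f) m n"

inductive tl_eq :: "'k::field \<Rightarrow> 'k tl_expr \<Rightarrow> 'k tl_expr \<Rightarrow> bool" for q :: 'k where
  refl: "tl_typed f m n \<Longrightarrow> tl_eq q f f"
| sym: "tl_eq q f g \<Longrightarrow> tl_eq q g f"
| trans: "tl_eq q f g \<Longrightarrow> tl_eq q g h \<Longrightarrow> tl_eq q f h"
  \<comment> \<open>congruence\<close>
| cong_comp: "tl_typed (g \<bullet>\<^sub>T f) m n \<Longrightarrow> tl_eq q f f' \<Longrightarrow> tl_eq q g g' \<Longrightarrow>
    tl_eq q (g \<bullet>\<^sub>T f) (g' \<bullet>\<^sub>T f')"
| cong_tens: "tl_eq q f f' \<Longrightarrow> tl_eq q g g' \<Longrightarrow> tl_eq q (f \<otimes>\<^sub>T g) (f' \<otimes>\<^sub>T g')"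
| cong_add: "tl_typed (f +\<^sub>T g) m n \<Longrightarrow> tl_eq q f f' \<Longrightarrow> tl_eq q g g' \<Longrightarrow>
    tl_eq q (f +\<^sub>T g) (f' +\<^sub>T g')"
| cong_scale: "tl_eq q f f' \<Longrightarrow> tl_eq q (c *\<^sub>T f) (c *\<^sub>T f')"
  \<comment> \<open>category\<close>
| id_left: "tl_typed f m n \<Longrightarrow> tl_eq q (TId n \<bullet>\<^sub>T f) f"
| id_right: "tl_typed f m n \<Longrightarrow> tl_eq q (f \<bullet>\<^sub>T TId m) f"
| comp_assoc: "tl_typed f k l \<Longrightarrow> tl_typed g l m \<Longrightarrow> tl_typed h m n \<Longrightarrow>
    tl_eq q (h \<bullet>\<^sub>T g \<bullet>\<^sub>T f) (h \<bullet>\<^sub>T (g \<bullet>\<^sub>T f))"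
  \<comment> \<open>strict monoidal structure\<close>
| tens_id: "tl_eq q (TId m \<otimes>\<^sub>T TId n) (TId (m + n))"
| interchange: "tl_typed f l m \<Longrightarrow> tl_typed g m n \<Longrightarrow> tl_typed f' l' m' \<Longrightarrow> tl_typed g' m' n' \<Longrightarrow>
    tl_eq q ((g \<bullet>\<^sub>T f) \<otimes>\<^sub>T (g' \<bullet>\<^sub>T f')) ((g \<otimes>\<^sub>T g') \<bullet>\<^sub>T (f \<otimes>\<^sub>T f'))"
| tens_assoc: "tl_typed f m n \<Longrightarrow> tl_typed g m' n' \<Longrightarrow> tl_typed h m'' n'' \<Longrightarrow>
    tl_eq q (f \<otimes>\<^sub>T g \<otimes>\<^sub>T h) (f \<otimes>\<^sub>T (g \<otimes>\<^sub>T h))"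
| tens_unit_left: "tl_typed f m n \<Longrightarrow> tl_eq q (TId 0 \<otimes>\<^sub>T f) f"
| tens_unit_right: "tl_typed f m n \<Longrightarrow> tl_eq q (f \<otimes>\<^sub>T TId 0) f"
  \<comment> \<open>vector space structure on hom-sets\<close>
| add_assoc: "tl_typed f m n \<Longrightarrow> tl_typed g m n \<Longrightarrow> tl_typed h m n \<Longrightarrow>
    tl_eq q (f +\<^sub>T g +\<^sub>T h) (f +\<^sub>T (g +\<^sub>T h))"
| add_comm: "tl_typed f m n \<Longrightarrow> tl_typed g m n \<Longrightarrow> tl_eq q (f +\<^sub>T g) (g +\<^sub>T f)"
| add_zero: "tl_typed f m n \<Longrightarrow> tl_eq q (f +\<^sub>T TZero m n) f"
| add_neg: "tl_typed f m n \<Longrightarrow> tl_eq q (f +\<^sub>T (- 1) *\<^sub>T f) (TZero m n)"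
| scale_one: "tl_typed f m n \<Longrightarrow> tl_eq q (1 *\<^sub>T f) f"
| scale_scale: "tl_typed f m n \<Longrightarrow> tl_eq q (c *\<^sub>T d *\<^sub>T f) ((c * d) *\<^sub>T f)"
| scale_add_left: "tl_typed f m n \<Longrightarrow> tl_eq q ((c + d) *\<^sub>T f) (c *\<^sub>T f +\<^sub>T d *\<^sub>T f)"
| scale_add_right: "tl_typed f m n \<Longrightarrow> tl_typed g m n \<Longrightarrow>
    tl_eq q (c *\<^sub>T (f +\<^sub>T g)) (c *\<^sub>T f +\<^sub>T c *\<^sub>T g)"
  \<comment> \<open>bilinearity of composition and tensor product\<close>
| comp_add_left: "tl_typed f l m \<Longrightarrow> tl_typed g m n \<Longrightarrow> tl_typed g' m n \<Longrightarrow>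
    tl_eq q ((g +\<^sub>T g') \<bullet>\<^sub>T f) (g \<bullet>\<^sub>T f +\<^sub>T g' \<bullet>\<^sub>T f)"
| comp_add_right: "tl_typed f l m \<Longrightarrow> tl_typed f' l m \<Longrightarrow> tl_typed g m n \<Longrightarrow>
    tl_eq q (g \<bullet>\<^sub>T (f +\<^sub>T f')) (g \<bullet>\<^sub>T f +\<^sub>T g \<bullet>\<^sub>T f')"
| comp_scale_left: "tl_typed f l m \<Longrightarrow> tl_typed g m n \<Longrightarrow>
    tl_eq q ((c *\<^sub>T g) \<bullet>\<^sub>T f) (c *\<^sub>T (g \<bullet>\<^sub>T f))"
| comp_scale_right: "tl_typed f l m \<Longrightarrow> tl_typed g m n \<Longrightarrow>
    tl_eq q (g \<bullet>\<^sub>T (c *\<^sub>T f)) (c *\<^sub>T (g \<bullet>\<^sub>T f))"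
| tens_add_left: "tl_typed f m n \<Longrightarrow> tl_typed f' m n \<Longrightarrow> tl_typed g m' n' \<Longrightarrow>
    tl_eq q ((f +\<^sub>T f') \<otimes>\<^sub>T g) (f \<otimes>\<^sub>T g +\<^sub>T f' \<otimes>\<^sub>T g)"
| tens_add_right: "tl_typed f m n \<Longrightarrow> tl_typed g m' n' \<Longrightarrow> tl_typed g' m' n' \<Longrightarrow>
    tl_eq q (f \<otimes>\<^sub>T (g +\<^sub>T g')) (f \<otimes>\<^sub>T g +\<^sub>T f \<otimes>\<^sub>T g')"
| tens_scale_left: "tl_typed f m n \<Longrightarrow> tl_typed g m' n' \<Longrightarrow>
    tl_eq q ((c *\<^sub>T f) \<otimes>\<^sub>T g) (c *\<^sub>T (f \<otimes>\<^sub>T g))"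
| tens_scale_right: "tl_typed f m n \<Longrightarrow> tl_typed g m' n' \<Longrightarrow>
    tl_eq q (f \<otimes>\<^sub>T (c *\<^sub>T g)) (c *\<^sub>T (f \<otimes>\<^sub>T g))"
  \<comment> \<open>defining relations\<close>
| zigzag_left: "tl_eq q ((TCap \<otimes>\<^sub>T TId 1) \<bullet>\<^sub>T (TId 1 \<otimes>\<^sub>T TCup)) (TId 1)"
| zigzag_right: "tl_eq q ((TId 1 \<otimes>\<^sub>T TCap) \<bullet>\<^sub>T (TCup \<otimes>\<^sub>T TId 1)) (TId 1)"
| circle: "tl_eq q (TCap \<bullet>\<^sub>T TCup) ((- (q + inverse q)) *\<^sub>T TId 0)"

definition tl_class :: "'k::field \<Rightarrow> 'k tl_expr \<Rightarrow> 'k tl_expr set" where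
  "tl_class q f = {g. tl_eq q f g}"

definition tl_pre :: "'k::field \<Rightarrow> (nat, 'k tl_expr set, 'k) lincat" where
  "tl_pre q = \<lparr>
     Ob = UNIV,
     Hom = (\<lambda>m n. {tl_class q f | f. tl_typed f m n}),
     idm = (\<lambda>n. tl_class q (TId n)),
     cmp = (\<lambda>G F. \<Union>g\<in>G. \<Union>f\<in>F. tl_class q (g \<bullet>\<^sub>T f)),
     zero = (\<lambda>m n. tl_class q (TZero m n)),
     add = (\<lambda>F G. \<Union>f\<in>F. \<Union>g\<in>G. tl_class q (f +\<^sub>T g)),
     scale = (\<lambda>c F. \<Union>f\<in>F. tl_class q (c *\<^sub>T f)),
     unit = 0,
     tensO = (+),
     tensM = (\<lambda>F G. \<Union>f\<in>F. \<Union>g\<in>G. tl_class q (f \<otimes>\<^sub>T g)) \<rparr>"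

type_synonym 'k tl_ob = "(nat, 'k tl_expr set) cauchy_ob"
type_synonym 'k tl_mor = "(nat, 'k tl_expr set) cauchy_mor"

definition TL :: "'k::field \<Rightarrow> ('k tl_ob, 'k tl_mor, 'k) lincat" where
  "TL q = cauchy_completion (tl_pre q)"

definition tl_ob :: "'k::field \<Rightarrow> nat \<Rightarrow> 'k tl_ob" where
  "tl_ob q n = cauchy_ob (tl_pre q) n"

definition tl_cup :: "'k::field \<Rightarrow> 'k tl_mor" where
  "tl_cup q = cauchy_mor (tl_pre q) 0 2 (tl_class q TCup)"

definition tl_cap :: "'k::field \<Rightarrow> 'k tl_mor" where
  "tl_cap q = cauchy_mor (tl_pre q) 2 0 (tl_class q TCap)"

text \<open>
  The objects \<open>T\<^sub>n\<close> are determined only up to isomorphism for \<open>n \<ge> 2\<close>; the predicate admits every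
  choice of representatives.
\<close>

definition tl_indecomposables :: "'k::field \<Rightarrow> (nat \<Rightarrow> 'k tl_ob) \<Rightarrow> bool" where
  "tl_indecomposables q T \<longleftrightarrow> T 0 = tl_ob q 0 \<and> T 1 = tl_ob q 1 \<and>
     (\<forall>n\<ge>2. indecomposable (TL q) (T n) \<and> is_summand (TL q) (T n) (tl_ob q n) \<and>
        \<not> is_summand (TL q) (T n) (tl_ob q (n - 2)))"

definition tl_braiding :: "'k::field \<Rightarrow> 'k \<Rightarrow> ('k tl_ob \<Rightarrow> 'k tl_ob \<Rightarrow> 'k tl_mor) \<Rightarrow> bool" where
  "tl_braiding q a \<sigma> \<longleftrightarrow> a \<noteq> 0 \<and> a\<^sup>2 + inverse (a\<^sup>2) = q + inverse q \<and> braiding (TL q) \<sigma> \<and>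
     \<sigma> (tl_ob q 1) (tl_ob q 1) =
       add (TL q) (scale (TL q) a (idm (TL q) (tl_ob q 2)))
         (scale (TL q) (inverse a) (tl_cup q \<cdot>\<^bsub>TL q\<^esub> tl_cap q))"

text \<open>By strictness, both unitors at \<open>T\<^sub>n\<close> are identities.\<close>

definition sign_half_braiding ::
  "'k::field \<Rightarrow> (nat \<Rightarrow> 'k tl_ob) \<Rightarrow> ('k tl_ob \<Rightarrow> 'k tl_mor) \<Rightarrow> bool" where
  "sign_half_braiding q T \<xi> \<longleftrightarrow> half_braiding (TL q) (tl_ob q 0) \<xi> \<and>
     (\<forall>n. \<xi> (T n) = scale (TL q) ((- 1) ^ n) (idm (TL q) (T n)))"

definition M_ob :: "('o, 'm, 'k) lincat \<Rightarrow> ('o \<Rightarrow> 'o \<Rightarrow> 'm) \<Rightarrow> (nat \<Rightarrow> 'o) \<Rightarrow> nat \<Rightarrow> nat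
    \<Rightarrow> 'o \<times> ('o \<Rightarrow> 'm)" where
  "M_ob C \<sigma> T i j = (T i \<odot>\<^bsub>C\<^esub> T j, \<lambda>Y\<in>Ob C.
     (\<sigma> (T i) Y \<otimes>\<^bsub>C\<^esub> idm C (T j)) \<cdot>\<^bsub>C\<^esub>
     (idm C (T i) \<otimes>\<^bsub>C\<^esub> inv_mor C (Y \<odot>\<^bsub>C\<^esub> T j) (T j \<odot>\<^bsub>C\<^esub> Y) (\<sigma> Y (T j))))"

definition W_ob :: "('o, 'm, 'k) lincat \<Rightarrow> ('o \<Rightarrow> 'o \<Rightarrow> 'm) \<Rightarrow> ('o \<Rightarrow> 'm) \<Rightarrow> (nat \<Rightarrow> 'o)
    \<Rightarrow> nat \<Rightarrow> nat \<Rightarrow> 'o \<times> ('o \<Rightarrow> 'm)" where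
  "W_ob C \<sigma> \<xi> T i j = M_ob C \<sigma> T i j \<odot>\<^bsub>drinfeld_center C\<^esub> (unit C, \<xi>)"

end

theory Submission
  imports Defs "HOL-Library.Multiset"
begin

text \<open>
  In the Drinfeld center, \<open>M i j\<close> is the product \<open>over (T i) \<odot> under (T j)\<close>, where \<open>over X\<close> carries the
  half-braiding \<open>\<sigma> X _\<close> and \<open>under X\<close> the half-braiding inverse to \<open>\<sigma> _ X\<close>. Both constructions are monoidal
  functors, and \<open>\<sigma>\<inverse>\<close> itself exchanges \<open>under Y \<odot> over X\<close> with \<open>over X \<odot> under Y\<close> by the Yang--Baxter equation.
  So \<open>M i j \<odot> M i' j'\<close> is \<open>over (T i \<odot> T i') \<odot> under (T j \<odot> T j')\<close> up to isomorphism, and the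
  Clebsch--Gordan rule for the \<open>T n\<close> decomposes it. The object \<open>(unit, \<xi>)\<close> commutes strictly with every object
  of the center, and its square is the unit since \<open>\<xi>\<close> is a sign on each tensor power of the generator;
  this gives the statements about \<open>W\<close>.

  For the Clebsch--Gordan rule, the Jones--Wenzl idempotents split off objects \<open>J n\<close> with scalar endomorphisms and no
  morphisms between different ones, because every morphism is a combination of composites of caps followed by cups.
  The recursion of the idempotents gives \<open>J (n + 1) \<odot> J 1 \<cong> J (n + 2) \<oplus> J n\<close>; cancelling summands in
  \<open>J i \<odot> J (j + 1) \<odot> J 1\<close> yields the general rule by induction, and an indecomposable summand of a tensor power of
  the generator is some \<open>J n\<close>.
\<close>

section \<open>Strict linear monoidal categories\<close>

text \<open>The category is given by generators and relations, and independence of diagrams is never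
  established; beforehand even the identities might vanish. Normal forms only bound hom-spaces from
  above. The bound from below is drawn from the hypothesis on \<open>T\<close>: the
  \<open>T n\<close> with \<open>n \<ge> 2\<close> are indecomposable, hence nonzero, and
  \<open>T 2\<close> is a summand of the second tensor power, so the unit and the generator are
  nonzero too (\<open>J_nonzero\<close>).

  The record \<open>lincat\<close> is mere data, so the laws must be carried through the quotient,
  the matrices, the idempotents and the center. All four are strict, and one locale serves every
  stage; the results on biproducts are used in \<open>TL q\<close> as well as in its center.

  Genericity of \<open>q\<close> enters through one scalar. The partial traces of the Jones--Wenzl
  idempotents are \<open>- [n + 1] / [n]\<close> in quantum integers, and these neither vanish nor
  lose their denominator because \<open>q ^ (2 * n)\<close> differs from 1 for \<open>n > 0\<close>.

  Cancellation of summands rests on an exchange argument for objects with scalar endomorphisms, in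
  the manner of Steinitz.\<close>

definition arrow :: "('o, 'm, 'k) lincat \<Rightarrow> 'm \<Rightarrow> 'o \<Rightarrow> 'o \<Rightarrow> bool" where
  "arrow C f X Y \<longleftrightarrow> X \<in> Ob C \<and> Y \<in> Ob C \<and> f \<in> Hom C X Y"

lemma csum_Nil [simp]: "csum C X Y [] = zero C X Y"
  and csum_Cons [simp]: "csum C X Y (f # fs) = add C f (csum C X Y fs)"
  by (simp_all add: csum_def)

text \<open>The record imposes no laws and its operations may do anything on junk, so each law is
  stated for an \<open>arrow\<close>, a morphism between actual objects. The laws are those listed
  by \<open>tl_eq\<close>; the action of the scalar 0 and all rules for zero morphisms follow from
  \<open>add_neg\<close> and the scaling laws.\<close>

locale strict_lin_monoidal =
  fixes C :: "('o, 'm, 'k::field) lincat" (structure)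
  assumes unit_Ob: "unit C \<in> Ob C"
    and tensO_Ob: "X \<in> Ob C \<Longrightarrow> Y \<in> Ob C \<Longrightarrow> X \<odot> Y \<in> Ob C"
    and tensO_assoc: "X \<in> Ob C \<Longrightarrow> Y \<in> Ob C \<Longrightarrow> Z \<in> Ob C \<Longrightarrow> (X \<odot> Y) \<odot> Z = X \<odot> (Y \<odot> Z)"
    and tensO_unit_left: "X \<in> Ob C \<Longrightarrow> unit C \<odot> X = X"
    and tensO_unit_right: "X \<in> Ob C \<Longrightarrow> X \<odot> unit C = X"
    and idm_Hom: "X \<in> Ob C \<Longrightarrow> idm C X \<in> Hom C X X"
    and zero_Hom: "X \<in> Ob C \<Longrightarrow> Y \<in> Ob C \<Longrightarrow> zero C X Y \<in> Hom C X Y"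
    and cmp_Hom: "arrow C f X Y \<Longrightarrow> arrow C g Y Z \<Longrightarrow> g \<cdot> f \<in> Hom C X Z"
    and add_Hom: "arrow C f X Y \<Longrightarrow> arrow C g X Y \<Longrightarrow> add C f g \<in> Hom C X Y"
    and scale_Hom: "arrow C f X Y \<Longrightarrow> scale C c f \<in> Hom C X Y"
    and tensM_Hom: "arrow C f X Y \<Longrightarrow> arrow C g X' Y' \<Longrightarrow> f \<otimes> g \<in> Hom C (X \<odot> X') (Y \<odot> Y')"
    and idm_left: "arrow C f X Y \<Longrightarrow> idm C Y \<cdot> f = f"
    and idm_right: "arrow C f X Y \<Longrightarrow> f \<cdot> idm C X = f"
    and cmp_assoc: "arrow C f W X \<Longrightarrow> arrow C g X Y \<Longrightarrow> arrow C h Y Z \<Longrightarrow> (h \<cdot> g) \<cdot> f = h \<cdot> (g \<cdot> f)"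
    and tensM_idm: "X \<in> Ob C \<Longrightarrow> Y \<in> Ob C \<Longrightarrow> idm C X \<otimes> idm C Y = idm C (X \<odot> Y)"
    and interchange: "arrow C f X Y \<Longrightarrow> arrow C g Y Z \<Longrightarrow> arrow C f' X' Y' \<Longrightarrow> arrow C g' Y' Z' \<Longrightarrow>
      (g \<otimes> g') \<cdot> (f \<otimes> f') = (g \<cdot> f) \<otimes> (g' \<cdot> f')"
    and tensM_assoc: "arrow C f X X' \<Longrightarrow> arrow C g Y Y' \<Longrightarrow> arrow C h Z Z' \<Longrightarrow>
      (f \<otimes> g) \<otimes> h = f \<otimes> (g \<otimes> h)"
    and tensM_unit_left: "arrow C f X Y \<Longrightarrow> idm C (unit C) \<otimes> f = f"
    and tensM_unit_right: "arrow C f X Y \<Longrightarrow> f \<otimes> idm C (unit C) = f"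
    and add_assoc: "arrow C f X Y \<Longrightarrow> arrow C g X Y \<Longrightarrow> arrow C h X Y \<Longrightarrow>
      add C (add C f g) h = add C f (add C g h)"
    and add_comm: "arrow C f X Y \<Longrightarrow> arrow C g X Y \<Longrightarrow> add C f g = add C g f"
    and add_zero: "arrow C f X Y \<Longrightarrow> add C f (zero C X Y) = f"
    and add_neg: "arrow C f X Y \<Longrightarrow> add C f (scale C (- 1) f) = zero C X Y"
    and scale_one: "arrow C f X Y \<Longrightarrow> scale C 1 f = f"
    and scale_scale: "arrow C f X Y \<Longrightarrow> scale C c (scale C d f) = scale C (c * d) f"
    and scale_add_left: "arrow C f X Y \<Longrightarrow> scale C (c + d) f = add C (scale C c f) (scale C d f)"
    and scale_add_right: "arrow C f X Y \<Longrightarrow> arrow C g X Y \<Longrightarrow>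
      scale C c (add C f g) = add C (scale C c f) (scale C c g)"
    and cmp_add_left: "arrow C f X Y \<Longrightarrow> arrow C g Y Z \<Longrightarrow> arrow C h Y Z \<Longrightarrow>
      add C g h \<cdot> f = add C (g \<cdot> f) (h \<cdot> f)"
    and cmp_add_right: "arrow C f X Y \<Longrightarrow> arrow C g X Y \<Longrightarrow> arrow C h Y Z \<Longrightarrow>
      h \<cdot> add C f g = add C (h \<cdot> f) (h \<cdot> g)"
    and cmp_scale_left: "arrow C f X Y \<Longrightarrow> arrow C g Y Z \<Longrightarrow> scale C c g \<cdot> f = scale C c (g \<cdot> f)"
    and cmp_scale_right: "arrow C f X Y \<Longrightarrow> arrow C g Y Z \<Longrightarrow> g \<cdot> scale C c f = scale C c (g \<cdot> f)"
    and tensM_add_left: "arrow C f X Y \<Longrightarrow> arrow C g X Y \<Longrightarrow> arrow C h X' Y' \<Longrightarrow>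
      add C f g \<otimes> h = add C (f \<otimes> h) (g \<otimes> h)"
    and tensM_add_right: "arrow C f X Y \<Longrightarrow> arrow C g X Y \<Longrightarrow> arrow C h X' Y' \<Longrightarrow>
      h \<otimes> add C f g = add C (h \<otimes> f) (h \<otimes> g)"
    and tensM_scale_left: "arrow C f X Y \<Longrightarrow> arrow C g X' Y' \<Longrightarrow> scale C c f \<otimes> g = scale C c (f \<otimes> g)"
    and tensM_scale_right: "arrow C f X Y \<Longrightarrow> arrow C g X' Y' \<Longrightarrow> f \<otimes> scale C c g = scale C c (f \<otimes> g)"
begin

lemma arrow_Ob: "arrow C f X Y \<Longrightarrow> X \<in> Ob C" "arrow C f X Y \<Longrightarrow> Y \<in> Ob C"
  by (auto simp: arrow_def)

lemma arrow_idm: "X \<in> Ob C \<Longrightarrow> arrow C (idm C X) X X"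
  and arrow_zero: "X \<in> Ob C \<Longrightarrow> Y \<in> Ob C \<Longrightarrow> arrow C (zero C X Y) X Y"
  and arrow_cmp: "arrow C f X Y \<Longrightarrow> arrow C g Y Z \<Longrightarrow> arrow C (g \<cdot> f) X Z"
  and arrow_add: "arrow C f X Y \<Longrightarrow> arrow C g X Y \<Longrightarrow> arrow C (add C f g) X Y"
  and arrow_scale: "arrow C f X Y \<Longrightarrow> arrow C (scale C c f) X Y"
  and arrow_tensM: "arrow C f X Y \<Longrightarrow> arrow C g X' Y' \<Longrightarrow> arrow C (f \<otimes> g) (X \<odot> X') (Y \<odot> Y')"
  using idm_Hom zero_Hom cmp_Hom add_Hom scale_Hom tensM_Hom tensO_Ob
  by (auto simp: arrow_def)

lemma add_zero_left: "arrow C f X Y \<Longrightarrow> add C (zero C X Y) f = f"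
  by (metis add_comm add_zero arrow_Ob arrow_zero)

lemma scale_zero_left: assumes f: "arrow C f X Y" shows "scale C 0 f = zero C X Y"
  using scale_add_left[OF f, of 1 "- 1"] scale_one[OF f] add_neg[OF f] by simp

lemma scale_zero_right: assumes X: "X \<in> Ob C" "Y \<in> Ob C" shows "scale C c (zero C X Y) = zero C X Y"
  using scale_zero_left[OF arrow_zero[OF X]] scale_scale[OF arrow_zero[OF X], of c 0] by simp

lemma cmp_zero_left: assumes f: "arrow C f X Y" and Z: "Z \<in> Ob C"
  shows "zero C Y Z \<cdot> f = zero C X Z"
proof -
  have z: "arrow C (zero C Y Z) Y Z" using arrow_zero arrow_Ob f Z by blast
  have "zero C Y Z \<cdot> f = scale C 0 (zero C Y Z) \<cdot> f" using scale_zero_left[OF z] by simp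
  also have "\<dots> = zero C X Z"
    using cmp_scale_left[OF f z] scale_zero_left[OF arrow_cmp[OF f z]] by simp
  finally show ?thesis .
qed

lemma cmp_zero_right: assumes f: "arrow C f X Y" and W: "W \<in> Ob C"
  shows "f \<cdot> zero C W X = zero C W Y"
proof -
  have z: "arrow C (zero C W X) W X" using arrow_zero arrow_Ob f W by blast
  have "f \<cdot> zero C W X = f \<cdot> scale C 0 (zero C W X)" using scale_zero_left[OF z] by simp
  also have "\<dots> = zero C W Y"
    using cmp_scale_right[OF z f] scale_zero_left[OF arrow_cmp[OF z f]] by simp
  finally show ?thesis .
qed

lemma tensM_zero_left: assumes f: "arrow C f X' Y'" and X: "X \<in> Ob C" "Y \<in> Ob C"
  shows "zero C X Y \<otimes> f = zero C (X \<odot> X') (Y \<odot> Y')"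
proof -
  note z = arrow_zero[OF X]
  show ?thesis
    using tensM_scale_left[OF z f, of 0] scale_zero_left[OF z] scale_zero_left[OF arrow_tensM[OF z f]] by simp
qed

lemma tensM_zero_right: assumes f: "arrow C f X' Y'" and X: "X \<in> Ob C" "Y \<in> Ob C"
  shows "f \<otimes> zero C X Y = zero C (X' \<odot> X) (Y' \<odot> Y)"
proof -
  note z = arrow_zero[OF X]
  show ?thesis
    using tensM_scale_right[OF f z, of 0] scale_zero_left[OF z] scale_zero_left[OF arrow_tensM[OF f z]] by simp
qed

section \<open>Finite sums of morphisms\<close>

lemma arrow_csum:
  "\<lbrakk>X \<in> Ob C; Y \<in> Ob C; \<And>f. f \<in> set fs \<Longrightarrow> arrow C f X Y\<rbrakk> \<Longrightarrow> arrow C (csum C X Y fs) X Y"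
  by (induction fs) (auto simp: arrow_zero arrow_add)

lemma csum_append:
  assumes "X \<in> Ob C" "Y \<in> Ob C" "\<And>f. f \<in> set fs \<Longrightarrow> arrow C f X Y" "\<And>f. f \<in> set gs \<Longrightarrow> arrow C f X Y"
  shows "csum C X Y (fs @ gs) = add C (csum C X Y fs) (csum C X Y gs)"
  using assms
proof (induction fs)
  case Nil then show ?case by (simp add: add_zero_left[OF arrow_csum])
next
  case (Cons f fs)
  then show ?case using add_assoc[OF _ arrow_csum arrow_csum, of f X Y fs gs] by simp
qed

lemma add_add_swap:
  assumes f: "arrow C f X Y" and g: "arrow C g X Y" and h: "arrow C h X Y" and k: "arrow C k X Y"
  shows "add C (add C f g) (add C h k) = add C (add C f h) (add C g k)"
proof -
  have "add C (add C f g) (add C h k) = add C f (add C (add C g h) k)"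
    using add_assoc[OF f g arrow_add[OF h k]] add_assoc[OF g h k] by simp
  also have "\<dots> = add C f (add C h (add C g k))"
    using add_comm[OF g h] add_assoc[OF h g k] by simp
  also have "\<dots> = add C (add C f h) (add C g k)"
    using add_assoc[OF f h arrow_add[OF g k]] by simp
  finally show ?thesis .
qed

lemma csum_add:
  assumes "X \<in> Ob C" "Y \<in> Ob C"
    and "\<And>x. x \<in> set xs \<Longrightarrow> arrow C (f x) X Y" "\<And>x. x \<in> set xs \<Longrightarrow> arrow C (g x) X Y"
  shows "csum C X Y (map (\<lambda>x. add C (f x) (g x)) xs) =
    add C (csum C X Y (map f xs)) (csum C X Y (map g xs))"
  using assms
proof (induction xs)
  case Nil then show ?case by (simp add: add_zero arrow_zero)
next
  case (Cons x xs)
  have a: "arrow C (f x) X Y" "arrow C (g x) X Y" using Cons.prems by auto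
  have b: "arrow C (csum C X Y (map f xs)) X Y" "arrow C (csum C X Y (map g xs)) X Y"
    using Cons.prems by (auto intro!: arrow_csum)
  have "add C (add C (f x) (g x)) (add C (csum C X Y (map f xs)) (csum C X Y (map g xs))) =
     add C (add C (f x) (csum C X Y (map f xs))) (add C (g x) (csum C X Y (map g xs)))"
    by (rule add_add_swap[OF a b])
  with Cons show ?case by simp
qed

lemma csum_zero: "X \<in> Ob C \<Longrightarrow> Y \<in> Ob C \<Longrightarrow> csum C X Y (map (\<lambda>x. zero C X Y) xs) = zero C X Y"
  by (induction xs) (auto simp: add_zero arrow_zero)

lemma csum_swap:
  assumes "X \<in> Ob C" "Y \<in> Ob C" "\<And>x y. x \<in> set xs \<Longrightarrow> y \<in> set ys \<Longrightarrow> arrow C (f x y) X Y"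
  shows "csum C X Y (map (\<lambda>x. csum C X Y (map (f x) ys)) xs) =
    csum C X Y (map (\<lambda>y. csum C X Y (map (\<lambda>x. f x y) xs)) ys)"
  using assms
proof (induction xs)
  case Nil then show ?case by (simp add: csum_zero)
next
  case (Cons x xs)
  then show ?case by (auto simp: csum_add intro!: csum_add[symmetric] arrow_csum)
qed

lemma csum_cmp_left:
  assumes "X \<in> Ob C" "arrow C g Y Z" "\<And>x. x \<in> set xs \<Longrightarrow> arrow C (f x) X Y"
  shows "g \<cdot> csum C X Y (map f xs) = csum C X Z (map (\<lambda>x. g \<cdot> f x) xs)"
  using assms
proof (induction xs)
  case Nil then show ?case by (simp add: cmp_zero_right)
next
  case (Cons x xs)
  have "arrow C (csum C X Y (map f xs)) X Y"
    using Cons.prems by (auto intro!: arrow_csum dest: arrow_Ob)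
  then show ?case using Cons cmp_add_right[of "f x" X Y "csum C X Y (map f xs)" g Z] by simp
qed

lemma csum_cmp_right:
  assumes "arrow C g X Y" "Z \<in> Ob C" "\<And>x. x \<in> set xs \<Longrightarrow> arrow C (f x) Y Z"
  shows "csum C Y Z (map f xs) \<cdot> g = csum C X Z (map (\<lambda>x. f x \<cdot> g) xs)"
  using assms
proof (induction xs)
  case Nil then show ?case by (simp add: cmp_zero_left)
next
  case (Cons x xs)
  have "arrow C (csum C Y Z (map f xs)) Y Z"
    using Cons.prems by (auto intro!: arrow_csum dest: arrow_Ob)
  then show ?case using Cons cmp_add_left[of g X Y "f x" Z "csum C Y Z (map f xs)"] by simp
qed

lemma csum_scale:
  assumes "X \<in> Ob C" "Y \<in> Ob C" "\<And>x. x \<in> set xs \<Longrightarrow> arrow C (f x) X Y"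
  shows "scale C c (csum C X Y (map f xs)) = csum C X Y (map (\<lambda>x. scale C c (f x)) xs)"
  using assms
proof (induction xs)
  case Nil then show ?case by (simp add: scale_zero_right)
next
  case (Cons x xs)
  then show ?case using scale_add_right[OF _ arrow_csum, of "f x" X Y "map f xs" c] by auto
qed

lemma csum_tens_left:
  assumes "arrow C g X' Y'" "X \<in> Ob C" "Y \<in> Ob C" "\<And>x. x \<in> set xs \<Longrightarrow> arrow C (f x) X Y"
  shows "g \<otimes> csum C X Y (map f xs) = csum C (X' \<odot> X) (Y' \<odot> Y) (map (\<lambda>x. g \<otimes> f x) xs)"
  using assms
proof (induction xs)
  case Nil then show ?case by (simp add: tensM_zero_right)
next
  case (Cons x xs)
  then show ?case using tensM_add_right[OF _ arrow_csum, of "f x" X Y "map f xs" g X' Y'] by auto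
qed

lemma csum_tens_right:
  assumes "arrow C g X' Y'" "X \<in> Ob C" "Y \<in> Ob C" "\<And>x. x \<in> set xs \<Longrightarrow> arrow C (f x) X Y"
  shows "csum C X Y (map f xs) \<otimes> g = csum C (X \<odot> X') (Y \<odot> Y') (map (\<lambda>x. f x \<otimes> g) xs)"
  using assms
proof (induction xs)
  case Nil then show ?case by (simp add: tensM_zero_left)
next
  case (Cons x xs)
  then show ?case using tensM_add_left[OF _ arrow_csum, of "f x" X Y "map f xs" g X' Y'] by auto
qed

lemma csum_concat:
  assumes "X \<in> Ob C" "Y \<in> Ob C" "\<And>x y. x \<in> set xs \<Longrightarrow> y \<in> set (ys x) \<Longrightarrow> arrow C (f x y) X Y"
  shows "csum C X Y (concat (map (\<lambda>x. map (f x) (ys x)) xs)) =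
    csum C X Y (map (\<lambda>x. csum C X Y (map (f x) (ys x))) xs)"
  using assms
proof (induction xs)
  case (Cons x xs)
  show ?case using Cons by (simp, subst csum_append) auto
qed simp

lemma csum_delta:
  assumes "X \<in> Ob C" "Y \<in> Ob C" "\<And>l. l < n \<Longrightarrow> l \<noteq> k \<Longrightarrow> f l = zero C X Y" "k < n" "arrow C (f k) X Y"
  shows "csum C X Y (map f [0..<n]) = f k"
proof -
  have split: "[0..<n] = [0..<k] @ k # [Suc k..<n]"
    using \<open>k < n\<close> by (metis less_imp_le upt_add_eq_append upt_conv_Cons zero_le
        le_add_diff_inverse)
  have z: "map f [0..<k] = map (\<lambda>_. zero C X Y) [0..<k]" "map f [Suc k..<n] = map (\<lambda>_. zero C X Y) [Suc k..<n]"
    using assms by auto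
  have "csum C X Y (map f [0..<n]) = add C (zero C X Y) (add C (f k) (zero C X Y))"
    unfolding split map_append list.map z
    by (subst csum_append) (use assms in \<open>auto simp: csum_zero arrow_zero\<close>)
  then show ?thesis using assms by (simp add: add_zero add_zero_left)
qed

end

text \<open>The row-major numbering \<open>i * b + j\<close> of pairs is the one used for tensor
  products in \<open>additive_completion\<close>; this and the next two facts convert between lists
  indexed by pairs and by single numbers.\<close>

lemma upt_mult: "[0..<a * b] = concat (map (\<lambda>i. map (\<lambda>j. i * b + j) [0..<b]) [0..<a])"
proof (induction a)
  case (Suc a)
  have "[0..<Suc a * b] = [0..<a * b] @ map (\<lambda>j. a * b + j) [0..<b]"
    using upt_add_eq_append[of 0 "a * b" b] map_add_upt[of "a * b" b] by (simp add: add.commute)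
  then show ?case using Suc by simp
qed simp

lemma nth_concat_const:
  assumes "i < length xs * n" "\<And>x. length (g x) = n"
  shows "concat (map g xs) ! i = g (xs ! (i div n)) ! (i mod n)"
  using assms
proof (induction xs arbitrary: i)
  case (Cons x xs)
  show ?case
  proof (cases "i < n")
    case True then show ?thesis using Cons.prems by (simp add: nth_append)
  next
    case False
    then have "i - n < length xs * n" "n > 0" using Cons.prems by (auto intro: gr0I)
    moreover have "i div n = Suc ((i - n) div n)" "i mod n = (i - n) mod n"
      using False \<open>n > 0\<close> by (auto simp: le_div_geq le_mod_geq)
    ultimately show ?thesis using Cons.IH[of "i - n"] Cons.prems False by (simp add: nth_append)
  qed
qed simp

lemma length_concat_const: "(\<And>x. length (g x) = n) \<Longrightarrow> length (concat (map g xs)) = length xs * n"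
  by (induction xs) auto

section \<open>The Temperley--Lieb presentation\<close>

text \<open>An expression has at most one type, and it can be computed from the syntax. Trading the
  inductive \<open>tl_typed\<close> for \<open>tl_dom\<close>, \<open>tl_cod\<close> and
  \<open>tl_wf\<close> makes every typing condition a matter of simplification.\<close>

primrec tl_dom :: "'k tl_expr \<Rightarrow> nat" where
  "tl_dom (TId n) = n"
| "tl_dom TCup = 0"
| "tl_dom TCap = 2"
| "tl_dom (g \<bullet>\<^sub>T f) = tl_dom f"
| "tl_dom (f \<otimes>\<^sub>T g) = tl_dom f + tl_dom g"
| "tl_dom (TZero m n) = m"
| "tl_dom (f +\<^sub>T g) = tl_dom f"
| "tl_dom (c *\<^sub>T f) = tl_dom f"

primrec tl_cod :: "'k tl_expr \<Rightarrow> nat" where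
  "tl_cod (TId n) = n"
| "tl_cod TCup = 2"
| "tl_cod TCap = 0"
| "tl_cod (g \<bullet>\<^sub>T f) = tl_cod g"
| "tl_cod (f \<otimes>\<^sub>T g) = tl_cod f + tl_cod g"
| "tl_cod (TZero m n) = n"
| "tl_cod (f +\<^sub>T g) = tl_cod f"
| "tl_cod (c *\<^sub>T f) = tl_cod f"

primrec tl_wf :: "'k tl_expr \<Rightarrow> bool" where
  "tl_wf (TId n) = True"
| "tl_wf TCup = True"
| "tl_wf TCap = True"
| "tl_wf (g \<bullet>\<^sub>T f) = (tl_wf g \<and> tl_wf f \<and> tl_dom g = tl_cod f)"
| "tl_wf (f \<otimes>\<^sub>T g) = (tl_wf f \<and> tl_wf g)"
| "tl_wf (TZero m n) = True"
| "tl_wf (f +\<^sub>T g) = (tl_wf f \<and> tl_wf g \<and> tl_dom f = tl_dom g \<and> tl_cod f = tl_cod g)"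
| "tl_wf (c *\<^sub>T f) = tl_wf f"

lemma tl_typed_wfI: "tl_wf f \<Longrightarrow> tl_typed f (tl_dom f) (tl_cod f)"
proof (induction f)
  case TCup show ?case by (simp add: tl_typed.intros)
next
  case TCap show ?case by (simp add: tl_typed.intros)
next
  case (TComp g f) then show ?case by (auto intro: tl_typed.intros)
next
  case (TAdd f g) then show ?case by (auto intro: tl_typed.intros)
qed (auto intro: tl_typed.intros)

lemma tl_typed_iff: "tl_typed f m n \<longleftrightarrow> tl_wf f \<and> tl_dom f = m \<and> tl_cod f = n"
proof
  show "tl_typed f m n \<Longrightarrow> tl_wf f \<and> tl_dom f = m \<and> tl_cod f = n"
    by (induction rule: tl_typed.induct) auto
qed (use tl_typed_wfI in blast)

lemma tl_class_eqI: "tl_eq q f g \<Longrightarrow> tl_class q f = tl_class q g"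
  by (auto simp: tl_class_def intro: tl_eq.sym tl_eq.trans)

lemma tl_class_self: "tl_wf f \<Longrightarrow> f \<in> tl_class q f"
  by (auto simp: tl_class_def intro: tl_eq.refl[OF tl_typed_wfI])

text \<open>The operations of \<open>tl_pre\<close> are unions over representatives. By congruence
  all members of such a union are the same class, and since the index sets contain the chosen
  representatives, the union is that class.\<close>

lemma UN_constant_on: "a \<in> A \<Longrightarrow> (\<And>x. x \<in> A \<Longrightarrow> h x = c) \<Longrightarrow> (\<Union>x\<in>A. h x) = c"
  by auto

lemma UN_UN_constant:
  "a \<in> A \<Longrightarrow> b \<in> B \<Longrightarrow> (\<And>x y. x \<in> A \<Longrightarrow> y \<in> B \<Longrightarrow> h x y = c) \<Longrightarrow> (\<Union>x\<in>A. \<Union>y\<in>B. h x y) = c"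
  by auto

lemma tl_pre_simps:
  "Ob (tl_pre q) = UNIV" "idm (tl_pre q) = (\<lambda>n. tl_class q (TId n))"
  "zero (tl_pre q) = (\<lambda>m n. tl_class q (TZero m n))" "unit (tl_pre q) = 0"
  "tensO (tl_pre q) = (+)"
  by (simp_all add: tl_pre_def)

lemma tl_pre_cmp:
  assumes "tl_wf f" "tl_wf g" "tl_dom g = tl_cod f"
  shows "tl_class q g \<cdot>\<^bsub>tl_pre q\<^esub> tl_class q f = tl_class q (g \<bullet>\<^sub>T f)"
proof -
  have "tl_class q (g' \<bullet>\<^sub>T f') = tl_class q (g \<bullet>\<^sub>T f)" if "g' \<in> tl_class q g" "f' \<in> tl_class q f" for f' g'
    by (rule tl_class_eqI[symmetric], rule tl_eq.cong_comp[OF tl_typed_wfI])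
      (use assms that in \<open>auto simp: tl_class_def\<close>)
  from UN_UN_constant[OF tl_class_self[OF assms(2)] tl_class_self[OF assms(1)] this]
  show ?thesis by (simp add: tl_pre_def)
qed

lemma tl_pre_tensM:
  assumes "tl_wf f" "tl_wf g"
  shows "tl_class q f \<otimes>\<^bsub>tl_pre q\<^esub> tl_class q g = tl_class q (f \<otimes>\<^sub>T g)"
proof -
  have "tl_class q (f' \<otimes>\<^sub>T g') = tl_class q (f \<otimes>\<^sub>T g)" if "f' \<in> tl_class q f" "g' \<in> tl_class q g" for f' g'
    by (rule tl_class_eqI[symmetric], rule tl_eq.cong_tens) (use that in \<open>auto simp: tl_class_def\<close>)
  from UN_UN_constant[OF tl_class_self[OF assms(1)] tl_class_self[OF assms(2)] this]
  show ?thesis by (simp add: tl_pre_def)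
qed

lemma tl_pre_add:
  assumes "tl_wf f" "tl_wf g" "tl_dom f = tl_dom g" "tl_cod f = tl_cod g"
  shows "add (tl_pre q) (tl_class q f) (tl_class q g) = tl_class q (f +\<^sub>T g)"
proof -
  have "tl_class q (f' +\<^sub>T g') = tl_class q (f +\<^sub>T g)" if "f' \<in> tl_class q f" "g' \<in> tl_class q g" for f' g'
    by (rule tl_class_eqI[symmetric], rule tl_eq.cong_add[OF tl_typed_wfI])
      (use assms that in \<open>auto simp: tl_class_def\<close>)
  from UN_UN_constant[OF tl_class_self[OF assms(1)] tl_class_self[OF assms(2)] this]
  show ?thesis by (simp add: tl_pre_def)
qed

lemma tl_pre_scale:
  assumes "tl_wf f"
  shows "scale (tl_pre q) c (tl_class q f) = tl_class q (c *\<^sub>T f)"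
proof -
  have "tl_class q (c *\<^sub>T f') = tl_class q (c *\<^sub>T f)" if "f' \<in> tl_class q f" for f'
    by (rule tl_class_eqI[symmetric], rule tl_eq.cong_scale) (use that in \<open>auto simp: tl_class_def\<close>)
  from UN_constant_on[OF tl_class_self[OF assms] this]
  show ?thesis by (simp add: tl_pre_def)
qed

lemmas tl_pre_ops = tl_pre_cmp tl_pre_tensM tl_pre_add tl_pre_scale

lemma tl_pre_Hom: "F \<in> Hom (tl_pre q) m n \<longleftrightarrow> (\<exists>f. F = tl_class q f \<and> tl_wf f \<and> tl_dom f = m \<and> tl_cod f = n)"
  by (auto simp: tl_pre_def tl_typed_iff)

lemma tl_pre_arrow:
  "arrow (tl_pre q) F m n \<longleftrightarrow> (\<exists>f. F = tl_class q f \<and> tl_wf f \<and> tl_dom f = m \<and> tl_cod f = n)"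
  by (simp add: arrow_def tl_pre_Hom tl_pre_simps)

lemma tl_class_HomI: "tl_wf f \<Longrightarrow> tl_dom f = m \<Longrightarrow> tl_cod f = n \<Longrightarrow> tl_class q f \<in> Hom (tl_pre q) m n"
  by (auto simp: tl_pre_Hom)

lemma tl_pre_monoidal: "strict_lin_monoidal (tl_pre q)"
  apply (unfold_locales; (unfold tl_pre_arrow tl_pre_simps)?; ((elim exE conjE)+)?; (hypsubst)?)
  apply (simp_all only: tl_pre_ops tl_dom.simps tl_cod.simps tl_wf.simps simp_thms UNIV_I)
  apply (simp_all add: tl_pre_ops add.assoc)
  apply (simp_all add: tl_class_HomI)
  apply (rule_tac [!] tl_class_eqI)
  \<comment> \<open>The remaining goals are the generating equations themselves: after the seven
    rules for equivalence and congruence, \<open>tl_eq\<close> lists the laws of a strict linear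
    monoidal category, with \<open>interchange\<close> oriented the other way round.\<close>
  apply (rule tl_eq.intros(8-) tl_eq.sym[OF tl_eq.interchange] ; simp add: tl_typed_iff; fail)+
  done

section \<open>Additive completion\<close>

lemma div_mult_add: "y < n \<Longrightarrow> (x * n + y) div n = x" for x y n :: nat
  by (metis add.right_neutral div_less div_mult_self3 gr_implies_not0)

lemma map_upt_mult:
  "map h [0..<a * b] = concat (map (\<lambda>i. map (\<lambda>j. h (i * b + j)) [0..<b]) [0..<a])"
  by (simp add: upt_mult map_concat comp_def)

context strict_lin_monoidal
begin

abbreviation AddC where "AddC \<equiv> additive_completion C"

abbreviation list_tens :: "'o list \<Rightarrow> 'o list \<Rightarrow> 'o list" where
  "list_tens X Y \<equiv> concat (map (\<lambda>x. map (\<lambda>y. x \<odot> y) Y) X)"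

lemma length_list_tens: "length (list_tens X Y) = length X * length Y"
  by (simp add: length_concat_const)

lemma nth_list_tens:
  assumes "i < length X * length Y"
  shows "list_tens X Y ! i = X ! (i div length Y) \<odot> Y ! (i mod length Y)"
proof -
  have "length Y > 0" using assms by (auto intro: gr0I)
  then show ?thesis using nth_concat_const[OF assms, of "\<lambda>x. map (\<lambda>y. x \<odot> y) Y"] by simp
qed

lemma list_tens_assoc:
  assumes "set X \<subseteq> Ob C" "set Y \<subseteq> Ob C" "set Z \<subseteq> Ob C"
  shows "list_tens (list_tens X Y) Z = list_tens X (list_tens Y Z)"
proof -
  have *: "list_tens (map (\<lambda>y. x \<odot> y) Y) Z = map (\<lambda>y. x \<odot> y) (list_tens Y Z)" if "x \<in> Ob C" for x
    using assms(2,3) that by (induction Y) (auto simp: tensO_assoc)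
  show ?thesis using assms(1) by (induction X) (auto simp: * simp del: map_map)
qed

lemma additive_sel:
  "Ob AddC = lists (Ob C)" "unit AddC = [unit C]" "tensO AddC = list_tens"
  "src (idm AddC X) = X" "tgt (idm AddC X) = X"
  "src (zero AddC X Y) = X" "tgt (zero AddC X Y) = Y"
  "src (g \<cdot>\<^bsub>AddC\<^esub> f) = src f" "tgt (g \<cdot>\<^bsub>AddC\<^esub> f) = tgt g"
  "src (add AddC f g) = src f" "tgt (add AddC f g) = tgt f"
  "src (scale AddC c f) = src f" "tgt (scale AddC c f) = tgt f"
  "src (f \<otimes>\<^bsub>AddC\<^esub> g) = list_tens (src f) (src g)" "tgt (f \<otimes>\<^bsub>AddC\<^esub> g) = list_tens (tgt f) (tgt g)"
  by (simp_all add: additive_completion_def Let_def)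

lemma additive_entry:
  "i < length X \<Longrightarrow> j < length X \<Longrightarrow>
    dat (idm AddC X) (i, j) = (if i = j then idm C (X ! i) else zero C (X ! j) (X ! i))"
  "i < length Y \<Longrightarrow> j < length X \<Longrightarrow> dat (zero AddC X Y) (i, j) = zero C (X ! j) (Y ! i)"
  "i < length (tgt g) \<Longrightarrow> j < length (src f) \<Longrightarrow> dat (g \<cdot>\<^bsub>AddC\<^esub> f) (i, j) =
    csum C (src f ! j) (tgt g ! i) (map (\<lambda>l. dat g (i, l) \<cdot> dat f (l, j)) [0..<length (tgt f)])"
  "i < length (tgt f) \<Longrightarrow> j < length (src f) \<Longrightarrow> dat (add AddC f g) (i, j) = add C (dat f (i, j)) (dat g (i, j))"
  "i < length (tgt f) \<Longrightarrow> j < length (src f) \<Longrightarrow> dat (scale AddC c f) (i, j) = scale C c (dat f (i, j))"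
  "i < length (tgt f) * length (tgt g) \<Longrightarrow> j < length (src f) * length (src g) \<Longrightarrow>
    dat (f \<otimes>\<^bsub>AddC\<^esub> g) (i, j) = dat f (i div length (tgt g), j div length (src g)) \<otimes>
      dat g (i mod length (tgt g), j mod length (src g))"
  by (simp_all add: additive_completion_def Let_def length_list_tens)

lemma additive_ext:
  "dat (idm AddC X) \<in> extensional (mat_index X X)"
  "dat (zero AddC X Y) \<in> extensional (mat_index X Y)"
  "dat (g \<cdot>\<^bsub>AddC\<^esub> f) \<in> extensional (mat_index (src f) (tgt g))"
  "dat (add AddC f g) \<in> extensional (mat_index (src f) (tgt f))"
  "dat (scale AddC c f) \<in> extensional (mat_index (src f) (tgt f))"
  "dat (f \<otimes>\<^bsub>AddC\<^esub> g) \<in> extensional (mat_index (list_tens (src f) (src g)) (list_tens (tgt f) (tgt g)))"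
  by (simp_all add: additive_completion_def Let_def)

lemma additive_HomI:
  assumes "set X \<subseteq> Ob C" "set Y \<subseteq> Ob C" "src f = X" "tgt f = Y" "dat f \<in> extensional (mat_index X Y)"
    and "\<And>i j. i < length Y \<Longrightarrow> j < length X \<Longrightarrow> arrow C (dat f (i, j)) (X ! j) (Y ! i)"
  shows "f \<in> Hom AddC X Y"
proof -
  have "dat f \<in> PiE (mat_index X Y) (\<lambda>(i, j). Hom C (X ! j) (Y ! i))"
    using assms by (auto simp: PiE_def arrow_def)
  then show ?thesis using assms(3,4) by (cases f) (auto simp: additive_completion_def)
qed

lemma additive_arrowD:
  assumes "arrow AddC f X Y"
  shows "src f = X" "tgt f = Y" "set X \<subseteq> Ob C" "set Y \<subseteq> Ob C" "dat f \<in> extensional (mat_index X Y)"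
    "i < length Y \<Longrightarrow> j < length X \<Longrightarrow> arrow C (dat f (i, j)) (X ! j) (Y ! i)"
proof -
  have f: "f \<in> Hom AddC X Y" and X: "set X \<subseteq> Ob C" and Y: "set Y \<subseteq> Ob C"
    using assms by (auto simp: arrow_def additive_sel)
  then obtain d where d: "f = Arr X Y d" "d \<in> PiE (mat_index X Y) (\<lambda>(i, j). Hom C (X ! j) (Y ! i))"
    by (auto simp: additive_completion_def)
  show "src f = X" "tgt f = Y" "set X \<subseteq> Ob C" "set Y \<subseteq> Ob C" "dat f \<in> extensional (mat_index X Y)"
    using d X Y by (auto simp: PiE_def)
  show "arrow C (dat f (i, j)) (X ! j) (Y ! i)" if "i < length Y" "j < length X"
    using PiE_mem[OF d(2), of "(i, j)"] that X Y d by (auto simp: arrow_def)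
qed

lemma additive_eqI:
  assumes "src f = X" "tgt f = Y" "dat f \<in> extensional (mat_index X Y)"
    and "src g = X" "tgt g = Y" "dat g \<in> extensional (mat_index X Y)"
    and "\<And>i j. i < length Y \<Longrightarrow> j < length X \<Longrightarrow> dat f (i, j) = dat g (i, j)"
  shows "f = g"
proof -
  have "dat f = dat g" by (rule extensionalityI[OF assms(3,6)]) (use assms(7) in auto)
  then show ?thesis using assms by (cases f; cases g) auto
qed

lemma split_index:
  fixes i a b :: nat assumes "i < a * b" shows "i div b < a" "i mod b < b" "0 < b"
proof -
  show "0 < b" using assms by (auto intro: gr0I)
  then show "i mod b < b" by simp
  show "i div b < a" using assms by (simp add: less_mult_imp_div_less)
qed

text \<open>Decoding a number into a triple of indices gives the same digits for either bracketing
  of a threefold product; this makes the Kronecker product strictly associative.\<close>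

lemma split_index2:
  fixes i a b :: nat
  shows "i mod (a * b) div b = i div b mod a" "i mod (a * b) mod b = i mod b" "i div (a * b) = i div b div a"
  by (cases "b = 0"; simp add: mod_mult2_eq[of i b a, simplified mult.commute] div_mult2_eq[symmetric] mult.commute mod_mod_cancel)+

lemma additive_tensM_arrow:
  assumes f: "arrow AddC f X Y" and g: "arrow AddC g X' Y'"
    and i: "i < length Y * length Y'" and j: "j < length X * length X'"
  shows "arrow C (dat f (i div length Y', j div length X') \<otimes> dat g (i mod length Y', j mod length X'))
    (list_tens X X' ! j) (list_tens Y Y' ! i)"
  unfolding nth_list_tens[OF i] nth_list_tens[OF j]
  by (intro arrow_tensM additive_arrowD(6)[OF f] additive_arrowD(6)[OF g] split_index[OF i] split_index[OF j])

lemma list_tens_Ob: "set X \<subseteq> Ob C \<Longrightarrow> set Y \<subseteq> Ob C \<Longrightarrow> set (list_tens X Y) \<subseteq> Ob C"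
  by (auto intro!: tensO_Ob)

lemma additive_Hom:
  "set X \<subseteq> Ob C \<Longrightarrow> idm AddC X \<in> Hom AddC X X"
  "set X \<subseteq> Ob C \<Longrightarrow> set Y \<subseteq> Ob C \<Longrightarrow> zero AddC X Y \<in> Hom AddC X Y"
  "arrow AddC f X Y \<Longrightarrow> arrow AddC g Y Z \<Longrightarrow> g \<cdot>\<^bsub>AddC\<^esub> f \<in> Hom AddC X Z"
  "arrow AddC f X Y \<Longrightarrow> arrow AddC f' X Y \<Longrightarrow> add AddC f f' \<in> Hom AddC X Y"
  "arrow AddC f X Y \<Longrightarrow> scale AddC c f \<in> Hom AddC X Y"
  "arrow AddC f X Y \<Longrightarrow> arrow AddC h X' Y' \<Longrightarrow> f \<otimes>\<^bsub>AddC\<^esub> h \<in> Hom AddC (list_tens X X') (list_tens Y Y')"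
proof -
  show "idm AddC X \<in> Hom AddC X X" if "set X \<subseteq> Ob C"
    by (rule additive_HomI)
      (use that in \<open>auto simp: additive_sel additive_ext additive_entry intro!: arrow_idm arrow_zero\<close>)
  show "zero AddC X Y \<in> Hom AddC X Y" if "set X \<subseteq> Ob C" "set Y \<subseteq> Ob C"
    by (rule additive_HomI)
      (use that in \<open>auto simp: additive_sel additive_ext additive_entry intro!: arrow_zero\<close>)
  show "g \<cdot>\<^bsub>AddC\<^esub> f \<in> Hom AddC X Z" if f: "arrow AddC f X Y" and g: "arrow AddC g Y Z"
  proof (rule additive_HomI)
    note fg = additive_arrowD(1-5)[OF f] additive_arrowD(1-5)[OF g]
    show "dat (g \<cdot>\<^bsub>AddC\<^esub> f) \<in> extensional (mat_index X Z)" using additive_ext(3)[of g f] fg by simp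
    fix i j assume ij: "i < length Z" "j < length X"
    have "arrow C (dat g (i, l) \<cdot> dat f (l, j)) (X ! j) (Z ! i)" if "l < length Y" for l
      by (rule arrow_cmp[OF additive_arrowD(6)[OF f that ij(2)] additive_arrowD(6)[OF g ij(1) that]])
    then show "arrow C (dat (g \<cdot>\<^bsub>AddC\<^esub> f) (i, j)) (X ! j) (Z ! i)"
      using fg ij by (auto simp: additive_entry intro!: arrow_csum)
  qed (use additive_arrowD(1-5)[OF f] additive_arrowD(1-5)[OF g] in \<open>auto simp: additive_sel\<close>)
  show "add AddC f f' \<in> Hom AddC X Y" if f: "arrow AddC f X Y" and g: "arrow AddC f' X Y"
    by (rule additive_HomI) (use additive_arrowD[OF f] additive_arrowD[OF g] additive_ext(4)[of f f'] in
      \<open>auto simp: additive_sel additive_entry intro!: arrow_add\<close>)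
  show "scale AddC c f \<in> Hom AddC X Y" if f: "arrow AddC f X Y"
    by (rule additive_HomI) (use additive_arrowD[OF f] additive_ext(5)[of c f] in
      \<open>auto simp: additive_sel additive_entry intro!: arrow_scale\<close>)
  show "f \<otimes>\<^bsub>AddC\<^esub> h \<in> Hom AddC (list_tens X X') (list_tens Y Y')" if f: "arrow AddC f X Y" and h: "arrow AddC h X' Y'"
  proof (rule additive_HomI)
    note fh = additive_arrowD(1-5)[OF f] additive_arrowD(1-5)[OF h]
    show "set (list_tens X X') \<subseteq> Ob C" "set (list_tens Y Y') \<subseteq> Ob C" using fh list_tens_Ob by blast+
    show "dat (f \<otimes>\<^bsub>AddC\<^esub> h) \<in> extensional (mat_index (list_tens X X') (list_tens Y Y'))"
      using additive_ext(6)[of f h] fh by simp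
    fix i j assume "i < length (list_tens Y Y')" "j < length (list_tens X X')"
    then show "arrow C (dat (f \<otimes>\<^bsub>AddC\<^esub> h) (i, j)) (list_tens X X' ! j) (list_tens Y Y' ! i)"
      using additive_tensM_arrow[OF f h, of i j] fh by (simp add: length_list_tens additive_entry)
  qed (use additive_arrowD(1-5)[OF f] additive_arrowD(1-5)[OF h] in \<open>simp_all add: additive_sel\<close>)
qed

lemma additive_arrow:
  "set X \<subseteq> Ob C \<Longrightarrow> arrow AddC (idm AddC X) X X"
  "arrow AddC f X Y \<Longrightarrow> arrow AddC g Y Z \<Longrightarrow> arrow AddC (g \<cdot>\<^bsub>AddC\<^esub> f) X Z"
  "arrow AddC f X Y \<Longrightarrow> arrow AddC h X' Y' \<Longrightarrow> arrow AddC (f \<otimes>\<^bsub>AddC\<^esub> h) (list_tens X X') (list_tens Y Y')"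
  subgoal by (simp add: arrow_def additive_sel additive_Hom subset_eq in_lists_conv_set)
  subgoal premises p
    using additive_Hom(3)[OF p] p by (simp add: arrow_def)
  subgoal premises p
    using additive_Hom(6)[OF p] additive_arrowD(3,4)[OF p(1)] additive_arrowD(3,4)[OF p(2)] list_tens_Ob[of X X']
      list_tens_Ob[of Y Y'] by (simp add: arrow_def additive_sel subset_eq in_lists_conv_set)
  done

lemma additive_arrow_eqI:
  assumes f: "arrow AddC f X Y" and g: "arrow AddC g X Y"
    and "\<And>i j. i < length Y \<Longrightarrow> j < length X \<Longrightarrow> dat f (i, j) = dat g (i, j)"
  shows "f = g"
  using additive_eqI[OF additive_arrowD(1,2,5)[OF f] additive_arrowD(1,2,5)[OF g]] assms(3) by blast

lemma additive_idm_left: assumes f: "arrow AddC f X Y" shows "idm AddC Y \<cdot>\<^bsub>AddC\<^esub> f = f"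
proof (rule additive_arrow_eqI[OF _ f])
  note [simp] = additive_arrowD(1-2)[OF f]
  show "arrow AddC (idm AddC Y \<cdot>\<^bsub>AddC\<^esub> f) X Y" by (rule additive_arrow(2)[OF f additive_arrow(1)[OF additive_arrowD(4)[OF f]]])
  fix i j assume ij: "i < length Y" "j < length X"
  have a: "arrow C (dat f (l, j)) (X ! j) (Y ! l)" if "l < length Y" for l
    using additive_arrowD(6)[OF f that ij(2)] .
  have Ob: "X ! j \<in> Ob C" "Y ! i \<in> Ob C" using ij additive_arrowD(3,4)[OF f] by auto
  have "dat (idm AddC Y \<cdot>\<^bsub>AddC\<^esub> f) (i, j) =
      csum C (X ! j) (Y ! i) (map (\<lambda>l. dat (idm AddC Y) (i, l) \<cdot> dat f (l, j)) [0..<length Y])"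
    using ij by (simp add: additive_sel additive_entry)
  also have "\<dots> = dat (idm AddC Y) (i, i) \<cdot> dat f (i, j)"
    by (rule csum_delta) (use ij a Ob in \<open>auto simp: additive_entry cmp_zero_left[OF a] intro!: arrow_cmp[OF a] arrow_idm\<close>)
  also have "\<dots> = dat f (i, j)" using ij idm_left[OF a] by (simp add: additive_entry)
  finally show "dat (idm AddC Y \<cdot>\<^bsub>AddC\<^esub> f) (i, j) = dat f (i, j)" .
qed

lemma additive_idm_right: assumes f: "arrow AddC f X Y" shows "f \<cdot>\<^bsub>AddC\<^esub> idm AddC X = f"
proof (rule additive_arrow_eqI[OF _ f])
  note [simp] = additive_arrowD(1-2)[OF f]
  show "arrow AddC (f \<cdot>\<^bsub>AddC\<^esub> idm AddC X) X Y" by (rule additive_arrow(2)[OF additive_arrow(1)[OF additive_arrowD(3)[OF f]] f])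
  fix i j assume ij: "i < length Y" "j < length X"
  have a: "arrow C (dat f (i, l)) (X ! l) (Y ! i)" if "l < length X" for l
    using additive_arrowD(6)[OF f ij(1) that] .
  have Ob: "X ! j \<in> Ob C" "Y ! i \<in> Ob C" using ij additive_arrowD(3,4)[OF f] by auto
  have "dat (f \<cdot>\<^bsub>AddC\<^esub> idm AddC X) (i, j) =
      csum C (X ! j) (Y ! i) (map (\<lambda>l. dat f (i, l) \<cdot> dat (idm AddC X) (l, j)) [0..<length X])"
    using ij by (simp add: additive_sel additive_entry)
  also have "\<dots> = dat f (i, j) \<cdot> dat (idm AddC X) (j, j)"
    by (rule csum_delta) (use ij a Ob in \<open>auto simp: additive_entry cmp_zero_right[OF a] intro!: arrow_cmp[OF _ a] arrow_idm\<close>)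
  also have "\<dots> = dat f (i, j)" using ij idm_right[OF a] by (simp add: additive_entry)
  finally show "dat (f \<cdot>\<^bsub>AddC\<^esub> idm AddC X) (i, j) = dat f (i, j)" .
qed

text \<open>Entrywise, both bracketings are the double sum over the two intermediate indices, with
  the summations in opposite order.\<close>

lemma additive_cmp_assoc:
  assumes f: "arrow AddC f W X" and g: "arrow AddC g X Y" and h: "arrow AddC h Y Z"
  shows "(h \<cdot>\<^bsub>AddC\<^esub> g) \<cdot>\<^bsub>AddC\<^esub> f = h \<cdot>\<^bsub>AddC\<^esub> (g \<cdot>\<^bsub>AddC\<^esub> f)"
proof (rule additive_arrow_eqI)
  note [simp] = additive_arrowD(1-2)[OF f] additive_arrowD(1-2)[OF g] additive_arrowD(1-2)[OF h]
  show "arrow AddC ((h \<cdot>\<^bsub>AddC\<^esub> g) \<cdot>\<^bsub>AddC\<^esub> f) W Z" "arrow AddC (h \<cdot>\<^bsub>AddC\<^esub> (g \<cdot>\<^bsub>AddC\<^esub> f)) W Z"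
    by (rule additive_arrow(2)[OF f additive_arrow(2)[OF g h]] additive_arrow(2)[OF additive_arrow(2)[OF f g] h])+
  fix i j assume ij: "i < length Z" "j < length W"
  note af = additive_arrowD(6)[OF f _ ij(2)] and ag = additive_arrowD(6)[OF g] and ah = additive_arrowD(6)[OF h ij(1)]
  have Ob: "W ! j \<in> Ob C" "Z ! i \<in> Ob C" using ij additive_arrowD(3,4)[OF f] additive_arrowD(4)[OF h] by auto
  let ?t = "\<lambda>k l. dat h (i, k) \<cdot> (dat g (k, l) \<cdot> dat f (l, j))"
  have 1: "csum C (X ! l) (Z ! i) (map (\<lambda>k. dat h (i, k) \<cdot> dat g (k, l)) [0..<length Y]) \<cdot> dat f (l, j) =
    csum C (W ! j) (Z ! i) (map (\<lambda>k. ?t k l) [0..<length Y])" if l: "l < length X" for l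
  proof -
    have "csum C (X ! l) (Z ! i) (map (\<lambda>k. dat h (i, k) \<cdot> dat g (k, l)) [0..<length Y]) \<cdot> dat f (l, j) =
      csum C (W ! j) (Z ! i) (map (\<lambda>k. (dat h (i, k) \<cdot> dat g (k, l)) \<cdot> dat f (l, j)) [0..<length Y])"
      by (rule csum_cmp_right[OF af[OF l] Ob(2)]) (use l in \<open>auto intro!: arrow_cmp[OF ag ah]\<close>)
    also have "\<dots> = csum C (W ! j) (Z ! i) (map (\<lambda>k. ?t k l) [0..<length Y])"
      by (intro arg_cong[where f = "csum C _ _"] map_cong HOL.refl cmp_assoc[OF af[OF l] ag[OF _ l] ah]) auto
    finally show ?thesis .
  qed
  have 2: "dat h (i, k) \<cdot> csum C (W ! j) (Y ! k) (map (\<lambda>l. dat g (k, l) \<cdot> dat f (l, j)) [0..<length X]) =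
    csum C (W ! j) (Z ! i) (map (\<lambda>l. ?t k l) [0..<length X])" if k: "k < length Y" for k
    by (rule csum_cmp_left[OF Ob(1) ah[OF k]]) (use k in \<open>auto intro!: arrow_cmp[OF af ag]\<close>)
  have "dat ((h \<cdot>\<^bsub>AddC\<^esub> g) \<cdot>\<^bsub>AddC\<^esub> f) (i, j) =
    csum C (W ! j) (Z ! i) (map (\<lambda>l. csum C (W ! j) (Z ! i) (map (\<lambda>k. ?t k l) [0..<length Y])) [0..<length X])"
    using ij 1 by (auto simp: additive_sel additive_entry intro!: arg_cong[where f = "csum C _ _"])
  also have "\<dots> = csum C (W ! j) (Z ! i) (map (\<lambda>k. csum C (W ! j) (Z ! i) (map (\<lambda>l. ?t k l) [0..<length X])) [0..<length Y])"
    by (rule csum_swap[OF Ob]) (auto intro!: arrow_cmp[OF arrow_cmp[OF af ag] ah])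
  also have "\<dots> = dat (h \<cdot>\<^bsub>AddC\<^esub> (g \<cdot>\<^bsub>AddC\<^esub> f)) (i, j)"
    using ij 2 by (auto simp: additive_sel additive_entry intro!: arg_cong[where f = "csum C _ _"])
  finally show "dat ((h \<cdot>\<^bsub>AddC\<^esub> g) \<cdot>\<^bsub>AddC\<^esub> f) (i, j) = dat (h \<cdot>\<^bsub>AddC\<^esub> (g \<cdot>\<^bsub>AddC\<^esub> f)) (i, j)" .
qed

text \<open>An intermediate index of the tensor product is a pair \<open>(a, b)\<close>. By
  interchange in \<open>C\<close> the summand at that pair is a tensor product of one factor
  depending on \<open>a\<close> and one depending on \<open>b\<close>, so bilinearity factors the
  sum.\<close>

lemma additive_interchange:
  assumes f: "arrow AddC f X Y" and g: "arrow AddC g Y Z" and f': "arrow AddC f' X' Y'" and g': "arrow AddC g' Y' Z'"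
  shows "(g \<otimes>\<^bsub>AddC\<^esub> g') \<cdot>\<^bsub>AddC\<^esub> (f \<otimes>\<^bsub>AddC\<^esub> f') = (g \<cdot>\<^bsub>AddC\<^esub> f) \<otimes>\<^bsub>AddC\<^esub> (g' \<cdot>\<^bsub>AddC\<^esub> f')"
proof (rule additive_arrow_eqI)
  note [simp] = additive_arrowD(1-2)[OF f] additive_arrowD(1-2)[OF g] additive_arrowD(1-2)[OF f'] additive_arrowD(1-2)[OF g']
  show "arrow AddC ((g \<otimes>\<^bsub>AddC\<^esub> g') \<cdot>\<^bsub>AddC\<^esub> (f \<otimes>\<^bsub>AddC\<^esub> f')) (list_tens X X') (list_tens Z Z')"
    "arrow AddC ((g \<cdot>\<^bsub>AddC\<^esub> f) \<otimes>\<^bsub>AddC\<^esub> (g' \<cdot>\<^bsub>AddC\<^esub> f')) (list_tens X X') (list_tens Z Z')"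
    by (rule additive_arrow(2)[OF additive_arrow(3)[OF f f'] additive_arrow(3)[OF g g']]
      additive_arrow(3)[OF additive_arrow(2)[OF f g] additive_arrow(2)[OF f' g']])+
  fix i j assume ij0: "i < length (list_tens Z Z')" "j < length (list_tens X X')"
  then have ij: "i < length Z * length Z'" "j < length X * length X'" by (simp_all add: length_list_tens)
  define i1 i2 j1 j2 where "i1 = i div length Z'" and "i2 = i mod length Z'"
    and "j1 = j div length X'" and "j2 = j mod length X'"
  note ijd = this
  have b: "i1 < length Z" "i2 < length Z'" "j1 < length X" "j2 < length X'"
    using split_index[OF ij(1)] split_index[OF ij(2)] by (simp_all add: ijd)
  note af = additive_arrowD(6)[OF f _ b(3)] and ag = additive_arrowD(6)[OF g b(1)]
    and af' = additive_arrowD(6)[OF f' _ b(4)] and ag' = additive_arrowD(6)[OF g' b(2)]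
  have Ob: "X ! j1 \<in> Ob C" "X' ! j2 \<in> Ob C" "Z ! i1 \<in> Ob C" "Z' ! i2 \<in> Ob C"
    using b additive_arrowD(3,4)[OF f] additive_arrowD(3,4)[OF f'] additive_arrowD(4)[OF g] additive_arrowD(4)[OF g'] by auto
  have nth: "list_tens X X' ! j = X ! j1 \<odot> X' ! j2" "list_tens Z Z' ! i = Z ! i1 \<odot> Z' ! i2"
    using ij by (simp_all add: nth_list_tens ijd)
  let ?S = "csum C (X ! j1 \<odot> X' ! j2) (Z ! i1 \<odot> Z' ! i2)"
  let ?u = "\<lambda>a. dat g (i1, a) \<cdot> dat f (a, j1)" and ?v = "\<lambda>b. dat g' (i2, b) \<cdot> dat f' (b, j2)"
  have u: "arrow C (?u a) (X ! j1) (Z ! i1)" if "a < length Y" for a using arrow_cmp[OF af ag] that by blast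
  have v: "arrow C (?v a) (X' ! j2) (Z' ! i2)" if "a < length Y'" for a using arrow_cmp[OF af' ag'] that by blast
  have "dat ((g \<otimes>\<^bsub>AddC\<^esub> g') \<cdot>\<^bsub>AddC\<^esub> (f \<otimes>\<^bsub>AddC\<^esub> f')) (i, j) =
    ?S (map (\<lambda>l. dat (g \<otimes>\<^bsub>AddC\<^esub> g') (i, l) \<cdot> dat (f \<otimes>\<^bsub>AddC\<^esub> f') (l, j)) [0..<length Y * length Y'])"
    using ij0 by (simp add: additive_sel additive_entry nth[symmetric] length_list_tens)
  also have "\<dots> = ?S (map (\<lambda>l. ?u (l div length Y') \<otimes> ?v (l mod length Y')) [0..<length Y * length Y'])"
  proof (intro arg_cong[where f = ?S] map_cong HOL.refl)
    fix l assume "l \<in> set [0..<length Y * length Y']"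
    then have l: "l < length Y * length Y'" by simp
    note ll = split_index[OF l]
    show "dat (g \<otimes>\<^bsub>AddC\<^esub> g') (i, l) \<cdot> dat (f \<otimes>\<^bsub>AddC\<^esub> f') (l, j) = ?u (l div length Y') \<otimes> ?v (l mod length Y')"
      using ij l interchange[OF af[OF ll(1)] ag[OF ll(1)] af'[OF ll(2)] ag'[OF ll(2)]]
      by (simp add: additive_entry ijd)
  qed
  also have "\<dots> = ?S (concat (map (\<lambda>a. map (\<lambda>b. ?u a \<otimes> ?v b) [0..<length Y']) [0..<length Y]))"
    unfolding map_upt_mult[of _ "length Y" "length Y'"]
    by (intro arg_cong[where f = ?S] arg_cong[where f = concat] map_cong HOL.refl) (simp add: div_mult_add)
  also have "\<dots> = ?S (map (\<lambda>a. ?S (map (\<lambda>b. ?u a \<otimes> ?v b) [0..<length Y'])) [0..<length Y])"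
    by (rule csum_concat) (use Ob in \<open>auto intro!: tensO_Ob arrow_tensM u v\<close>)
  also have "\<dots> = ?S (map (\<lambda>a. ?u a \<otimes> csum C (X' ! j2) (Z' ! i2) (map ?v [0..<length Y'])) [0..<length Y])"
    by (intro arg_cong[where f = ?S] map_cong HOL.refl csum_tens_left[symmetric]) (use Ob u v in auto)
  also have "\<dots> = csum C (X ! j1) (Z ! i1) (map ?u [0..<length Y]) \<otimes> csum C (X' ! j2) (Z' ! i2) (map ?v [0..<length Y'])"
    by (rule csum_tens_right[symmetric]) (use Ob u v in \<open>auto intro!: arrow_csum\<close>)
  also have "\<dots> = dat ((g \<cdot>\<^bsub>AddC\<^esub> f) \<otimes>\<^bsub>AddC\<^esub> (g' \<cdot>\<^bsub>AddC\<^esub> f')) (i, j)"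
    using ij b by (simp add: additive_sel additive_entry ijd[symmetric])
  finally show "dat ((g \<otimes>\<^bsub>AddC\<^esub> g') \<cdot>\<^bsub>AddC\<^esub> (f \<otimes>\<^bsub>AddC\<^esub> f')) (i, j) = dat ((g \<cdot>\<^bsub>AddC\<^esub> f) \<otimes>\<^bsub>AddC\<^esub> (g' \<cdot>\<^bsub>AddC\<^esub> f')) (i, j)" .
qed

lemma additive_tensM_assoc:
  assumes f: "arrow AddC f X X'" and g: "arrow AddC g Y Y'" and h: "arrow AddC h Z Z'"
  shows "(f \<otimes>\<^bsub>AddC\<^esub> g) \<otimes>\<^bsub>AddC\<^esub> h = f \<otimes>\<^bsub>AddC\<^esub> (g \<otimes>\<^bsub>AddC\<^esub> h)"
proof (rule additive_arrow_eqI)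
  note [simp] = additive_arrowD(1-2)[OF f] additive_arrowD(1-2)[OF g] additive_arrowD(1-2)[OF h]
  note Ob = additive_arrowD(3,4)[OF f] additive_arrowD(3,4)[OF g] additive_arrowD(3,4)[OF h]
  show "arrow AddC ((f \<otimes>\<^bsub>AddC\<^esub> g) \<otimes>\<^bsub>AddC\<^esub> h) (list_tens (list_tens X Y) Z) (list_tens (list_tens X' Y') Z')"
    by (rule additive_arrow(3)[OF additive_arrow(3)[OF f g] h])
  show "arrow AddC (f \<otimes>\<^bsub>AddC\<^esub> (g \<otimes>\<^bsub>AddC\<^esub> h)) (list_tens (list_tens X Y) Z) (list_tens (list_tens X' Y') Z')"
    using additive_arrow(3)[OF f additive_arrow(3)[OF g h]] Ob by (simp only: list_tens_assoc)
  fix i j assume "i < length (list_tens (list_tens X' Y') Z')" "j < length (list_tens (list_tens X Y) Z)"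
  then have ij: "i < length X' * length Y' * length Z'" "j < length X * length Y * length Z"
    by (simp_all only: length_list_tens)
  then have ij': "i < length X' * (length Y' * length Z')" "j < length X * (length Y * length Z)"
    by (simp_all only: mult.assoc)
  note s = split_index[OF ij(1)] split_index[OF ij(2)] split_index[OF ij'(1)] split_index[OF ij'(2)]
  note s' = split_index[OF s(1)] split_index[OF s(4)]
  show "dat ((f \<otimes>\<^bsub>AddC\<^esub> g) \<otimes>\<^bsub>AddC\<^esub> h) (i, j) = dat (f \<otimes>\<^bsub>AddC\<^esub> (g \<otimes>\<^bsub>AddC\<^esub> h)) (i, j)"
    using ij ij' s s' tensM_assoc[OF additive_arrowD(6)[OF f s'(1) s'(4)] additive_arrowD(6)[OF g s'(2) s'(5)]
      additive_arrowD(6)[OF h s(2) s(5)]]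
    by (simp add: additive_sel additive_entry length_list_tens split_index2 mult.assoc)
qed

lemma additive_tensM_idm:
  assumes "set X \<subseteq> Ob C" "set Y \<subseteq> Ob C"
  shows "idm AddC X \<otimes>\<^bsub>AddC\<^esub> idm AddC Y = idm AddC (list_tens X Y)"
proof (rule additive_arrow_eqI)
  show "arrow AddC (idm AddC X \<otimes>\<^bsub>AddC\<^esub> idm AddC Y) (list_tens X Y) (list_tens X Y)"
    "arrow AddC (idm AddC (list_tens X Y)) (list_tens X Y) (list_tens X Y)"
    by (rule additive_arrow(3)[OF additive_arrow(1)[OF assms(1)] additive_arrow(1)[OF assms(2)]]
      additive_arrow(1)[OF list_tens_Ob[OF assms]])+
  fix i j assume "i < length (list_tens X Y)" "j < length (list_tens X Y)"
  then have ij: "i < length X * length Y" "j < length X * length Y" by (simp_all only: length_list_tens)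
  note s = split_index[OF ij(1)] split_index[OF ij(2)]
  have Ob: "X ! k \<in> Ob C" if "k < length X" for k using that assms by auto
  have Ob': "Y ! k \<in> Ob C" if "k < length Y" for k using that assms by auto
  \<comment> \<open>An entry off the diagonal has at least one pair of digits that differ, and one
    zero factor makes the entry zero.\<close>
  have eq: "i = j \<longleftrightarrow> i div length Y = j div length Y \<and> i mod length Y = j mod length Y"
    by (metis div_mult_mod_eq)
  show "dat (idm AddC X \<otimes>\<^bsub>AddC\<^esub> idm AddC Y) (i, j) = dat (idm AddC (list_tens X Y)) (i, j)"
    using ij s Ob Ob' unfolding additive_entry(6)[of i "idm AddC X" "idm AddC Y" j, unfolded additive_sel, OF ij]
    by (auto simp: additive_entry length_list_tens nth_list_tens eq additive_sel tensM_idm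
        tensM_zero_left[OF arrow_idm] tensM_zero_right[OF arrow_idm] tensM_zero_left[OF arrow_zero])
qed

lemma additive_arrow_add: "arrow AddC f X Y \<Longrightarrow> arrow AddC g X Y \<Longrightarrow> arrow AddC (add AddC f g) X Y"
  using additive_Hom(4) by (auto simp: arrow_def)

lemma additive_arrow_scale: "arrow AddC f X Y \<Longrightarrow> arrow AddC (scale AddC c f) X Y"
  using additive_Hom(5) by (auto simp: arrow_def)

lemma additive_arrow_zero: "arrow AddC f X Y \<Longrightarrow> arrow AddC (zero AddC X Y) X Y"
  using additive_Hom(2)[OF additive_arrowD(3,4)] by (auto simp: arrow_def)

lemma additive_cmp_add_left:
  assumes f: "arrow AddC f X Y" and g: "arrow AddC g Y Z" and h: "arrow AddC h Y Z"
  shows "add AddC g h \<cdot>\<^bsub>AddC\<^esub> f = add AddC (g \<cdot>\<^bsub>AddC\<^esub> f) (h \<cdot>\<^bsub>AddC\<^esub> f)"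
proof (rule additive_arrow_eqI[OF additive_arrow(2)[OF f additive_arrow_add[OF g h]]
      additive_arrow_add[OF additive_arrow(2)[OF f g] additive_arrow(2)[OF f h]]])
  note [simp] = additive_arrowD(1-2)[OF f] additive_arrowD(1-2)[OF g] additive_arrowD(1-2)[OF h]
  fix i j assume ij: "i < length Z" "j < length X"
  note af = additive_arrowD(6)[OF f _ ij(2)] and ag = additive_arrowD(6)[OF g ij(1)] and ah = additive_arrowD(6)[OF h ij(1)]
  have Ob: "X ! j \<in> Ob C" "Z ! i \<in> Ob C" using ij additive_arrowD(3)[OF f] additive_arrowD(4)[OF g] by auto
  have "dat (add AddC g h \<cdot>\<^bsub>AddC\<^esub> f) (i, j) = csum C (X ! j) (Z ! i)
      (map (\<lambda>l. add C (dat g (i, l) \<cdot> dat f (l, j)) (dat h (i, l) \<cdot> dat f (l, j))) [0..<length Y])"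
    using ij cmp_add_left[OF af ag ah]
    by (auto simp: additive_sel additive_entry intro!: arg_cong[where f = "csum C _ _"])
  also have "\<dots> = add C (csum C (X ! j) (Z ! i) (map (\<lambda>l. dat g (i, l) \<cdot> dat f (l, j)) [0..<length Y]))
      (csum C (X ! j) (Z ! i) (map (\<lambda>l. dat h (i, l) \<cdot> dat f (l, j)) [0..<length Y]))"
    by (rule csum_add) (use Ob in \<open>auto intro!: arrow_cmp[OF af ag] arrow_cmp[OF af ah]\<close>)
  finally show "dat (add AddC g h \<cdot>\<^bsub>AddC\<^esub> f) (i, j) = dat (add AddC (g \<cdot>\<^bsub>AddC\<^esub> f) (h \<cdot>\<^bsub>AddC\<^esub> f)) (i, j)"
    using ij by (simp add: additive_sel additive_entry)
qed

lemma additive_cmp_add_right: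
  assumes f: "arrow AddC f X Y" and g: "arrow AddC g X Y" and h: "arrow AddC h Y Z"
  shows "h \<cdot>\<^bsub>AddC\<^esub> add AddC f g = add AddC (h \<cdot>\<^bsub>AddC\<^esub> f) (h \<cdot>\<^bsub>AddC\<^esub> g)"
proof (rule additive_arrow_eqI[OF additive_arrow(2)[OF additive_arrow_add[OF f g] h]
      additive_arrow_add[OF additive_arrow(2)[OF f h] additive_arrow(2)[OF g h]]])
  note [simp] = additive_arrowD(1-2)[OF f] additive_arrowD(1-2)[OF g] additive_arrowD(1-2)[OF h]
  fix i j assume ij: "i < length Z" "j < length X"
  note af = additive_arrowD(6)[OF f _ ij(2)] and ag = additive_arrowD(6)[OF g _ ij(2)] and ah = additive_arrowD(6)[OF h ij(1)]
  have Ob: "X ! j \<in> Ob C" "Z ! i \<in> Ob C" using ij additive_arrowD(3)[OF f] additive_arrowD(4)[OF h] by auto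
  have "dat (h \<cdot>\<^bsub>AddC\<^esub> add AddC f g) (i, j) = csum C (X ! j) (Z ! i)
      (map (\<lambda>l. add C (dat h (i, l) \<cdot> dat f (l, j)) (dat h (i, l) \<cdot> dat g (l, j))) [0..<length Y])"
    using ij cmp_add_right[OF af ag ah]
    by (auto simp: additive_sel additive_entry intro!: arg_cong[where f = "csum C _ _"])
  also have "\<dots> = add C (csum C (X ! j) (Z ! i) (map (\<lambda>l. dat h (i, l) \<cdot> dat f (l, j)) [0..<length Y]))
      (csum C (X ! j) (Z ! i) (map (\<lambda>l. dat h (i, l) \<cdot> dat g (l, j)) [0..<length Y]))"
    by (rule csum_add) (use Ob in \<open>auto intro!: arrow_cmp[OF af ah] arrow_cmp[OF ag ah]\<close>)
  finally show "dat (h \<cdot>\<^bsub>AddC\<^esub> add AddC f g) (i, j) = dat (add AddC (h \<cdot>\<^bsub>AddC\<^esub> f) (h \<cdot>\<^bsub>AddC\<^esub> g)) (i, j)"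
    using ij by (simp add: additive_sel additive_entry)
qed

lemma additive_cmp_scale:
  assumes f: "arrow AddC f X Y" and g: "arrow AddC g Y Z"
  shows "scale AddC c g \<cdot>\<^bsub>AddC\<^esub> f = scale AddC c (g \<cdot>\<^bsub>AddC\<^esub> f)" "g \<cdot>\<^bsub>AddC\<^esub> scale AddC c f = scale AddC c (g \<cdot>\<^bsub>AddC\<^esub> f)"
proof -
  note [simp] = additive_arrowD(1-2)[OF f] additive_arrowD(1-2)[OF g]
  have *: "dat (scale AddC c g \<cdot>\<^bsub>AddC\<^esub> f) (i, j) = dat (scale AddC c (g \<cdot>\<^bsub>AddC\<^esub> f)) (i, j) \<and>
      dat (g \<cdot>\<^bsub>AddC\<^esub> scale AddC c f) (i, j) = dat (scale AddC c (g \<cdot>\<^bsub>AddC\<^esub> f)) (i, j)"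
    if ij: "i < length Z" "j < length X" for i j
  proof -
    note af = additive_arrowD(6)[OF f _ ij(2)] and ag = additive_arrowD(6)[OF g ij(1)]
    have Ob: "X ! j \<in> Ob C" "Z ! i \<in> Ob C" using ij additive_arrowD(3)[OF f] additive_arrowD(4)[OF g] by auto
    have "scale C c (csum C (X ! j) (Z ! i) (map (\<lambda>l. dat g (i, l) \<cdot> dat f (l, j)) [0..<length Y])) =
      csum C (X ! j) (Z ! i) (map (\<lambda>l. scale C c (dat g (i, l) \<cdot> dat f (l, j))) [0..<length Y])"
      by (rule csum_scale) (use Ob in \<open>auto intro!: arrow_cmp[OF af ag]\<close>)
    then show ?thesis
      using ij cmp_scale_left[OF af ag] cmp_scale_right[OF af ag]
      by (auto simp: additive_sel additive_entry intro!: arg_cong[where f = "csum C _ _"])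
  qed
  show "scale AddC c g \<cdot>\<^bsub>AddC\<^esub> f = scale AddC c (g \<cdot>\<^bsub>AddC\<^esub> f)"
    by (rule additive_arrow_eqI[OF additive_arrow(2)[OF f additive_arrow_scale[OF g]]
      additive_arrow_scale[OF additive_arrow(2)[OF f g]]]) (use * in blast)
  show "g \<cdot>\<^bsub>AddC\<^esub> scale AddC c f = scale AddC c (g \<cdot>\<^bsub>AddC\<^esub> f)"
    by (rule additive_arrow_eqI[OF additive_arrow(2)[OF additive_arrow_scale[OF f] g]
      additive_arrow_scale[OF additive_arrow(2)[OF f g]]]) (use * in blast)
qed

lemma additive_module:
  assumes f: "arrow AddC f X Y" and g: "arrow AddC g X Y" and h: "arrow AddC h X Y"
  shows "add AddC (add AddC f g) h = add AddC f (add AddC g h)" "add AddC f g = add AddC g f"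
    "add AddC f (zero AddC X Y) = f" "add AddC f (scale AddC (- 1) f) = zero AddC X Y" "scale AddC 1 f = f"
    "scale AddC c (scale AddC d f) = scale AddC (c * d) f"
    "scale AddC (c + d) f = add AddC (scale AddC c f) (scale AddC d f)"
    "scale AddC c (add AddC f g) = add AddC (scale AddC c f) (scale AddC c g)"
proof -
  note [simp] = additive_arrowD(1-2)[OF f] additive_arrowD(1-2)[OF g] additive_arrowD(1-2)[OF h]
  note af = additive_arrowD(6)[OF f] and ag = additive_arrowD(6)[OF g] and ah = additive_arrowD(6)[OF h]
  note ar = additive_arrow_add additive_arrow_scale additive_arrow_zero f g h
  show "add AddC (add AddC f g) h = add AddC f (add AddC g h)"
    by (rule additive_arrow_eqI[of _ X Y]) (intro ar, intro ar,
      simp add: additive_sel additive_entry add_assoc[OF af ag ah])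
  show "add AddC f g = add AddC g f"
    by (rule additive_arrow_eqI[of _ X Y]) (intro ar, intro ar,
      simp add: additive_sel additive_entry add_comm[OF af ag])
  show "add AddC f (zero AddC X Y) = f"
    by (rule additive_arrow_eqI[of _ X Y]) (rule additive_arrow_add[OF f additive_arrow_zero[OF f]], rule f,
      simp add: additive_sel additive_entry add_zero[OF af])
  show "add AddC f (scale AddC (- 1) f) = zero AddC X Y"
    by (rule additive_arrow_eqI[of _ X Y]) (intro ar, rule additive_arrow_zero[OF f],
      simp add: additive_sel additive_entry add_neg[OF af])
  show "scale AddC 1 f = f"
    by (rule additive_arrow_eqI[of _ X Y]) (intro ar, intro ar,
      simp add: additive_sel additive_entry scale_one[OF af])
  show "scale AddC c (scale AddC d f) = scale AddC (c * d) f"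
    by (rule additive_arrow_eqI[of _ X Y]) (intro ar, intro ar,
      simp add: additive_sel additive_entry scale_scale[OF af])
  show "scale AddC (c + d) f = add AddC (scale AddC c f) (scale AddC d f)"
    by (rule additive_arrow_eqI[of _ X Y]) (intro ar, intro ar,
      simp add: additive_sel additive_entry scale_add_left[OF af])
  show "scale AddC c (add AddC f g) = add AddC (scale AddC c f) (scale AddC c g)"
    by (rule additive_arrow_eqI[of _ X Y]) (intro ar, intro ar,
      simp add: additive_sel additive_entry scale_add_right[OF af ag])
qed

lemma additive_tensM_linear:
  assumes f: "arrow AddC f X Y" and g: "arrow AddC g X Y" and h: "arrow AddC h X' Y'"
  shows "add AddC f g \<otimes>\<^bsub>AddC\<^esub> h = add AddC (f \<otimes>\<^bsub>AddC\<^esub> h) (g \<otimes>\<^bsub>AddC\<^esub> h)"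
    "h \<otimes>\<^bsub>AddC\<^esub> add AddC f g = add AddC (h \<otimes>\<^bsub>AddC\<^esub> f) (h \<otimes>\<^bsub>AddC\<^esub> g)"
    "scale AddC c f \<otimes>\<^bsub>AddC\<^esub> h = scale AddC c (f \<otimes>\<^bsub>AddC\<^esub> h)"
    "h \<otimes>\<^bsub>AddC\<^esub> scale AddC c f = scale AddC c (h \<otimes>\<^bsub>AddC\<^esub> f)"
proof -
  note [simp] = additive_arrowD(1-2)[OF f] additive_arrowD(1-2)[OF g] additive_arrowD(1-2)[OF h]
  note af = additive_arrowD(6)[OF f] and ag = additive_arrowD(6)[OF g] and ah = additive_arrowD(6)[OF h]
  note ar = additive_arrow_add additive_arrow_scale additive_arrow(3) f g h
  note s = split_index
  show "add AddC f g \<otimes>\<^bsub>AddC\<^esub> h = add AddC (f \<otimes>\<^bsub>AddC\<^esub> h) (g \<otimes>\<^bsub>AddC\<^esub> h)"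
    by (rule additive_arrow_eqI[of _ "list_tens X X'" "list_tens Y Y'"]) (intro ar, intro ar,
      simp add: additive_sel additive_entry length_list_tens s(1,2) tensM_add_left[OF af ag ah])
  show "h \<otimes>\<^bsub>AddC\<^esub> add AddC f g = add AddC (h \<otimes>\<^bsub>AddC\<^esub> f) (h \<otimes>\<^bsub>AddC\<^esub> g)"
    by (rule additive_arrow_eqI[of _ "list_tens X' X" "list_tens Y' Y"]) (intro ar, intro ar,
      simp add: additive_sel additive_entry length_list_tens s(1,2) tensM_add_right[OF af ag ah])
  show "scale AddC c f \<otimes>\<^bsub>AddC\<^esub> h = scale AddC c (f \<otimes>\<^bsub>AddC\<^esub> h)"
    by (rule additive_arrow_eqI[of _ "list_tens X X'" "list_tens Y Y'"]) (intro ar, intro ar,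
      simp add: additive_sel additive_entry length_list_tens s(1,2) tensM_scale_left[OF af ah])
  show "h \<otimes>\<^bsub>AddC\<^esub> scale AddC c f = scale AddC c (h \<otimes>\<^bsub>AddC\<^esub> f)"
    by (rule additive_arrow_eqI[of _ "list_tens X' X" "list_tens Y' Y"]) (intro ar, intro ar,
      simp add: additive_sel additive_entry length_list_tens s(1,2) tensM_scale_right[OF ah af])
qed

lemma additive_completion_monoidal: "strict_lin_monoidal AddC"
proof
  fix f g h X Y
  show "unit AddC \<in> Ob AddC" by (simp add: additive_sel unit_Ob)
  show "X \<in> Ob AddC \<Longrightarrow> Y \<in> Ob AddC \<Longrightarrow> X \<odot>\<^bsub>AddC\<^esub> Y \<in> Ob AddC"
    by (auto simp: additive_sel intro!: tensO_Ob)
  show "X \<in> Ob AddC \<Longrightarrow> unit AddC \<odot>\<^bsub>AddC\<^esub> X = X"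
    by (auto simp: additive_sel intro!: map_idI tensO_unit_left)
  show "X \<in> Ob AddC \<Longrightarrow> X \<odot>\<^bsub>AddC\<^esub> unit AddC = X"
    by (induction X) (auto simp: additive_sel tensO_unit_right)
  show "idm AddC X \<in> Hom AddC X X" if "X \<in> Ob AddC" using that by (auto simp: additive_sel intro!: additive_Hom)
  show "zero AddC X Y \<in> Hom AddC X Y" if "X \<in> Ob AddC" "Y \<in> Ob AddC" using that by (auto simp: additive_sel intro!: additive_Hom)
  show "idm AddC (unit AddC) \<otimes>\<^bsub>AddC\<^esub> f = f" if f: "arrow AddC f X Y"
  proof (rule additive_arrow_eqI[OF _ f])
    note [simp] = additive_arrowD(1-2)[OF f]
    have "list_tens [unit C] X = X" "list_tens [unit C] Y = Y"
      using additive_arrowD(3,4)[OF f] by (auto intro!: map_idI tensO_unit_left)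
    then show "arrow AddC (idm AddC (unit AddC) \<otimes>\<^bsub>AddC\<^esub> f) X Y"
      using additive_arrow(3)[OF additive_arrow(1)[of "[unit C]"] f] unit_Ob by (simp add: additive_sel)
    fix i j assume "i < length Y" "j < length X"
    then show "dat (idm AddC (unit AddC) \<otimes>\<^bsub>AddC\<^esub> f) (i, j) = dat f (i, j)"
      using tensM_unit_left[OF additive_arrowD(6)[OF f]] by (simp add: additive_sel additive_entry)
  qed
  show "f \<otimes>\<^bsub>AddC\<^esub> idm AddC (unit AddC) = f" if f: "arrow AddC f X Y"
  proof (rule additive_arrow_eqI[OF _ f])
    note [simp] = additive_arrowD(1-2)[OF f]
    have "list_tens X [unit C] = X" if "set X \<subseteq> Ob C" for X
      using that by (induction X) (auto simp: tensO_unit_right)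
    then show "arrow AddC (f \<otimes>\<^bsub>AddC\<^esub> idm AddC (unit AddC)) X Y"
      using additive_arrow(3)[OF f additive_arrow(1)[of "[unit C]"]] unit_Ob additive_arrowD(3,4)[OF f]
      by (simp add: additive_sel)
    fix i j assume "i < length Y" "j < length X"
    then show "dat (f \<otimes>\<^bsub>AddC\<^esub> idm AddC (unit AddC)) (i, j) = dat f (i, j)"
      using tensM_unit_right[OF additive_arrowD(6)[OF f]] by (simp add: additive_sel additive_entry)
  qed
qed (simp_all only: additive_sel(1,3) additive_Hom additive_idm_left additive_idm_right additive_cmp_assoc
    additive_interchange additive_tensM_assoc additive_tensM_idm list_tens_assoc
    additive_cmp_add_left additive_cmp_add_right additive_cmp_scale additive_module additive_tensM_linear
    in_lists_conv_set subset_eq)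

end

section \<open>Idempotent completion\<close>

text \<open>Serves the idempotent completion and the center at once. In both, a morphism is a
  morphism of \<open>C\<close> tagged with its endpoints, and \<open>dat\<close> is faithful and
  preserves all operations; so the equational laws are inherited, and only closure of hom-sets and
  the laws for objects remain. \<open>J\<close> gives the morphism underlying an identity, which in
  the idempotent completion is the idempotent itself and in general no identity of
  \<open>C\<close>.\<close>

lemma (in strict_lin_monoidal) concrete_monoidal:
  fixes K :: "('p, ('p, 'm) arr, 'k) lincat" and U :: "'p \<Rightarrow> 'o" and J :: "'p \<Rightarrow> 'm"
  assumes unit: "unit K \<in> Ob K" "U (unit K) = unit C" "J (unit K) = idm C (unit C)"
    and ob: "\<And>A B. A \<in> Ob K \<Longrightarrow> B \<in> Ob K \<Longrightarrow> A \<odot>\<^bsub>K\<^esub> B \<in> Ob K"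
      "\<And>A B D. A \<in> Ob K \<Longrightarrow> B \<in> Ob K \<Longrightarrow> D \<in> Ob K \<Longrightarrow> (A \<odot>\<^bsub>K\<^esub> B) \<odot>\<^bsub>K\<^esub> D = A \<odot>\<^bsub>K\<^esub> (B \<odot>\<^bsub>K\<^esub> D)"
      "\<And>A. A \<in> Ob K \<Longrightarrow> unit K \<odot>\<^bsub>K\<^esub> A = A" "\<And>A. A \<in> Ob K \<Longrightarrow> A \<odot>\<^bsub>K\<^esub> unit K = A"
    and hom: "\<And>A. A \<in> Ob K \<Longrightarrow> idm K A \<in> Hom K A A"
      "\<And>A B. A \<in> Ob K \<Longrightarrow> B \<in> Ob K \<Longrightarrow> zero K A B \<in> Hom K A B"
      "\<And>f g A B D. arrow K f A B \<Longrightarrow> arrow K g B D \<Longrightarrow> g \<cdot>\<^bsub>K\<^esub> f \<in> Hom K A D"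
      "\<And>f g A B. arrow K f A B \<Longrightarrow> arrow K g A B \<Longrightarrow> add K f g \<in> Hom K A B"
      "\<And>f A B c. arrow K f A B \<Longrightarrow> scale K c f \<in> Hom K A B"
      "\<And>f g A B A' B'. arrow K f A B \<Longrightarrow> arrow K g A' B' \<Longrightarrow> f \<otimes>\<^bsub>K\<^esub> g \<in> Hom K (A \<odot>\<^bsub>K\<^esub> A') (B \<odot>\<^bsub>K\<^esub> B')"
    and arrowD: "\<And>f A B. arrow K f A B \<Longrightarrow> src f = A \<and> tgt f = B \<and> arrow C (dat f) (U A) (U B)"
    and dat: "\<And>f g. dat (g \<cdot>\<^bsub>K\<^esub> f) = dat g \<cdot> dat f" "\<And>f g. dat (f \<otimes>\<^bsub>K\<^esub> g) = dat f \<otimes> dat g"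
      "\<And>f g. dat (add K f g) = add C (dat f) (dat g)" "\<And>c f. dat (scale K c f) = scale C c (dat f)"
      "\<And>A B. dat (zero K A B) = zero C (U A) (U B)" "\<And>A. dat (idm K A) = J A"
    and J: "\<And>f A B. arrow K f A B \<Longrightarrow> dat f \<cdot> J A = dat f \<and> J B \<cdot> dat f = dat f"
      "\<And>A B. A \<in> Ob K \<Longrightarrow> B \<in> Ob K \<Longrightarrow> J (A \<odot>\<^bsub>K\<^esub> B) = J A \<otimes> J B"
  shows "strict_lin_monoidal K"
proof -
  have arr_eq: "f = g" if "arrow K f A B" "arrow K g A B" "dat f = dat g" for f g A B
    using that arrowD[OF that(1)] arrowD[OF that(2)] by (intro arr.expand) auto
  have obj: "A \<in> Ob K \<and> B \<in> Ob K" if "arrow K f A B" for f A B using that by (simp add: arrow_def)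
  have ar: "A \<in> Ob K \<Longrightarrow> arrow K (idm K A) A A"
      "A \<in> Ob K \<Longrightarrow> B \<in> Ob K \<Longrightarrow> arrow K (zero K A B) A B"
      "arrow K f A B \<Longrightarrow> arrow K g B D \<Longrightarrow> arrow K (g \<cdot>\<^bsub>K\<^esub> f) A D"
      "arrow K f A B \<Longrightarrow> arrow K f' A B \<Longrightarrow> arrow K (add K f f') A B"
      "arrow K f A B \<Longrightarrow> arrow K (scale K c f) A B"
      "arrow K f A B \<Longrightarrow> arrow K h A' B' \<Longrightarrow> arrow K (f \<otimes>\<^bsub>K\<^esub> h) (A \<odot>\<^bsub>K\<^esub> A') (B \<odot>\<^bsub>K\<^esub> B')"
    for f g f' h A B D A' B' c
    using hom ob(1) unfolding arrow_def by meson+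
  note a = arrowD[THEN conjunct2, THEN conjunct2]
  show ?thesis
  proof (unfold_locales, goal_cases)
    case (12 f X Y) then show ?case by (intro arr_eq[OF ar(3)[OF _ ar(1)]]) (auto simp: dat J obj)
  next
    case (13 f X Y) then show ?case by (intro arr_eq[OF ar(3)[OF ar(1)]]) (auto simp: dat J obj)
  next
    case (14 f W X g Y h Z)
    then show ?case
      by (intro arr_eq[OF ar(3)[OF 14(1) ar(3)[OF 14(2,3)]] ar(3)[OF ar(3)[OF 14(1,2)] 14(3)]])
        (simp add: dat cmp_assoc[OF 14[THEN a]])
  next
    case (15 X Y)
    show ?case by (rule arr_eq[OF ar(6)[OF ar(1)[OF 15(1)] ar(1)[OF 15(2)]] ar(1)[OF ob(1)[OF 15]]])
        (simp add: dat J 15)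
  next
    case (16 f X Y g Z f' X' Y' g' Z')
    show ?case by (rule arr_eq[OF ar(3)[OF ar(6)[OF 16(1,3)] ar(6)[OF 16(2,4)]] ar(6)[OF ar(3)[OF 16(1,2)] ar(3)[OF 16(3,4)]]])
        (simp add: dat interchange[OF 16[THEN a]])
  next
    case (17 f X X' g Y Y' h Z Z')
    \<comment> \<open>Tagged morphisms can only be equal if their endpoints are, so associativity on
      objects is needed first.\<close>
    have o: "(X \<odot>\<^bsub>K\<^esub> Y) \<odot>\<^bsub>K\<^esub> Z = X \<odot>\<^bsub>K\<^esub> (Y \<odot>\<^bsub>K\<^esub> Z)" "(X' \<odot>\<^bsub>K\<^esub> Y') \<odot>\<^bsub>K\<^esub> Z' = X' \<odot>\<^bsub>K\<^esub> (Y' \<odot>\<^bsub>K\<^esub> Z')"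
      using ob(2) obj[OF 17(1)] obj[OF 17(2)] obj[OF 17(3)] by blast+
    show ?case by (rule arr_eq[OF ar(6)[OF ar(6)[OF 17(1,2)] 17(3), unfolded o] ar(6)[OF 17(1) ar(6)[OF 17(2,3)]]])
        (simp add: dat tensM_assoc[OF 17[THEN a]])
  next
    case (18 f X Y)
    show ?case by (rule arr_eq[OF _ 18], use ar(6)[OF ar(1)[OF unit(1)] 18] ob(3) obj[OF 18] in simp)
        (simp add: dat unit tensM_unit_left[OF 18[THEN a]])
  next
    case (19 f X Y)
    show ?case by (rule arr_eq[OF _ 19], use ar(6)[OF 19 ar(1)[OF unit(1)]] ob(4) obj[OF 19] in simp)
        (simp add: dat unit tensM_unit_right[OF 19[THEN a]])
  next
    case (20 f X Y g h)
    show ?case by (rule arr_eq[OF ar(4)[OF ar(4)[OF 20(1,2)] 20(3)] ar(4)[OF 20(1) ar(4)[OF 20(2,3)]]])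
        (simp add: dat add_assoc[OF 20[THEN a]])
  next
    case (21 f X Y g)
    show ?case by (rule arr_eq[OF ar(4)[OF 21] ar(4)[OF 21(2,1)]]) (simp add: dat add_comm[OF 21[THEN a]])
  next
    case (22 f X Y)
    show ?case by (rule arr_eq[OF ar(4)[OF 22 ar(2)] 22]) (use obj[OF 22] in \<open>simp_all add: dat add_zero[OF 22[THEN a]]\<close>)
  next
    case (23 f X Y)
    show ?case by (rule arr_eq[OF ar(4)[OF 23 ar(5)[OF 23]] ar(2)])
        (use obj[OF 23] in \<open>simp_all add: dat add_neg[OF 23[THEN a]]\<close>)
  next
    case (24 f X Y) show ?case by (rule arr_eq[OF ar(5)[OF 24] 24]) (simp add: dat scale_one[OF 24[THEN a]])
  next
    case (25 f X Y c d)
    show ?case by (rule arr_eq[OF ar(5)[OF ar(5)[OF 25]] ar(5)[OF 25]]) (simp add: dat scale_scale[OF 25[THEN a]])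
  next
    case (26 f X Y c d)
    show ?case by (rule arr_eq[OF ar(5)[OF 26] ar(4)[OF ar(5)[OF 26] ar(5)[OF 26]]])
        (simp add: dat scale_add_left[OF 26[THEN a]])
  next
    case (27 f X Y g c)
    show ?case by (rule arr_eq[OF ar(5)[OF ar(4)[OF 27]] ar(4)[OF ar(5)[OF 27(1)] ar(5)[OF 27(2)]]])
        (simp add: dat scale_add_right[OF 27[THEN a]])
  next
    case (28 f X Y g Z h)
    show ?case by (rule arr_eq[OF ar(3)[OF 28(1) ar(4)[OF 28(2,3)]] ar(4)[OF ar(3)[OF 28(1,2)] ar(3)[OF 28(1,3)]]])
        (simp add: dat cmp_add_left[OF 28[THEN a]])
  next
    case (29 f X Y g h Z)
    show ?case by (rule arr_eq[OF ar(3)[OF ar(4)[OF 29(1,2)] 29(3)] ar(4)[OF ar(3)[OF 29(1,3)] ar(3)[OF 29(2,3)]]])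
        (simp add: dat cmp_add_right[OF 29[THEN a]])
  next
    case (30 f X Y g Z c)
    show ?case by (rule arr_eq[OF ar(3)[OF 30(1) ar(5)[OF 30(2)]] ar(5)[OF ar(3)[OF 30]]])
        (simp add: dat cmp_scale_left[OF 30[THEN a]])
  next
    case (31 f X Y g Z c)
    show ?case by (rule arr_eq[OF ar(3)[OF ar(5)[OF 31(1)] 31(2)] ar(5)[OF ar(3)[OF 31]]])
        (simp add: dat cmp_scale_right[OF 31[THEN a]])
  next
    case (32 f X Y g h X' Y')
    show ?case by (rule arr_eq[OF ar(6)[OF ar(4)[OF 32(1,2)] 32(3)] ar(4)[OF ar(6)[OF 32(1,3)] ar(6)[OF 32(2,3)]]])
        (simp add: dat tensM_add_left[OF 32[THEN a]])
  next
    case (33 f X Y g h X' Y')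
    show ?case by (rule arr_eq[OF ar(6)[OF 33(3) ar(4)[OF 33(1,2)]] ar(4)[OF ar(6)[OF 33(3,1)] ar(6)[OF 33(3,2)]]])
        (simp add: dat tensM_add_right[OF 33[THEN a]])
  next
    case (34 f X Y g X' Y' c)
    show ?case by (rule arr_eq[OF ar(6)[OF ar(5)[OF 34(1)] 34(2)] ar(5)[OF ar(6)[OF 34]]])
        (simp add: dat tensM_scale_left[OF 34[THEN a]])
  next
    case (35 f X Y g X' Y' c)
    show ?case by (rule arr_eq[OF ar(6)[OF 35(1) ar(5)[OF 35(2)]] ar(5)[OF ar(6)[OF 35]]])
        (simp add: dat tensM_scale_right[OF 35[THEN a]])
  qed (fact unit(1) ob hom)+
qed

context strict_lin_monoidal
begin

abbreviation IdC where "IdC \<equiv> idempotent_completion C"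

lemma idempotent_sel:
  "unit IdC = (unit C, idm C (unit C))" "A \<odot>\<^bsub>IdC\<^esub> B = (fst A \<odot> fst B, snd A \<otimes> snd B)"
  "src (idm IdC A) = A" "tgt (idm IdC A) = A" "src (zero IdC A B) = A" "tgt (zero IdC A B) = B"
  "src (g \<cdot>\<^bsub>IdC\<^esub> f) = src f" "tgt (g \<cdot>\<^bsub>IdC\<^esub> f) = tgt g"
  "src (add IdC f g) = src f" "tgt (add IdC f g) = tgt f" "src (scale IdC c f) = src f" "tgt (scale IdC c f) = tgt f"
  "src (f \<otimes>\<^bsub>IdC\<^esub> g) = src f \<odot>\<^bsub>IdC\<^esub> src g" "tgt (f \<otimes>\<^bsub>IdC\<^esub> g) = tgt f \<odot>\<^bsub>IdC\<^esub> tgt g"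
  "dat (idm IdC A) = snd A" "dat (zero IdC A B) = zero C (fst A) (fst B)" "dat (g \<cdot>\<^bsub>IdC\<^esub> f) = dat g \<cdot> dat f"
  "dat (add IdC f g) = add C (dat f) (dat g)" "dat (scale IdC c f) = scale C c (dat f)"
  "dat (f \<otimes>\<^bsub>IdC\<^esub> g) = dat f \<otimes> dat g"
  by (simp_all add: idempotent_completion_def)

lemma idempotent_Ob: "A \<in> Ob IdC \<longleftrightarrow> arrow C (snd A) (fst A) (fst A) \<and> snd A \<cdot> snd A = snd A"
  by (cases A) (auto simp: idempotent_completion_def arrow_def)

lemma idempotent_Hom: "f \<in> Hom IdC A B \<longleftrightarrow> src f = A \<and> tgt f = B \<and> dat f \<in> Hom C (fst A) (fst B) \<and>
    dat f \<cdot> snd A = dat f \<and> snd B \<cdot> dat f = dat f"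
  by (cases f) (auto simp: idempotent_completion_def)

lemma idempotent_arrow: "arrow IdC f A B \<longleftrightarrow> A \<in> Ob IdC \<and> B \<in> Ob IdC \<and> src f = A \<and> tgt f = B \<and>
    arrow C (dat f) (fst A) (fst B) \<and> dat f \<cdot> snd A = dat f \<and> snd B \<cdot> dat f = dat f"
  by (auto simp: arrow_def[of IdC] idempotent_Hom idempotent_Ob arrow_def[of C])

lemma idempotent_completion_monoidal: "strict_lin_monoidal IdC"
proof (rule concrete_monoidal[where U = fst and J = snd])
  show "unit IdC \<in> Ob IdC" using arrow_idm[OF unit_Ob] idm_left[OF arrow_idm[OF unit_Ob]]
    by (simp add: idempotent_Ob idempotent_sel)
  fix f g A B D A' B' c
  show "A \<odot>\<^bsub>IdC\<^esub> B \<in> Ob IdC" if "A \<in> Ob IdC" "B \<in> Ob IdC"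
    using that interchange[of "snd A" "fst A" "fst A" "snd A" "fst A" "snd B" "fst B" "fst B" "snd B" "fst B"]
    by (simp add: idempotent_Ob idempotent_sel arrow_tensM)
  \<comment> \<open>An object carries its idempotent, so strict associativity for objects already
    uses that for morphisms of \<open>C\<close>.\<close>
  show "(A \<odot>\<^bsub>IdC\<^esub> B) \<odot>\<^bsub>IdC\<^esub> D = A \<odot>\<^bsub>IdC\<^esub> (B \<odot>\<^bsub>IdC\<^esub> D)" if "A \<in> Ob IdC" "B \<in> Ob IdC" "D \<in> Ob IdC"
    using that tensM_assoc[of "snd A" "fst A" "fst A" "snd B" "fst B" "fst B" "snd D" "fst D" "fst D"]
      tensO_assoc[of "fst A" "fst B" "fst D"]
    by (auto simp: idempotent_sel idempotent_Ob arrow_Ob)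
  show "unit IdC \<odot>\<^bsub>IdC\<^esub> A = A" "A \<odot>\<^bsub>IdC\<^esub> unit IdC = A" if "A \<in> Ob IdC"
    using that tensM_unit_left[of "snd A"] tensM_unit_right[of "snd A"]
    by (auto simp: idempotent_sel idempotent_Ob arrow_Ob tensO_unit_left tensO_unit_right prod_eq_iff)
  show "idm IdC A \<in> Hom IdC A A" if "A \<in> Ob IdC"
    using that by (simp add: idempotent_Hom idempotent_sel idempotent_Ob arrow_def)
  show "zero IdC A B \<in> Hom IdC A B" if "A \<in> Ob IdC" "B \<in> Ob IdC"
    using that cmp_zero_left[of "snd A" "fst A" "fst A"] cmp_zero_right[of "snd B" "fst B" "fst B"]
    by (auto simp: idempotent_Hom idempotent_sel idempotent_Ob zero_Hom arrow_Ob)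
  show "g \<cdot>\<^bsub>IdC\<^esub> f \<in> Hom IdC A D" if f: "arrow IdC f A B" and g: "arrow IdC g B D"
  proof -
    have a: "arrow C (dat f) (fst A) (fst B)" "arrow C (dat g) (fst B) (fst D)"
        "arrow C (snd A) (fst A) (fst A)" "arrow C (snd D) (fst D) (fst D)"
      using f g by (auto simp: idempotent_arrow idempotent_Ob)
    show ?thesis using f g cmp_assoc[OF a(3,1,2)] cmp_assoc[OF a(1,2,4)]
      by (simp add: idempotent_Hom idempotent_sel idempotent_arrow cmp_Hom[OF a(1,2)])
  qed
  show "add IdC f g \<in> Hom IdC A B" if f: "arrow IdC f A B" and g: "arrow IdC g A B"
  proof -
    have a: "arrow C (dat f) (fst A) (fst B)" "arrow C (dat g) (fst A) (fst B)"
        "arrow C (snd A) (fst A) (fst A)" "arrow C (snd B) (fst B) (fst B)"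
      using f g by (auto simp: idempotent_arrow idempotent_Ob)
    show ?thesis using f g cmp_add_left[OF a(3,1,2)] cmp_add_right[OF a(1,2,4)]
      by (simp add: idempotent_Hom idempotent_sel idempotent_arrow add_Hom[OF a(1,2)])
  qed
  show "scale IdC c f \<in> Hom IdC A B" if f: "arrow IdC f A B"
  proof -
    have a: "arrow C (dat f) (fst A) (fst B)" "arrow C (snd A) (fst A) (fst A)" "arrow C (snd B) (fst B) (fst B)"
      using f by (auto simp: idempotent_arrow idempotent_Ob)
    show ?thesis using f cmp_scale_left[OF a(2,1)] cmp_scale_right[OF a(1,3)]
      by (simp add: idempotent_Hom idempotent_sel idempotent_arrow scale_Hom[OF a(1)])
  qed
  show "f \<otimes>\<^bsub>IdC\<^esub> g \<in> Hom IdC (A \<odot>\<^bsub>IdC\<^esub> A') (B \<odot>\<^bsub>IdC\<^esub> B')" if f: "arrow IdC f A B" and g: "arrow IdC g A' B'"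
  proof -
    have a: "arrow C (dat f) (fst A) (fst B)" "arrow C (dat g) (fst A') (fst B')"
        "arrow C (snd A) (fst A) (fst A)" "arrow C (snd B) (fst B) (fst B)"
        "arrow C (snd A') (fst A') (fst A')" "arrow C (snd B') (fst B') (fst B')"
      using f g by (auto simp: idempotent_arrow idempotent_Ob)
    show ?thesis using f g interchange[OF a(3,1,5,2)] interchange[OF a(1,4,2,6)]
      by (simp add: idempotent_Hom idempotent_sel idempotent_arrow tensM_Hom[OF a(1,2)])
  qed
qed (auto simp: idempotent_arrow idempotent_sel)

end

lemma TL_monoidal: "strict_lin_monoidal (TL q)"
  unfolding TL_def cauchy_completion_def
  by (intro strict_lin_monoidal.idempotent_completion_monoidal
      strict_lin_monoidal.additive_completion_monoidal tl_pre_monoidal)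

text \<open>Total source and target functions with unconditional rewrite rules let the simplifier
  compute endpoints and discharge typing conditions. They are available for \<open>TL q\<close> and
  for the center because morphisms there are tagged.\<close>

locale strict_lin_monoidal_dc = strict_lin_monoidal +
  fixes dom cod :: "'b \<Rightarrow> 'a"
  assumes Hom_dom: "f \<in> Hom C X Y \<Longrightarrow> dom f = X"
    and Hom_cod: "f \<in> Hom C X Y \<Longrightarrow> cod f = Y"
    and dom_simps [simp]: "dom (g \<cdot> f) = dom f" "dom (f \<otimes> g) = dom f \<odot> dom g" "dom (idm C X) = X"
      "dom (zero C X Y) = X" "dom (add C f g) = dom f" "dom (scale C c f) = dom f"
    and cod_simps [simp]: "cod (g \<cdot> f) = cod g" "cod (f \<otimes> g) = cod f \<odot> cod g" "cod (idm C X) = X"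
      "cod (zero C X Y) = Y" "cod (add C f g) = cod f" "cod (scale C c f) = cod f"
begin

definition arr :: "'b \<Rightarrow> bool" where "arr f \<longleftrightarrow> arrow C f (dom f) (cod f)"

lemma arrow_iff: "arrow C f X Y \<longleftrightarrow> arr f \<and> dom f = X \<and> cod f = Y"
  by (auto simp: arr_def arrow_def Hom_dom Hom_cod)

lemma Hom_iff: "X \<in> Ob C \<Longrightarrow> Y \<in> Ob C \<Longrightarrow> f \<in> Hom C X Y \<longleftrightarrow> arr f \<and> dom f = X \<and> cod f = Y"
  using arrow_iff by (auto simp: arrow_def)

lemma ob_simps [simp]: "arr f \<Longrightarrow> dom f \<in> Ob C" "arr f \<Longrightarrow> cod f \<in> Ob C" "unit C \<in> Ob C"
  "X \<in> Ob C \<Longrightarrow> Y \<in> Ob C \<Longrightarrow> X \<odot> Y \<in> Ob C" "X \<in> Ob C \<Longrightarrow> unit C \<odot> X = X" "X \<in> Ob C \<Longrightarrow> X \<odot> unit C = X"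
  "X \<in> Ob C \<Longrightarrow> Y \<in> Ob C \<Longrightarrow> Z \<in> Ob C \<Longrightarrow> (X \<odot> Y) \<odot> Z = X \<odot> (Y \<odot> Z)"
  by (auto simp: arr_def arrow_Ob unit_Ob tensO_Ob tensO_unit_left tensO_unit_right tensO_assoc)

lemma arr_simps [simp]:
  "X \<in> Ob C \<Longrightarrow> arr (idm C X)" "X \<in> Ob C \<Longrightarrow> Y \<in> Ob C \<Longrightarrow> arr (zero C X Y)"
  "arr f \<Longrightarrow> arr g \<Longrightarrow> dom g = cod f \<Longrightarrow> arr (g \<cdot> f)"
  "arr f \<Longrightarrow> arr g \<Longrightarrow> arr (f \<otimes> g)"
  "arr f \<Longrightarrow> arr g \<Longrightarrow> dom f = dom g \<Longrightarrow> cod f = cod g \<Longrightarrow> arr (add C f g)"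
  "arr f \<Longrightarrow> arr (scale C c f)"
  using arrow_idm arrow_zero arrow_cmp arrow_add arrow_scale arrow_tensM by (auto simp: arr_def)

lemma id_simps [simp]:
  "arr f \<Longrightarrow> cod f = X \<Longrightarrow> idm C X \<cdot> f = f" "arr f \<Longrightarrow> dom f = X \<Longrightarrow> f \<cdot> idm C X = f"
  "X \<in> Ob C \<Longrightarrow> Y \<in> Ob C \<Longrightarrow> idm C X \<otimes> idm C Y = idm C (X \<odot> Y)"
  "arr f \<Longrightarrow> idm C (unit C) \<otimes> f = f" "arr f \<Longrightarrow> f \<otimes> idm C (unit C) = f"
  using idm_left idm_right tensM_idm tensM_unit_left tensM_unit_right by (auto simp: arrow_iff)

lemma assoc_cmp: "arr f \<Longrightarrow> arr g \<Longrightarrow> arr h \<Longrightarrow> dom g = cod f \<Longrightarrow> dom h = cod g \<Longrightarrow> (h \<cdot> g) \<cdot> f = h \<cdot> (g \<cdot> f)"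
  using cmp_assoc by (auto simp: arrow_iff)

lemma assoc_tens: "arr f \<Longrightarrow> arr g \<Longrightarrow> arr h \<Longrightarrow> (f \<otimes> g) \<otimes> h = f \<otimes> (g \<otimes> h)"
  using tensM_assoc by (auto simp: arrow_iff)

lemma cmp_tensM: "arr f \<Longrightarrow> arr g \<Longrightarrow> arr f' \<Longrightarrow> arr g' \<Longrightarrow> dom g = cod f \<Longrightarrow> dom g' = cod f' \<Longrightarrow>
  (g \<otimes> g') \<cdot> (f \<otimes> f') = (g \<cdot> f) \<otimes> (g' \<cdot> f')"
  using interchange by (auto simp: arrow_iff)

lemma whisker_left: "arr f \<Longrightarrow> arr g \<Longrightarrow> dom g = cod f \<Longrightarrow> X \<in> Ob C \<Longrightarrow>
    idm C X \<otimes> (g \<cdot> f) = (idm C X \<otimes> g) \<cdot> (idm C X \<otimes> f)"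
  by (simp add: cmp_tensM)

lemma whisker_right: "arr f \<Longrightarrow> arr g \<Longrightarrow> dom g = cod f \<Longrightarrow> X \<in> Ob C \<Longrightarrow>
    (g \<cdot> f) \<otimes> idm C X = (g \<otimes> idm C X) \<cdot> (f \<otimes> idm C X)"
  by (simp add: cmp_tensM)

lemma whisker_merge: "X \<in> Ob C \<Longrightarrow> Y \<in> Ob C \<Longrightarrow> arr f \<Longrightarrow> idm C X \<otimes> (idm C Y \<otimes> f) = idm C (X \<odot> Y) \<otimes> f"
  by (simp add: assoc_tens[symmetric])

text \<open>As rewrite rules these turn a composite into a right-nested composite of layers, each a
  morphism padded by identities. They do not decide the order of layers that act on disjoint
  strands; \<open>whisker_exchange\<close> is there for that.\<close>

lemmas whisker = whisker_left whisker_right whisker_merge assoc_tens assoc_cmp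

lemma whisker_exchange:
  assumes "arr f" "arr g"
  shows "(f \<otimes> idm C (cod g)) \<cdot> (idm C (dom f) \<otimes> g) = f \<otimes> g"
    "(idm C (cod f) \<otimes> g) \<cdot> (f \<otimes> idm C (dom g)) = f \<otimes> g"
  using assms by (simp_all add: cmp_tensM)

lemma zero_simps [simp]:
  "arr f \<Longrightarrow> Z \<in> Ob C \<Longrightarrow> cod f = Y \<Longrightarrow> zero C Y Z \<cdot> f = zero C (dom f) Z"
  "arr f \<Longrightarrow> dom f = Y \<Longrightarrow> X \<in> Ob C \<Longrightarrow> f \<cdot> zero C X Y = zero C X (cod f)"
  "arr f \<Longrightarrow> X \<in> Ob C \<Longrightarrow> Y \<in> Ob C \<Longrightarrow> f \<otimes> zero C X Y = zero C (dom f \<odot> X) (cod f \<odot> Y)"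
  "arr f \<Longrightarrow> X \<in> Ob C \<Longrightarrow> Y \<in> Ob C \<Longrightarrow> zero C X Y \<otimes> f = zero C (X \<odot> dom f) (Y \<odot> cod f)"
  "X \<in> Ob C \<Longrightarrow> Y \<in> Ob C \<Longrightarrow> scale C c (zero C X Y) = zero C X Y"
  "arr f \<Longrightarrow> scale C 0 f = zero C (dom f) (cod f)"
  using cmp_zero_left cmp_zero_right tensM_zero_left tensM_zero_right scale_zero_left scale_zero_right
  by (auto simp: arrow_iff)

lemma add_simps:
  "arr f \<Longrightarrow> arr g \<Longrightarrow> arr h \<Longrightarrow> dom f = dom g \<Longrightarrow> cod f = cod g \<Longrightarrow> dom h = dom g \<Longrightarrow> cod h = cod g \<Longrightarrow>
    add C (add C f g) h = add C f (add C g h)"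
  "arr f \<Longrightarrow> dom f = X \<Longrightarrow> cod f = Y \<Longrightarrow> add C f (zero C X Y) = f"
  "arr f \<Longrightarrow> dom f = X \<Longrightarrow> cod f = Y \<Longrightarrow> add C (zero C X Y) f = f"
  "arr f \<Longrightarrow> add C f (scale C (- 1) f) = zero C (dom f) (cod f)"
  using add_assoc add_zero add_zero_left add_neg by (auto simp: arrow_iff)

lemma add_commute: "arr f \<Longrightarrow> arr g \<Longrightarrow> dom f = dom g \<Longrightarrow> cod f = cod g \<Longrightarrow> add C f g = add C g f"
  using add_comm by (auto simp: arrow_iff)

lemma scale_simps:
  "arr f \<Longrightarrow> scale C 1 f = f" "arr f \<Longrightarrow> scale C c (scale C d f) = scale C (c * d) f"
  "arr f \<Longrightarrow> arr g \<Longrightarrow> dom f = dom g \<Longrightarrow> cod f = cod g \<Longrightarrow>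
    scale C c (add C f g) = add C (scale C c f) (scale C c g)"
  "arr f \<Longrightarrow> arr g \<Longrightarrow> dom g = cod f \<Longrightarrow> scale C c g \<cdot> f = scale C c (g \<cdot> f)"
  "arr f \<Longrightarrow> arr g \<Longrightarrow> dom g = cod f \<Longrightarrow> g \<cdot> scale C c f = scale C c (g \<cdot> f)"
  "arr f \<Longrightarrow> arr g \<Longrightarrow> scale C c f \<otimes> g = scale C c (f \<otimes> g)"
  "arr f \<Longrightarrow> arr g \<Longrightarrow> f \<otimes> scale C c g = scale C c (f \<otimes> g)"
  using scale_one scale_scale scale_add_right cmp_scale_left cmp_scale_right
    tensM_scale_left tensM_scale_right by (auto simp: arrow_iff)

lemma scale_add: "arr f \<Longrightarrow> scale C (c + d) f = add C (scale C c f) (scale C d f)"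
  using scale_add_left by (auto simp: arrow_iff)

lemma distrib_simps:
  "arr f \<Longrightarrow> arr g \<Longrightarrow> arr h \<Longrightarrow> dom g = dom h \<Longrightarrow> cod g = cod h \<Longrightarrow> dom g = cod f \<Longrightarrow>
    add C g h \<cdot> f = add C (g \<cdot> f) (h \<cdot> f)"
  "arr f \<Longrightarrow> arr g \<Longrightarrow> arr h \<Longrightarrow> dom g = dom h \<Longrightarrow> cod g = cod h \<Longrightarrow> dom f = cod g \<Longrightarrow>
    f \<cdot> add C g h = add C (f \<cdot> g) (f \<cdot> h)"
  "arr f \<Longrightarrow> arr g \<Longrightarrow> arr h \<Longrightarrow> dom g = dom h \<Longrightarrow> cod g = cod h \<Longrightarrow> add C g h \<otimes> f = add C (g \<otimes> f) (h \<otimes> f)"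
  "arr f \<Longrightarrow> arr g \<Longrightarrow> arr h \<Longrightarrow> dom g = dom h \<Longrightarrow> cod g = cod h \<Longrightarrow> f \<otimes> add C g h = add C (f \<otimes> g) (f \<otimes> h)"
  using cmp_add_left cmp_add_right tensM_add_left tensM_add_right by (auto simp: arrow_iff)

end

lemma TL_monoidal_dc: "strict_lin_monoidal_dc (TL q) src tgt"
proof -
  interpret pre: strict_lin_monoidal "tl_pre q" by (rule tl_pre_monoidal)
  interpret add: strict_lin_monoidal "additive_completion (tl_pre q)" by (rule pre.additive_completion_monoidal)
  show ?thesis
  proof (rule strict_lin_monoidal_dc.intro[OF TL_monoidal], unfold_locales)
    show "src f = X" if "f \<in> Hom (TL q) X Y" for f X Y
      using that add.idempotent_Hom by (simp add: TL_def cauchy_completion_def)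
    show "tgt f = Y" if "f \<in> Hom (TL q) X Y" for f X Y
      using that add.idempotent_Hom by (simp add: TL_def cauchy_completion_def)
  qed (simp_all add: TL_def cauchy_completion_def add.idempotent_sel)
qed

section \<open>The Drinfeld center as a monoidal category\<close>

context strict_lin_monoidal_dc
begin

section \<open>Inverses and isomorphisms\<close>

lemma inverse_pair_iff:
  assumes "X \<in> Ob C" "Y \<in> Ob C"
  shows "inverse_pair C X Y f g \<longleftrightarrow> arr f \<and> dom f = X \<and> cod f = Y \<and> arr g \<and> dom g = Y \<and> cod g = X \<and>
    g \<cdot> f = idm C X \<and> f \<cdot> g = idm C Y"
  using assms by (auto simp: inverse_pair_def Hom_iff)

lemma inverse_pair_cmp:
  assumes "X \<in> Ob C" "Y \<in> Ob C" "Z \<in> Ob C" "inverse_pair C X Y f g" "inverse_pair C Y Z f' g'"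
  shows "inverse_pair C X Z (f' \<cdot> f) (g \<cdot> g')"
proof -
  have t [simp]: "arr f" "dom f = X" "cod f = Y" "arr g" "dom g = Y" "cod g = X"
      "arr f'" "dom f' = Y" "cod f' = Z" "arr g'" "dom g' = Z" "cod g' = Y"
    and e: "g \<cdot> f = idm C X" "f \<cdot> g = idm C Y" "g' \<cdot> f' = idm C Y" "f' \<cdot> g' = idm C Z"
    using assms by (simp_all add: inverse_pair_iff)
  have "(g \<cdot> g') \<cdot> (f' \<cdot> f) = g \<cdot> ((g' \<cdot> f') \<cdot> f)" "(f' \<cdot> f) \<cdot> (g \<cdot> g') = f' \<cdot> ((f \<cdot> g) \<cdot> g')"
    by (simp_all add: assoc_cmp)
  then show ?thesis using assms(1-3) by (simp add: inverse_pair_iff e)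
qed

lemma inverse_pair_tensM:
  assumes "X \<in> Ob C" "Y \<in> Ob C" "X' \<in> Ob C" "Y' \<in> Ob C" "inverse_pair C X Y f g" "inverse_pair C X' Y' f' g'"
  shows "inverse_pair C (X \<odot> X') (Y \<odot> Y') (f \<otimes> f') (g \<otimes> g')"
  using assms by (simp add: inverse_pair_iff cmp_tensM)

lemma inverse_pair_idm: "X \<in> Ob C \<Longrightarrow> inverse_pair C X X (idm C X) (idm C X)"
  by (simp add: inverse_pair_iff)

lemma inverse_pair_sym: "inverse_pair C X Y f g \<Longrightarrow> inverse_pair C Y X g f"
  by (auto simp: inverse_pair_def)

lemma is_iso_cmp: "X \<in> Ob C \<Longrightarrow> Y \<in> Ob C \<Longrightarrow> Z \<in> Ob C \<Longrightarrow> is_iso C X Y f \<Longrightarrow> is_iso C Y Z g \<Longrightarrow> is_iso C X Z (g \<cdot> f)"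
  using inverse_pair_cmp unfolding is_iso_def by blast

lemma is_iso_tensM: "X \<in> Ob C \<Longrightarrow> Y \<in> Ob C \<Longrightarrow> X' \<in> Ob C \<Longrightarrow> Y' \<in> Ob C \<Longrightarrow> is_iso C X Y f \<Longrightarrow> is_iso C X' Y' g \<Longrightarrow>
    is_iso C (X \<odot> X') (Y \<odot> Y') (f \<otimes> g)"
  using inverse_pair_tensM unfolding is_iso_def by blast

lemma is_iso_idm: "X \<in> Ob C \<Longrightarrow> is_iso C X X (idm C X)"
  using inverse_pair_idm unfolding is_iso_def by blast

lemma inverse_pair_unique:
  assumes X: "X \<in> Ob C" "Y \<in> Ob C" and i: "inverse_pair C X Y f g" "inverse_pair C X Y f h"
  shows "g = h"
proof -
  have t [simp]: "arr f" "dom f = X" "cod f = Y" "arr g" "dom g = Y" "cod g = X" "arr h" "dom h = Y" "cod h = X"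
    and e: "g \<cdot> f = idm C X" "f \<cdot> h = idm C Y"
    using i X by (simp_all add: inverse_pair_iff)
  have "g \<cdot> (f \<cdot> h) = (g \<cdot> f) \<cdot> h" by (simp add: assoc_cmp)
  then show ?thesis by (simp add: e)
qed

lemma inv_mor_inverse_pair:
  assumes "X \<in> Ob C" "Y \<in> Ob C" "is_iso C X Y f" shows "inverse_pair C X Y f (inv_mor C X Y f)"
proof -
  obtain g where g: "inverse_pair C X Y f g" using assms by (auto simp: is_iso_def)
  show ?thesis unfolding inv_mor_def
    by (rule theI[where a = g and P = "inverse_pair C X Y f", OF g]) (rule inverse_pair_unique[OF assms(1,2) _ g])
qed

lemma isomorphic_refl: "X \<in> Ob C \<Longrightarrow> isomorphic C X X"
  using is_iso_idm by (auto simp: isomorphic_def)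

lemma isomorphic_sym: "isomorphic C X Y \<Longrightarrow> isomorphic C Y X"
  unfolding isomorphic_def is_iso_def using inverse_pair_sym by blast

lemma isomorphic_tensO: "isomorphic C X Y \<Longrightarrow> isomorphic C X' Y' \<Longrightarrow> isomorphic C (X \<odot> X') (Y \<odot> Y')"
  by (auto simp: isomorphic_def intro: is_iso_tensM)

text \<open>Naturality is quantified over one morphism with computed endpoints instead of two
  objects and a hom-set, which suits rewriting.\<close>

lemma half_braiding_iff:
  "half_braiding C X \<phi> \<longleftrightarrow> X \<in> Ob C \<and> \<phi> \<in> extensional (Ob C) \<and>
    (\<forall>Y\<in>Ob C. is_iso C (X \<odot> Y) (Y \<odot> X) (\<phi> Y)) \<and>
    (\<forall>f. arr f \<longrightarrow> \<phi> (cod f) \<cdot> (idm C X \<otimes> f) = (f \<otimes> idm C X) \<cdot> \<phi> (dom f)) \<and>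
    (\<forall>Y\<in>Ob C. \<forall>Z\<in>Ob C. \<phi> (Y \<odot> Z) = (idm C Y \<otimes> \<phi> Z) \<cdot> (\<phi> Y \<otimes> idm C Z))"
proof -
  have "(\<forall>Y\<in>Ob C. \<forall>Z\<in>Ob C. \<forall>f\<in>Hom C Y Z. \<phi> Z \<cdot> (idm C X \<otimes> f) = (f \<otimes> idm C X) \<cdot> \<phi> Y) \<longleftrightarrow>
    (\<forall>f. arr f \<longrightarrow> \<phi> (cod f) \<cdot> (idm C X \<otimes> f) = (f \<otimes> idm C X) \<cdot> \<phi> (dom f))"
    by (auto simp: Hom_iff)
  then show ?thesis unfolding half_braiding_def by blast
qed

lemma half_braidingD:
  assumes "half_braiding C X \<phi>"
  shows "X \<in> Ob C" "\<phi> \<in> extensional (Ob C)"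
    "Y \<in> Ob C \<Longrightarrow> is_iso C (X \<odot> Y) (Y \<odot> X) (\<phi> Y)"
    "Y \<in> Ob C \<Longrightarrow> arr (\<phi> Y)" "Y \<in> Ob C \<Longrightarrow> dom (\<phi> Y) = X \<odot> Y" "Y \<in> Ob C \<Longrightarrow> cod (\<phi> Y) = Y \<odot> X"
    "arr f \<Longrightarrow> \<phi> (cod f) \<cdot> (idm C X \<otimes> f) = (f \<otimes> idm C X) \<cdot> \<phi> (dom f)"
    "Y \<in> Ob C \<Longrightarrow> Z \<in> Ob C \<Longrightarrow> \<phi> (Y \<odot> Z) = (idm C Y \<otimes> \<phi> Z) \<cdot> (\<phi> Y \<otimes> idm C Z)"
proof -
  note h = assms[unfolded half_braiding_iff]
  then show X: "X \<in> Ob C" and "\<phi> \<in> extensional (Ob C)"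
    and i: "Y \<in> Ob C \<Longrightarrow> is_iso C (X \<odot> Y) (Y \<odot> X) (\<phi> Y)"
    and "arr f \<Longrightarrow> \<phi> (cod f) \<cdot> (idm C X \<otimes> f) = (f \<otimes> idm C X) \<cdot> \<phi> (dom f)"
    and "Y \<in> Ob C \<Longrightarrow> Z \<in> Ob C \<Longrightarrow> \<phi> (Y \<odot> Z) = (idm C Y \<otimes> \<phi> Z) \<cdot> (\<phi> Y \<otimes> idm C Z)" by auto
  show "Y \<in> Ob C \<Longrightarrow> arr (\<phi> Y)" "Y \<in> Ob C \<Longrightarrow> dom (\<phi> Y) = X \<odot> Y" "Y \<in> Ob C \<Longrightarrow> cod (\<phi> Y) = Y \<odot> X"
    using i X by (auto simp: is_iso_def inverse_pair_iff)
qed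

lemma half_braiding_tensor:
  assumes A: "half_braiding C X \<phi>" and B: "half_braiding C Y \<psi>"
  shows "half_braiding C (X \<odot> Y) (\<lambda>Z\<in>Ob C. (\<phi> Z \<otimes> idm C Y) \<cdot> (idm C X \<otimes> \<psi> Z))"
  unfolding half_braiding_iff
proof (intro conjI ballI allI impI)
  note X [simp] = half_braidingD(1)[OF A] and Y [simp] = half_braidingD(1)[OF B]
  note [simp] = half_braidingD(4-6)[OF A] half_braidingD(4-6)[OF B]
  show "X \<odot> Y \<in> Ob C" by simp
  fix Z assume Z: "Z \<in> Ob C"
  have "is_iso C (X \<odot> Y \<odot> Z) (X \<odot> Z \<odot> Y) (idm C X \<otimes> \<psi> Z)" "is_iso C ((X \<odot> Z) \<odot> Y) ((Z \<odot> X) \<odot> Y) (\<phi> Z \<otimes> idm C Y)"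
    using Z by (intro is_iso_tensM is_iso_idm half_braidingD(3)[OF A] half_braidingD(3)[OF B]; simp)+
  then show "is_iso C ((X \<odot> Y) \<odot> Z) (Z \<odot> X \<odot> Y) ((\<lambda>Z\<in>Ob C. (\<phi> Z \<otimes> idm C Y) \<cdot> (idm C X \<otimes> \<psi> Z)) Z)"
    using Z is_iso_cmp[of "X \<odot> Y \<odot> Z" "X \<odot> Z \<odot> Y" "Z \<odot> X \<odot> Y"] by simp
next
  note [simp] = half_braidingD(1)[OF A] half_braidingD(1)[OF B]
    half_braidingD(4-6)[OF A] half_braidingD(4-6)[OF B]
  fix f assume f [simp]: "arr f"
  have "((\<phi> (cod f) \<otimes> idm C Y) \<cdot> (idm C X \<otimes> \<psi> (cod f))) \<cdot> (idm C (X \<odot> Y) \<otimes> f) =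
    (\<phi> (cod f) \<otimes> idm C Y) \<cdot> (idm C X \<otimes> (\<psi> (cod f) \<cdot> (idm C Y \<otimes> f)))"
    by (simp add: whisker)
  also have "\<dots> = ((\<phi> (cod f) \<cdot> (idm C X \<otimes> f)) \<otimes> idm C Y) \<cdot> (idm C X \<otimes> \<psi> (dom f))"
    unfolding half_braidingD(7)[OF B f] by (simp add: whisker)
  also have "\<dots> = (f \<otimes> idm C (X \<odot> Y)) \<cdot> ((\<phi> (dom f) \<otimes> idm C Y) \<cdot> (idm C X \<otimes> \<psi> (dom f)))"
    unfolding half_braidingD(7)[OF A f] by (simp add: whisker)
  finally show "(\<lambda>Z\<in>Ob C. (\<phi> Z \<otimes> idm C Y) \<cdot> (idm C X \<otimes> \<psi> Z)) (cod f) \<cdot> (idm C (X \<odot> Y) \<otimes> f) =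
    (f \<otimes> idm C (X \<odot> Y)) \<cdot> (\<lambda>Z\<in>Ob C. (\<phi> Z \<otimes> idm C Y) \<cdot> (idm C X \<otimes> \<psi> Z)) (dom f)"
    by simp
next
  note [simp] = half_braidingD(1)[OF A] half_braidingD(1)[OF B]
    half_braidingD(4-6)[OF A] half_braidingD(4-6)[OF B]
  fix Z W assume Z [simp]: "Z \<in> Ob C" and W [simp]: "W \<in> Ob C"
  have "(\<phi> (Z \<odot> W) \<otimes> idm C Y) \<cdot> (idm C X \<otimes> \<psi> (Z \<odot> W)) =
    (idm C Z \<otimes> (\<phi> W \<otimes> idm C Y)) \<cdot> (((\<phi> Z \<otimes> idm C (W \<odot> Y)) \<cdot> (idm C (X \<odot> Z) \<otimes> \<psi> W)) \<cdot> (idm C X \<otimes> (\<psi> Z \<otimes> idm C W)))"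
    by (simp add: whisker half_braidingD(8)[OF A] half_braidingD(8)[OF B])
  \<comment> \<open>The only move that is not mere regrouping: \<open>\<phi> Z\<close> and
    \<open>\<psi> W\<close> act on disjoint strands and may change places.\<close>
  also have "(\<phi> Z \<otimes> idm C (W \<odot> Y)) \<cdot> (idm C (X \<odot> Z) \<otimes> \<psi> W) = (idm C (Z \<odot> X) \<otimes> \<psi> W) \<cdot> (\<phi> Z \<otimes> idm C (Y \<odot> W))"
    using whisker_exchange[of "\<phi> Z" "\<psi> W"] by simp
  also have "(idm C Z \<otimes> (\<phi> W \<otimes> idm C Y)) \<cdot> (((idm C (Z \<odot> X) \<otimes> \<psi> W) \<cdot> (\<phi> Z \<otimes> idm C (Y \<odot> W))) \<cdot> (idm C X \<otimes> (\<psi> Z \<otimes> idm C W)))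
     = (idm C Z \<otimes> ((\<phi> W \<otimes> idm C Y) \<cdot> (idm C X \<otimes> \<psi> W))) \<cdot> (((\<phi> Z \<otimes> idm C Y) \<cdot> (idm C X \<otimes> \<psi> Z)) \<otimes> idm C W)"
    by (simp add: whisker)
  finally show "(\<lambda>Z\<in>Ob C. (\<phi> Z \<otimes> idm C Y) \<cdot> (idm C X \<otimes> \<psi> Z)) (Z \<odot> W) =
    (idm C Z \<otimes> (\<lambda>Z\<in>Ob C. (\<phi> Z \<otimes> idm C Y) \<cdot> (idm C X \<otimes> \<psi> Z)) W) \<cdot>
    ((\<lambda>Z\<in>Ob C. (\<phi> Z \<otimes> idm C Y) \<cdot> (idm C X \<otimes> \<psi> Z)) Z \<otimes> idm C W)" by simp
qed simp

abbreviation CenC where "CenC \<equiv> drinfeld_center C"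

lemma center_sel:
  "unit CenC = (unit C, \<lambda>Y\<in>Ob C. idm C Y)"
  "A \<odot>\<^bsub>CenC\<^esub> B = (fst A \<odot> fst B, \<lambda>Y\<in>Ob C. (snd A Y \<otimes> idm C (fst B)) \<cdot> (idm C (fst A) \<otimes> snd B Y))"
  "src (idm CenC A) = A" "tgt (idm CenC A) = A" "src (zero CenC A B) = A" "tgt (zero CenC A B) = B"
  "src (g \<cdot>\<^bsub>CenC\<^esub> f) = src f" "tgt (g \<cdot>\<^bsub>CenC\<^esub> f) = tgt g"
  "src (add CenC f g) = src f" "tgt (add CenC f g) = tgt f" "src (scale CenC c f) = src f" "tgt (scale CenC c f) = tgt f"
  "src (f \<otimes>\<^bsub>CenC\<^esub> g) = src f \<odot>\<^bsub>CenC\<^esub> src g" "tgt (f \<otimes>\<^bsub>CenC\<^esub> g) = tgt f \<odot>\<^bsub>CenC\<^esub> tgt g"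
  "dat (idm CenC A) = idm C (fst A)" "dat (zero CenC A B) = zero C (fst A) (fst B)" "dat (g \<cdot>\<^bsub>CenC\<^esub> f) = dat g \<cdot> dat f"
  "dat (add CenC f g) = add C (dat f) (dat g)" "dat (scale CenC c f) = scale C c (dat f)"
  "dat (f \<otimes>\<^bsub>CenC\<^esub> g) = dat f \<otimes> dat g"
  by (simp_all add: drinfeld_center_def)

lemma center_Ob: "A \<in> Ob CenC \<longleftrightarrow> half_braiding C (fst A) (snd A)"
  by (cases A) (auto simp: drinfeld_center_def)

lemma center_Hom:
  assumes "A \<in> Ob CenC" "B \<in> Ob CenC"
  shows "f \<in> Hom CenC A B \<longleftrightarrow> src f = A \<and> tgt f = B \<and> arr (dat f) \<and> dom (dat f) = fst A \<and> cod (dat f) = fst B \<and>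
    (\<forall>Y\<in>Ob C. (idm C Y \<otimes> dat f) \<cdot> snd A Y = snd B Y \<cdot> (dat f \<otimes> idm C Y))"
  using assms half_braidingD(1)
  by (cases f) (auto simp: drinfeld_center_def center_Ob[unfolded drinfeld_center_def] Hom_iff)

lemma center_arrow: "arrow CenC f A B \<longleftrightarrow> A \<in> Ob CenC \<and> B \<in> Ob CenC \<and> src f = A \<and> tgt f = B \<and>
    arr (dat f) \<and> dom (dat f) = fst A \<and> cod (dat f) = fst B \<and>
    (\<forall>Y\<in>Ob C. (idm C Y \<otimes> dat f) \<cdot> snd A Y = snd B Y \<cdot> (dat f \<otimes> idm C Y))"
  unfolding arrow_def[of CenC] using center_Hom by blast

text \<open>The first factor is slid through the half-braiding of \<open>A\<close> and the second
  through that of \<open>A'\<close>. In between, the pieces act on disjoint strands, so the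
  interchange law does the rest.\<close>

lemma center_tensM_natural:
  assumes f: "arrow CenC f A B" and g: "arrow CenC g A' B'" and Y [simp]: "Y \<in> Ob C"
  shows "(idm C Y \<otimes> (dat f \<otimes> dat g)) \<cdot> ((snd A Y \<otimes> idm C (fst A')) \<cdot> (idm C (fst A) \<otimes> snd A' Y)) =
    ((snd B Y \<otimes> idm C (fst B')) \<cdot> (idm C (fst B) \<otimes> snd B' Y)) \<cdot> ((dat f \<otimes> dat g) \<otimes> idm C Y)"
    (is "?l \<cdot> (?a \<cdot> ?b) = (?c \<cdot> ?d) \<cdot> ?r")
proof -
  note f' = f[unfolded center_arrow center_Ob] and g' = g[unfolded center_arrow center_Ob]
  have h: "half_braiding C (fst A) (snd A)" "half_braiding C (fst B) (snd B)"
    "half_braiding C (fst A') (snd A')" "half_braiding C (fst B') (snd B')" using f' g' by auto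
  note [simp] = half_braidingD(1)[OF h(1)] half_braidingD(1)[OF h(2)] half_braidingD(1)[OF h(3)] half_braidingD(1)[OF h(4)]
    half_braidingD(4-6)[OF h(1)] half_braidingD(4-6)[OF h(2)] half_braidingD(4-6)[OF h(3)] half_braidingD(4-6)[OF h(4)]
  have fs [simp]: "arr (dat f)" "dom (dat f) = fst A" "cod (dat f) = fst B"
    and gs [simp]: "arr (dat g)" "dom (dat g) = fst A'" "cod (dat g) = fst B'"
    and fn: "(idm C Y \<otimes> dat f) \<cdot> snd A Y = snd B Y \<cdot> (dat f \<otimes> idm C Y)"
    and gn: "(idm C Y \<otimes> dat g) \<cdot> snd A' Y = snd B' Y \<cdot> (dat g \<otimes> idm C Y)"
    using f' g' Y by auto
  have "?l \<cdot> (?a \<cdot> ?b) = (((idm C Y \<otimes> dat f) \<otimes> dat g) \<cdot> (snd A Y \<otimes> idm C (fst A'))) \<cdot> ?b"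
    by (simp add: assoc_cmp assoc_tens)
  also have "\<dots> = ((snd B Y \<cdot> (dat f \<otimes> idm C Y)) \<otimes> (idm C (fst B') \<cdot> dat g)) \<cdot> ?b"
    by (subst cmp_tensM) (simp_all add: fn)
  also have "\<dots> = (?c \<cdot> ((dat f \<otimes> idm C Y) \<otimes> dat g)) \<cdot> ?b"
    by (subst cmp_tensM[symmetric]) simp_all
  also have "\<dots> = ?c \<cdot> ((dat f \<otimes> (idm C Y \<otimes> dat g)) \<cdot> ?b)"
    by (simp add: assoc_cmp assoc_tens)
  also have "(dat f \<otimes> (idm C Y \<otimes> dat g)) \<cdot> ?b = (idm C (fst B) \<cdot> dat f) \<otimes> (snd B' Y \<cdot> (dat g \<otimes> idm C Y))"
    by (subst cmp_tensM) (simp_all add: gn)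
  also have "\<dots> = ?d \<cdot> ?r"
    by (subst cmp_tensM[symmetric]) (simp_all add: assoc_tens)
  finally show ?thesis by (simp add: assoc_cmp assoc_tens)
qed

lemma center_monoidal: "strict_lin_monoidal CenC"
proof (rule concrete_monoidal[where U = fst and J = "\<lambda>A. idm C (fst A)"])
  show uo: "unit CenC \<in> Ob CenC"
    by (auto simp: center_Ob center_sel half_braiding_iff is_iso_idm)
  fix f g A B D A' B' c
  note D = half_braidingD[OF iffD1[OF center_Ob]]
  show ob: "A \<odot>\<^bsub>CenC\<^esub> B \<in> Ob CenC" if "A \<in> Ob CenC" "B \<in> Ob CenC" for A B
    using that half_braiding_tensor by (simp add: center_Ob center_sel)
  show "(A \<odot>\<^bsub>CenC\<^esub> B) \<odot>\<^bsub>CenC\<^esub> D = A \<odot>\<^bsub>CenC\<^esub> (B \<odot>\<^bsub>CenC\<^esub> D)" if [simp]: "A \<in> Ob CenC" "B \<in> Ob CenC" "D \<in> Ob CenC"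
    by (auto simp: center_sel D(1,4,5,6) whisker intro!: restrict_ext)
  show "unit CenC \<odot>\<^bsub>CenC\<^esub> A = A" "A \<odot>\<^bsub>CenC\<^esub> unit CenC = A" if [simp]: "A \<in> Ob CenC"
    using D(2)[of A] by (auto simp: center_sel D(1,4,5,6) prod_eq_iff intro!: extensionalityI[of _ "Ob C"])
  show "idm CenC A \<in> Hom CenC A A" if "A \<in> Ob CenC"
    using that by (simp add: center_Hom center_sel D(1,4,5,6))
  show "zero CenC A B \<in> Hom CenC A B" if "A \<in> Ob CenC" "B \<in> Ob CenC"
    using that by (simp add: center_Hom center_sel D(1,4,5,6))
  show "g \<cdot>\<^bsub>CenC\<^esub> f \<in> Hom CenC A D" if f: "arrow CenC f A B" and g: "arrow CenC g B D"
  proof -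
    note f' = f[unfolded center_arrow] and g' = g[unfolded center_arrow]
    have "(idm C Y \<otimes> (dat g \<cdot> dat f)) \<cdot> snd A Y = snd D Y \<cdot> ((dat g \<cdot> dat f) \<otimes> idm C Y)" if [simp]: "Y \<in> Ob C" for Y
    proof -
      have o [simp]: "A \<in> Ob CenC" "B \<in> Ob CenC" "D \<in> Ob CenC" "arr (dat f)" "arr (dat g)" "dom (dat f) = fst A"
         "cod (dat f) = fst B" "dom (dat g) = fst B" "cod (dat g) = fst D" using f' g' by auto
      note [simp] = D(1,4,5,6)
      have "(idm C Y \<otimes> (dat g \<cdot> dat f)) \<cdot> snd A Y = (idm C Y \<otimes> dat g) \<cdot> ((idm C Y \<otimes> dat f) \<cdot> snd A Y)"
        by (simp add: whisker)
      also have "\<dots> = ((idm C Y \<otimes> dat g) \<cdot> snd B Y) \<cdot> (dat f \<otimes> idm C Y)"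
        using f' by (simp add: assoc_cmp)
      also have "\<dots> = snd D Y \<cdot> ((dat g \<cdot> dat f) \<otimes> idm C Y)"
        using g' by (simp add: whisker)
      finally show ?thesis .
    qed
    then show ?thesis using f' g' by (simp add: center_Hom center_sel)
  qed
  show "add CenC f g \<in> Hom CenC A B" if f: "arrow CenC f A B" and g: "arrow CenC g A B"
    using f g by (auto simp: center_Hom center_arrow center_sel distrib_simps D(1,4,5,6))
  show "scale CenC c f \<in> Hom CenC A B" if f: "arrow CenC f A B"
    using f by (auto simp: center_Hom center_arrow center_sel scale_simps D(1,4,5,6))
  show "f \<otimes>\<^bsub>CenC\<^esub> g \<in> Hom CenC (A \<odot>\<^bsub>CenC\<^esub> A') (B \<odot>\<^bsub>CenC\<^esub> B')" if f: "arrow CenC f A B" and g: "arrow CenC g A' B'"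
    using f g center_tensM_natural[OF f g] ob[of A A'] ob[of B B']
    by (simp add: center_Hom center_arrow center_sel)
  show "src f = A \<and> tgt f = B \<and> arrow C (dat f) (fst A) (fst B)" if "arrow CenC f A B"
    using that by (simp add: center_arrow arrow_iff)
  show "dat f \<cdot> idm C (fst A) = dat f \<and> idm C (fst B) \<cdot> dat f = dat f" if "arrow CenC f A B"
    using that by (simp add: center_arrow)
  show "idm C (fst (A \<odot>\<^bsub>CenC\<^esub> B)) = idm C (fst A) \<otimes> idm C (fst B)" if "A \<in> Ob CenC" "B \<in> Ob CenC"
    using that by (simp add: center_sel D(1))
qed (auto simp: center_sel)

text \<open>Makes the results of this locale on isomorphisms and biproducts available inside the
  center.\<close>

lemma center_monoidal_dc: "strict_lin_monoidal_dc CenC src tgt"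
proof (rule strict_lin_monoidal_dc.intro[OF center_monoidal], unfold_locales)
  show "src f = X" "tgt f = Y" if "f \<in> Hom CenC X Y" for f X Y
    using that by (auto simp: drinfeld_center_def)
qed (simp_all add: center_sel)

end

section \<open>Biproducts\<close>

text \<open>Label count of a nested decomposition: running over pairs adds up the labels of the
  parts.\<close>

lemma image_mset_Sigma:
  assumes "finite K" "\<And>k. k \<in> K \<Longrightarrow> finite (L k)"
  shows "image_mset (\<lambda>(k, l). f k l) (mset_set (Sigma K L)) = (\<Sum>k\<in>K. image_mset (f k) (mset_set (L k)))"
  using assms
proof (induction K rule: finite_induct)
  case (insert a K)
  have "Sigma (insert a K) L = Pair a ` L a \<union> Sigma K L" by auto
  moreover have "Pair a ` L a \<inter> Sigma K L = {}" using insert.hyps by auto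
  ultimately have "mset_set (Sigma (insert a K) L) = mset_set (Pair a ` L a) + mset_set (Sigma K L)"
    using insert by (simp add: mset_set_Union finite_SigmaI)
  moreover have "mset_set (Pair a ` L a) = image_mset (Pair a) (mset_set (L a))"
    by (simp add: image_mset_mset_set inj_on_def)
  ultimately show ?case using insert by (simp add: image_mset.compositionality comp_def)
qed simp

context strict_lin_monoidal_dc
begin

definition sub :: "'b \<Rightarrow> 'b \<Rightarrow> 'b" where "sub f g = add C f (scale C (- 1) g)"

lemma sub_simps [simp]:
  "arr f \<Longrightarrow> arr g \<Longrightarrow> dom f = dom g \<Longrightarrow> cod f = cod g \<Longrightarrow> arr (sub f g)"
  "dom (sub f g) = dom f" "cod (sub f g) = cod f"
  "arr f \<Longrightarrow> sub f f = zero C (dom f) (cod f)"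
  "arr f \<Longrightarrow> dom f = X \<Longrightarrow> cod f = Y \<Longrightarrow> sub f (zero C X Y) = f"
  using ob_simps(1,2)[of f] by (simp_all add: sub_def add_simps)

lemma sub_cmp:
  "arr f \<Longrightarrow> arr g \<Longrightarrow> arr h \<Longrightarrow> dom g = dom h \<Longrightarrow> cod g = cod h \<Longrightarrow> dom h = cod f \<Longrightarrow>
    sub g h \<cdot> f = sub (g \<cdot> f) (h \<cdot> f)"
  "arr f \<Longrightarrow> arr g \<Longrightarrow> arr h \<Longrightarrow> dom g = dom h \<Longrightarrow> cod g = cod h \<Longrightarrow> dom f = cod h \<Longrightarrow>
    f \<cdot> sub g h = sub (f \<cdot> g) (f \<cdot> h)"
  by (simp_all add: sub_def distrib_simps scale_simps)

lemma add_sub: "arr f \<Longrightarrow> arr g \<Longrightarrow> dom f = dom g \<Longrightarrow> cod f = cod g \<Longrightarrow> add C (sub f g) g = f"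
  using add_simps(4)[of g] add_commute[of "scale C (- 1) g" g] by (simp add: sub_def add_simps)

lemma sub_eq_zero: "arr f \<Longrightarrow> arr g \<Longrightarrow> dom f = dom g \<Longrightarrow> cod f = cod g \<Longrightarrow> sub f g = zero C (dom g) (cod g) \<Longrightarrow> f = g"
  using add_sub[of f g] by (simp add: add_simps)

lemma csum_cong: "(\<And>x. x \<in> set xs \<Longrightarrow> f x = g x) \<Longrightarrow> csum C X Y (map f xs) = csum C X Y (map g xs)"
  by (auto intro!: arg_cong[where f = "csum C X Y"])

lemma csum_typing:
  assumes "X \<in> Ob C" "Y \<in> Ob C" "\<And>x. x \<in> set xs \<Longrightarrow> arr (f x) \<and> dom (f x) = X \<and> cod (f x) = Y"
  shows "arr (csum C X Y (map f xs))" "dom (csum C X Y (map f xs)) = X" "cod (csum C X Y (map f xs)) = Y"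
  using arrow_csum[OF assms(1,2), of "map f xs"] assms(3) by (auto simp: arrow_iff)

lemma csum_single:
  assumes "X \<in> Ob C" "Y \<in> Ob C" "distinct xs" "k \<in> set xs"
    and "\<And>l. l \<in> set xs \<Longrightarrow> l \<noteq> k \<Longrightarrow> f l = zero C X Y" "arr (f k)" "dom (f k) = X" "cod (f k) = Y"
  shows "csum C X Y (map f xs) = f k"
  using assms
proof (induction xs)
  case (Cons x xs)
  show ?case
  proof (cases "x = k")
    case True
    then have "csum C X Y (map f xs) = csum C X Y (map (\<lambda>_. zero C X Y) xs)"
      using Cons.prems by (intro csum_cong) auto
    then show ?thesis using True Cons.prems by (simp add: csum_zero add_simps)
  next
    case False then show ?thesis using Cons by (simp add: add_simps)
  qed
qed simp

text \<open>Completeness of the family is expressed by the projections being jointly monic; this avoids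
  sums and is equivalent to the usual condition, see \<open>biprod_csum\<close> and \<open>biprodI_csum\<close>.\<close>

definition biprod :: "'a \<Rightarrow> 'i set \<Rightarrow> ('i \<Rightarrow> 'a) \<Rightarrow> ('i \<Rightarrow> 'b) \<Rightarrow> ('i \<Rightarrow> 'b) \<Rightarrow> bool" where
  "biprod X K A \<iota> \<pi> \<longleftrightarrow> X \<in> Ob C \<and> finite K \<and>
    (\<forall>k\<in>K. A k \<in> Ob C \<and> arr (\<iota> k) \<and> dom (\<iota> k) = A k \<and> cod (\<iota> k) = X \<and>
      arr (\<pi> k) \<and> dom (\<pi> k) = X \<and> cod (\<pi> k) = A k) \<and>
    (\<forall>k\<in>K. \<forall>l\<in>K. \<pi> k \<cdot> \<iota> l = (if k = l then idm C (A k) else zero C (A l) (A k))) \<and>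
    (\<forall>f. arr f \<and> cod f = X \<and> (\<forall>k\<in>K. \<pi> k \<cdot> f = zero C (dom f) (A k)) \<longrightarrow> f = zero C (dom f) X)"

lemma biprodD:
  assumes "biprod X K A \<iota> \<pi>"
  shows "X \<in> Ob C" "finite K" "k \<in> K \<Longrightarrow> A k \<in> Ob C"
    "k \<in> K \<Longrightarrow> arr (\<iota> k)" "k \<in> K \<Longrightarrow> dom (\<iota> k) = A k" "k \<in> K \<Longrightarrow> cod (\<iota> k) = X"
    "k \<in> K \<Longrightarrow> arr (\<pi> k)" "k \<in> K \<Longrightarrow> dom (\<pi> k) = X" "k \<in> K \<Longrightarrow> cod (\<pi> k) = A k"
    "k \<in> K \<Longrightarrow> l \<in> K \<Longrightarrow> \<pi> k \<cdot> \<iota> l = (if k = l then idm C (A k) else zero C (A l) (A k))"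
  using assms by (simp_all add: biprod_def)

lemma biprod_monic:
  assumes "biprod X K A \<iota> \<pi>" "arr f" "cod f = X" "\<And>k. k \<in> K \<Longrightarrow> \<pi> k \<cdot> f = zero C (dom f) (A k)"
  shows "f = zero C (dom f) X"
  using assms by (simp add: biprod_def)

lemma biprod_eqI:
  assumes b: "biprod X K A \<iota> \<pi>" and f: "arr f" "cod f = X" and g: "arr g" "cod g = X" "dom f = dom g"
    and e: "\<And>k. k \<in> K \<Longrightarrow> \<pi> k \<cdot> f = \<pi> k \<cdot> g"
  shows "f = g"
proof -
  have "\<pi> k \<cdot> sub f g = zero C (dom (sub f g)) (A k)" if "k \<in> K" for k
    using that f g e biprodD[OF b] by (simp add: sub_cmp)
  from biprod_monic[OF b _ _ this] have "sub f g = zero C (dom (sub f g)) X"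
    using f g by simp
  then show ?thesis using sub_eq_zero[of f g] f g by simp
qed

text \<open>Tested against the jointly monic projections: by orthogonality only one term survives
  when \<open>\<pi> k\<close> is composed with the sum, and it is \<open>\<pi> k\<close>.\<close>

lemma biprod_csum:
  assumes b: "biprod X K A \<iota> \<pi>" and ks: "distinct ks" "set ks = K"
  shows "csum C X X (map (\<lambda>k. \<iota> k \<cdot> \<pi> k) ks) = idm C X"
proof (rule biprod_eqI[OF b])
  note [simp] = biprodD[OF b]
  have "arr (\<iota> k \<cdot> \<pi> k) \<and> dom (\<iota> k \<cdot> \<pi> k) = X \<and> cod (\<iota> k \<cdot> \<pi> k) = X" if "k \<in> set ks" for k
    using ks that by simp
  from csum_typing[OF biprodD(1)[OF b] biprodD(1)[OF b] this]
  show "arr (csum C X X (map (\<lambda>k. \<iota> k \<cdot> \<pi> k) ks))" "cod (csum C X X (map (\<lambda>k. \<iota> k \<cdot> \<pi> k) ks)) = X"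
    "dom (csum C X X (map (\<lambda>k. \<iota> k \<cdot> \<pi> k) ks)) = dom (idm C X)"
    by simp_all
  fix k assume k: "k \<in> K"
  have "\<pi> k \<cdot> csum C X X (map (\<lambda>k. \<iota> k \<cdot> \<pi> k) ks) = csum C X (A k) (map (\<lambda>l. \<pi> k \<cdot> (\<iota> l \<cdot> \<pi> l)) ks)"
    by (rule csum_cmp_left) (use k ks in \<open>auto simp: arrow_iff\<close>)
  also have "\<dots> = csum C X (A k) (map (\<lambda>l. (\<pi> k \<cdot> \<iota> l) \<cdot> \<pi> l) ks)"
    by (rule csum_cong) (use k ks in \<open>auto simp: assoc_cmp simp del: biprodD(10)[OF b]\<close>)
  also have "\<dots> = (\<pi> k \<cdot> \<iota> k) \<cdot> \<pi> k"
    by (rule csum_single) (use k ks in auto)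
  finally show "\<pi> k \<cdot> csum C X X (map (\<lambda>k. \<iota> k \<cdot> \<pi> k) ks) = \<pi> k \<cdot> idm C X" using k by simp
qed (use biprodD[OF b] in simp_all)

lemma biprodI_csum:
  assumes "X \<in> Ob C" "distinct ks"
    and t: "\<And>k. k \<in> set ks \<Longrightarrow> A k \<in> Ob C \<and> arr (\<iota> k) \<and> dom (\<iota> k) = A k \<and> cod (\<iota> k) = X \<and>
      arr (\<pi> k) \<and> dom (\<pi> k) = X \<and> cod (\<pi> k) = A k"
    and o: "\<And>k l. k \<in> set ks \<Longrightarrow> l \<in> set ks \<Longrightarrow> \<pi> k \<cdot> \<iota> l = (if k = l then idm C (A k) else zero C (A l) (A k))"
    and s: "csum C X X (map (\<lambda>k. \<iota> k \<cdot> \<pi> k) ks) = idm C X"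
  shows "biprod X (set ks) A \<iota> \<pi>"
  unfolding biprod_def
proof (intro conjI ballI allI impI; (elim conjE)?)
  fix f assume f: "arr f" "cod f = X" "\<forall>k\<in>set ks. \<pi> k \<cdot> f = zero C (dom f) (A k)"
  have "f = csum C X X (map (\<lambda>k. \<iota> k \<cdot> \<pi> k) ks) \<cdot> f" using f s by simp
  also have "\<dots> = csum C (dom f) X (map (\<lambda>k. (\<iota> k \<cdot> \<pi> k) \<cdot> f) ks)"
    by (rule csum_cmp_right) (use f assms(1) t in \<open>auto simp: arrow_iff\<close>)
  also have "\<dots> = csum C (dom f) X (map (\<lambda>k. zero C (dom f) X) ks)"
    by (rule csum_cong) (use f t in \<open>simp add: assoc_cmp\<close>)
  also have "\<dots> = zero C (dom f) X" using f assms(1) by (simp add: csum_zero)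
  finally show "f = zero C (dom f) X" .
qed (use assms in simp_all)

text \<open>The bridge between the list with its sum formula, in which the theorem is stated, and
  \<open>biprod\<close>, in which all arguments are carried out.\<close>

lemma is_direct_sum_iff_biprod:
  "is_direct_sum C X As \<longleftrightarrow> (\<exists>\<iota> \<pi>. biprod X {..<length As} (\<lambda>k. As ! k) \<iota> \<pi>)"
proof
  assume "is_direct_sum C X As"
  then obtain \<iota> \<pi> where X: "X \<in> Ob C" and As: "set As \<subseteq> Ob C"
    and t: "\<And>k. k < length As \<Longrightarrow> \<iota> k \<in> Hom C (As ! k) X \<and> \<pi> k \<in> Hom C X (As ! k)"
    and o: "\<And>k l. k < length As \<Longrightarrow> l < length As \<Longrightarrow>
      \<pi> k \<cdot> \<iota> l = (if k = l then idm C (As ! k) else zero C (As ! l) (As ! k))"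
    and s: "csum C X X (map (\<lambda>k. \<iota> k \<cdot> \<pi> k) [0..<length As]) = idm C X"
    unfolding is_direct_sum_def by blast
  have Ob: "As ! k \<in> Ob C" if "k < length As" for k using As that by auto
  have "biprod X (set [0..<length As]) (\<lambda>k. As ! k) \<iota> \<pi>"
  proof (rule biprodI_csum)
    show "As ! k \<in> Ob C \<and> arr (\<iota> k) \<and> dom (\<iota> k) = As ! k \<and> cod (\<iota> k) = X \<and>
      arr (\<pi> k) \<and> dom (\<pi> k) = X \<and> cod (\<pi> k) = As ! k" if "k \<in> set [0..<length As]" for k
      using t[of k] Ob[of k] that X by (simp add: Hom_iff)
  qed (use X o s in simp_all)
  then show "\<exists>\<iota> \<pi>. biprod X {..<length As} (\<lambda>k. As ! k) \<iota> \<pi>" by (auto simp: atLeast0LessThan)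
next
  assume "\<exists>\<iota> \<pi>. biprod X {..<length As} (\<lambda>k. As ! k) \<iota> \<pi>"
  then obtain \<iota> \<pi> where b: "biprod X {..<length As} (\<lambda>k. As ! k) \<iota> \<pi>" by blast
  have "csum C X X (map (\<lambda>k. \<iota> k \<cdot> \<pi> k) [0..<length As]) = idm C X"
    by (rule biprod_csum[OF b]) (simp_all add: atLeast0LessThan)
  moreover have "set As \<subseteq> Ob C" using biprodD(3)[OF b] by (auto simp: in_set_conv_nth)
  ultimately show "is_direct_sum C X As"
    unfolding is_direct_sum_def using biprodD[OF b]
    by (intro conjI exI[of _ \<iota>] exI[of _ \<pi>]) (auto simp: Hom_iff)
qed

lemma biprod_reindex:
  assumes b: "biprod X K A \<iota> \<pi>" and h: "bij_betw h K' K"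
  shows "biprod X K' (A \<circ> h) (\<iota> \<circ> h) (\<pi> \<circ> h)"
proof -
  have K: "finite K'" "\<And>k. k \<in> K' \<Longrightarrow> h k \<in> K" "\<And>k l. k \<in> K' \<Longrightarrow> l \<in> K' \<Longrightarrow> h k = h l \<longleftrightarrow> k = l"
    "\<And>P. (\<forall>k\<in>K'. P (h k)) \<Longrightarrow> (\<forall>k\<in>K. P k)"
    using h biprodD(2)[OF b] bij_betw_finite[OF h] by (auto simp: bij_betw_def inj_on_def)
  show ?thesis unfolding biprod_def
  proof (intro conjI ballI allI impI; (elim conjE)?)
    fix f assume "arr f" "cod f = X" "\<forall>k\<in>K'. (\<pi> \<circ> h) k \<cdot> f = zero C (dom f) ((A \<circ> h) k)"
    then show "f = zero C (dom f) X" using K(4)[of "\<lambda>k. \<pi> k \<cdot> f = zero C (dom f) (A k)"]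
      biprod_monic[OF b, of f] by auto
  qed (use biprodD[OF b] K in simp_all)
qed

lemma biprod_cong:
  "biprod X K A \<iota> \<pi> \<Longrightarrow> (\<And>k. k \<in> K \<Longrightarrow> A k = B k) \<Longrightarrow> biprod X K B \<iota> \<pi>"
  unfolding biprod_def by (auto split: if_splits)

lemma biprod_iso_summands:
  assumes b: "biprod X K A \<iota> \<pi>" and i: "\<And>k. k \<in> K \<Longrightarrow> isomorphic C (A k) (B k)"
  shows "\<exists>\<iota>' \<pi>'. biprod X K B \<iota>' \<pi>'"
proof -
  have "\<forall>k. \<exists>u v. k \<in> K \<longrightarrow> B k \<in> Ob C \<and> inverse_pair C (A k) (B k) u v"
    using i by (auto simp: isomorphic_def is_iso_def)
  then obtain u v where "\<And>k. k \<in> K \<Longrightarrow> B k \<in> Ob C \<and> inverse_pair C (A k) (B k) (u k) (v k)" by metis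
  then have "\<And>k. k \<in> K \<Longrightarrow> B k \<in> Ob C \<and> arr (u k) \<and> dom (u k) = A k \<and> cod (u k) = B k \<and> arr (v k) \<and>
      dom (v k) = B k \<and> cod (v k) = A k \<and> v k \<cdot> u k = idm C (A k) \<and> u k \<cdot> v k = idm C (B k)"
    using biprodD(3)[OF b] inverse_pair_iff by meson
  then have uv [simp]: "k \<in> K \<Longrightarrow> B k \<in> Ob C" "k \<in> K \<Longrightarrow> arr (u k)" "k \<in> K \<Longrightarrow> dom (u k) = A k"
    "k \<in> K \<Longrightarrow> cod (u k) = B k" "k \<in> K \<Longrightarrow> arr (v k)" "k \<in> K \<Longrightarrow> dom (v k) = B k" "k \<in> K \<Longrightarrow> cod (v k) = A k"
    and uv': "k \<in> K \<Longrightarrow> v k \<cdot> u k = idm C (A k)" "k \<in> K \<Longrightarrow> u k \<cdot> v k = idm C (B k)" for k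
    by blast+
  note [simp] = biprodD(1-9)[OF b]
  have "biprod X K B (\<lambda>k. \<iota> k \<cdot> v k) (\<lambda>k. u k \<cdot> \<pi> k)"
    unfolding biprod_def
  proof (intro conjI ballI allI impI; (elim conjE)?)
    fix k l assume kl: "k \<in> K" "l \<in> K"
    have "(u k \<cdot> \<pi> k) \<cdot> (\<iota> l \<cdot> v l) = u k \<cdot> ((\<pi> k \<cdot> \<iota> l) \<cdot> v l)" using kl by (simp add: assoc_cmp)
    then show "(u k \<cdot> \<pi> k) \<cdot> (\<iota> l \<cdot> v l) = (if k = l then idm C (B k) else zero C (B l) (B k))"
      using kl by (simp add: biprodD(10)[OF b] uv')
  next
    fix f assume f: "arr f" "cod f = X" "\<forall>k\<in>K. (u k \<cdot> \<pi> k) \<cdot> f = zero C (dom f) (B k)"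
    show "f = zero C (dom f) X"
    proof (rule biprod_monic[OF b f(1,2)])
      fix k assume k: "k \<in> K"
      have "\<pi> k \<cdot> f = (v k \<cdot> u k) \<cdot> (\<pi> k \<cdot> f)" using k f by (simp add: uv')
      also have "\<dots> = v k \<cdot> ((u k \<cdot> \<pi> k) \<cdot> f)" using k f(1,2) by (simp add: assoc_cmp)
      also have "\<dots> = zero C (dom f) (A k)" using f k by simp
      finally show "\<pi> k \<cdot> f = zero C (dom f) (A k)" .
    qed
  qed simp_all
  then show ?thesis by blast
qed

lemma biprod_iso_total:
  assumes b: "biprod X K A \<iota> \<pi>" and i: "isomorphic C X Y"
  shows "\<exists>\<iota>' \<pi>'. biprod Y K A \<iota>' \<pi>'"
proof -
  obtain u v where i: "Y \<in> Ob C" "inverse_pair C X Y u v"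
    using i by (auto simp: isomorphic_def is_iso_def)
  then have uv [simp]: "Y \<in> Ob C" "arr u" "dom u = X" "cod u = Y" "arr v" "dom v = Y" "cod v = X"
    and uv': "v \<cdot> u = idm C X" "u \<cdot> v = idm C Y"
    using biprodD(1)[OF b] by (auto simp: inverse_pair_iff)
  note [simp] = biprodD(1-9)[OF b]
  have "biprod Y K A (\<lambda>k. u \<cdot> \<iota> k) (\<lambda>k. \<pi> k \<cdot> v)"
    unfolding biprod_def
  proof (intro conjI ballI allI impI; (elim conjE)?)
    fix k l assume kl: "k \<in> K" "l \<in> K"
    have "(\<pi> k \<cdot> v) \<cdot> (u \<cdot> \<iota> l) = \<pi> k \<cdot> ((v \<cdot> u) \<cdot> \<iota> l)" using kl by (simp add: assoc_cmp)
    then show "(\<pi> k \<cdot> v) \<cdot> (u \<cdot> \<iota> l) = (if k = l then idm C (A k) else zero C (A l) (A k))"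
      using kl by (simp add: biprodD(10)[OF b] uv')
  next
    fix f assume f: "arr f" "cod f = Y" "\<forall>k\<in>K. (\<pi> k \<cdot> v) \<cdot> f = zero C (dom f) (A k)"
    have "v \<cdot> f = zero C (dom (v \<cdot> f)) X"
      by (rule biprod_monic[OF b]) (use f in \<open>simp_all add: assoc_cmp[symmetric]\<close>)
    then have "u \<cdot> (v \<cdot> f) = zero C (dom f) Y" using f by simp
    moreover have "u \<cdot> (v \<cdot> f) = (u \<cdot> v) \<cdot> f" using f by (simp add: assoc_cmp)
    ultimately show "f = zero C (dom f) Y" using f by (simp add: uv')
  qed simp_all
  then show ?thesis by blast
qed

text \<open>Joint monicity is passed on one level at a time, so no double sum of idempotents has to
  be evaluated.\<close>

lemma biprod_nested:
  assumes b: "biprod X K A \<iota> \<pi>" and n: "\<And>k. k \<in> K \<Longrightarrow> biprod (A k) (L k) (B k) (\<iota>' k) (\<pi>' k)"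
  shows "biprod X (Sigma K L) (\<lambda>(k, l). B k l) (\<lambda>(k, l). \<iota> k \<cdot> \<iota>' k l) (\<lambda>(k, l). \<pi>' k l \<cdot> \<pi> k)"
proof -
  note [simp] = biprodD(1-9)[OF b] biprodD(1-9)[OF n]
  show ?thesis
    unfolding biprod_def
  proof (intro conjI ballI allI impI; (elim conjE)?)
    fix p r assume pr: "p \<in> Sigma K L" "r \<in> Sigma K L"
    obtain k l k' l' where p: "p = (k, l)" "k \<in> K" "l \<in> L k" and r: "r = (k', l')" "k' \<in> K" "l' \<in> L k'"
      using pr by auto
    have "(\<pi>' k l \<cdot> \<pi> k) \<cdot> (\<iota> k' \<cdot> \<iota>' k' l') = \<pi>' k l \<cdot> ((\<pi> k \<cdot> \<iota> k') \<cdot> \<iota>' k' l')" using p r by (simp add: assoc_cmp)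
    also have "\<dots> = (if p = r then idm C (B k l) else zero C (B k' l') (B k l))"
      using p r by (auto simp: biprodD(10)[OF b] biprodD(10)[OF n])
    finally show "(case p of (k, l) \<Rightarrow> \<pi>' k l \<cdot> \<pi> k) \<cdot> (case r of (k, l) \<Rightarrow> \<iota> k \<cdot> \<iota>' k l) =
      (if p = r then idm C (case p of (k, l) \<Rightarrow> B k l) else zero C (case r of (k, l) \<Rightarrow> B k l) (case p of (k, l) \<Rightarrow> B k l))"
      using p r by simp
  next
    fix f assume f: "arr f" "cod f = X"
      "\<forall>p\<in>Sigma K L. (case p of (k, l) \<Rightarrow> \<pi>' k l \<cdot> \<pi> k) \<cdot> f = zero C (dom f) (case p of (k, l) \<Rightarrow> B k l)"
    show "f = zero C (dom f) X"
    proof (rule biprod_monic[OF b f(1,2)])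
      fix k assume k: "k \<in> K"
      have "\<pi>' k l \<cdot> (\<pi> k \<cdot> f) = zero C (dom f) (B k l)" if "l \<in> L k" for l
      proof -
        have "\<pi>' k l \<cdot> (\<pi> k \<cdot> f) = (\<pi>' k l \<cdot> \<pi> k) \<cdot> f" using that k f(1,2) by (simp add: assoc_cmp)
        also have "\<dots> = zero C (dom f) (B k l)" using f(3) that k by auto
        finally show ?thesis .
      qed
      then have "\<pi> k \<cdot> f = zero C (dom (\<pi> k \<cdot> f)) (A k)"
        using biprod_monic[OF n[OF k], of "\<pi> k \<cdot> f"] f(1,2) k by simp
      then show "\<pi> k \<cdot> f = zero C (dom f) (A k)" by simp
    qed
  qed auto
qed

text \<open>Tensoring with \<open>Y\<close> does not visibly preserve joint monicity, but being
  additive it preserves the equation that writes the identity as a sum; hence the detour through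
  \<open>biprodI_csum\<close>.\<close>

lemma biprod_tens_right:
  assumes b: "biprod X K A \<iota> \<pi>" and Y: "Y \<in> Ob C"
  shows "biprod (X \<odot> Y) K (\<lambda>k. A k \<odot> Y) (\<lambda>k. \<iota> k \<otimes> idm C Y) (\<lambda>k. \<pi> k \<otimes> idm C Y)"
proof -
  note [simp] = biprodD[OF b] Y
  obtain ks where ks: "set ks = K" "distinct ks" using finite_distinct_list[OF biprodD(2)[OF b]] by blast
  have "biprod (X \<odot> Y) (set ks) (\<lambda>k. A k \<odot> Y) (\<lambda>k. \<iota> k \<otimes> idm C Y) (\<lambda>k. \<pi> k \<otimes> idm C Y)"
  proof (rule biprodI_csum)
    have "csum C (X \<odot> Y) (X \<odot> Y) (map (\<lambda>k. (\<iota> k \<otimes> idm C Y) \<cdot> (\<pi> k \<otimes> idm C Y)) ks) =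
      csum C (X \<odot> Y) (X \<odot> Y) (map (\<lambda>k. (\<iota> k \<cdot> \<pi> k) \<otimes> idm C Y) ks)"
      by (rule csum_cong) (use ks in \<open>simp add: cmp_tensM\<close>)
    also have "\<dots> = csum C X X (map (\<lambda>k. \<iota> k \<cdot> \<pi> k) ks) \<otimes> idm C Y"
      by (rule csum_tens_right[symmetric]) (use ks in \<open>auto simp: arrow_iff\<close>)
    finally show "csum C (X \<odot> Y) (X \<odot> Y) (map (\<lambda>k. (\<iota> k \<otimes> idm C Y) \<cdot> (\<pi> k \<otimes> idm C Y)) ks) = idm C (X \<odot> Y)"
      using biprod_csum[OF b ks(2,1)] by simp
  qed (use ks in \<open>simp_all add: cmp_tensM\<close>)
  then show ?thesis using ks by simp
qed

lemma biprod_tens_left: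
  assumes b: "biprod X K A \<iota> \<pi>" and Y: "Y \<in> Ob C"
  shows "biprod (Y \<odot> X) K (\<lambda>k. Y \<odot> A k) (\<lambda>k. idm C Y \<otimes> \<iota> k) (\<lambda>k. idm C Y \<otimes> \<pi> k)"
proof -
  note [simp] = biprodD[OF b] Y
  obtain ks where ks: "set ks = K" "distinct ks" using finite_distinct_list[OF biprodD(2)[OF b]] by blast
  have "biprod (Y \<odot> X) (set ks) (\<lambda>k. Y \<odot> A k) (\<lambda>k. idm C Y \<otimes> \<iota> k) (\<lambda>k. idm C Y \<otimes> \<pi> k)"
  proof (rule biprodI_csum)
    have "csum C (Y \<odot> X) (Y \<odot> X) (map (\<lambda>k. (idm C Y \<otimes> \<iota> k) \<cdot> (idm C Y \<otimes> \<pi> k)) ks) =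
      csum C (Y \<odot> X) (Y \<odot> X) (map (\<lambda>k. idm C Y \<otimes> (\<iota> k \<cdot> \<pi> k)) ks)"
      by (rule csum_cong) (use ks in \<open>simp add: cmp_tensM\<close>)
    also have "\<dots> = idm C Y \<otimes> csum C X X (map (\<lambda>k. \<iota> k \<cdot> \<pi> k) ks)"
      by (rule csum_tens_left[symmetric]) (use ks in \<open>auto simp: arrow_iff\<close>)
    finally show "csum C (Y \<odot> X) (Y \<odot> X) (map (\<lambda>k. (idm C Y \<otimes> \<iota> k) \<cdot> (idm C Y \<otimes> \<pi> k)) ks) = idm C (Y \<odot> X)"
      using biprod_csum[OF b ks(2,1)] by simp
  qed (use ks in \<open>simp_all add: cmp_tensM\<close>)
  then show ?thesis using ks by simp
qed

lemma biprod_tens: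
  assumes b: "biprod X K A \<iota> \<pi>" and b': "biprod Y L B \<iota>' \<pi>'"
  shows "\<exists>\<iota> \<pi>. biprod (X \<odot> Y) (K \<times> L) (\<lambda>(k, l). A k \<odot> B l) \<iota> \<pi>"
  using biprod_nested[OF biprod_tens_right[OF b biprodD(1)[OF b']], where L = "\<lambda>_. L" and B = "\<lambda>k l. A k \<odot> B l",
      OF biprod_tens_left[OF b' biprodD(3)[OF b]]] by blast

text \<open>The dual of joint monicity, obtained from the expression of the identity as a
  sum.\<close>

lemma biprod_epic:
  assumes b: "biprod X K A \<iota> \<pi>" and f: "arr f" "dom f = X" and z: "\<And>k. k \<in> K \<Longrightarrow> f \<cdot> \<iota> k = zero C (A k) (cod f)"
  shows "f = zero C X (cod f)"
proof -
  note [simp] = biprodD[OF b] f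
  obtain ks where ks: "set ks = K" "distinct ks" using finite_distinct_list[OF biprodD(2)[OF b]] by blast
  have "f = f \<cdot> csum C X X (map (\<lambda>k. \<iota> k \<cdot> \<pi> k) ks)" using biprod_csum[OF b ks(2,1)] by simp
  also have "\<dots> = csum C X (cod f) (map (\<lambda>k. f \<cdot> (\<iota> k \<cdot> \<pi> k)) ks)"
    by (rule csum_cmp_left) (use ks in \<open>auto simp: arrow_iff\<close>)
  also have "\<dots> = csum C X (cod f) (map (\<lambda>k. zero C X (cod f)) ks)"
    by (rule csum_cong) (use ks z in \<open>simp add: assoc_cmp[symmetric]\<close>)
  also have "\<dots> = zero C X (cod f)" by (simp add: csum_zero)
  finally show ?thesis .
qed

lemma biprod_singleton: "X \<in> Ob C \<Longrightarrow> biprod X {k} (\<lambda>_. X) (\<lambda>_. idm C X) (\<lambda>_. idm C X)"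
  by (auto simp: biprod_def)

lemma biprod_singleton_iso:
  assumes b: "biprod X {k} A \<iota> \<pi>" shows "isomorphic C X (A k)"
proof -
  note [simp] = biprodD[OF b]
  have "\<iota> k \<cdot> \<pi> k = idm C X" using biprod_csum[OF b, of "[k]"] by (simp add: add_simps)
  then have "inverse_pair C X (A k) (\<pi> k) (\<iota> k)" by (simp add: inverse_pair_iff)
  then show ?thesis by (auto simp: isomorphic_def is_iso_def)
qed

section \<open>Retracts and their complements\<close>

definition idempotents_split :: bool where
  "idempotents_split \<longleftrightarrow> (\<forall>e. arr e \<and> cod e = dom e \<and> e \<cdot> e = e \<longrightarrow>
    (\<exists>i p. arr i \<and> arr p \<and> dom p = dom e \<and> cod i = dom e \<and> cod p = dom i \<and>
      p \<cdot> i = idm C (dom i) \<and> i \<cdot> p = e))"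

text \<open>The complement of the retract \<open>T\<close> is the image of the idempotent
  \<open>idm C X - s \<cdot> r\<close>, which splits by assumption. This idempotent is killed by
  \<open>r\<close> on the left and by \<open>s\<close> on the right, whence the two vanishing
  statements.\<close>

lemma retract_complement:
  assumes sp: idempotents_split and s: "arr s" "dom s = T" "cod s = X" and r: "arr r" "dom r = X" "cod r = T"
    and rs: "r \<cdot> s = idm C T"
  obtains i p where "arr i" "arr p" "dom p = X" "cod i = X" "cod p = dom i" "p \<cdot> i = idm C (dom i)"
    "r \<cdot> i = zero C (dom i) T" "p \<cdot> s = zero C T (dom i)" "i \<cdot> p = sub (idm C X) (s \<cdot> r)"
proof -
  have Ob [simp]: "X \<in> Ob C" "T \<in> Ob C" using s ob_simps(1,2) by blast+
  note [simp] = s r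
  let ?e = "sub (idm C X) (s \<cdot> r)"
  have se: "r \<cdot> ?e = zero C X T" "?e \<cdot> s = zero C T X"
    using assoc_cmp[of s r s] assoc_cmp[of r s r] rs by (simp_all add: sub_cmp)
  have ss: "(s \<cdot> r) \<cdot> ?e = zero C X X"
    using se by (simp add: assoc_cmp)
  have "?e \<cdot> ?e = sub (idm C X \<cdot> ?e) ((s \<cdot> r) \<cdot> ?e)" by (subst sub_cmp(1)) simp_all
  also have "\<dots> = ?e" unfolding ss by simp
  finally have "?e \<cdot> ?e = ?e" .
  then obtain i p where ip: "arr i" "arr p" "dom p = X" "cod i = X" "cod p = dom i" "p \<cdot> i = idm C (dom i)" "i \<cdot> p = ?e"
    using sp[unfolded idempotents_split_def, rule_format, of ?e] by auto
  note [simp] = ip(1-5)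
  have "r \<cdot> i = r \<cdot> (i \<cdot> (p \<cdot> i))" using ip(6) by simp
  also have "\<dots> = (r \<cdot> (i \<cdot> p)) \<cdot> i" by (simp add: assoc_cmp)
  also have "\<dots> = zero C (dom i) T" unfolding ip(7) se by simp
  finally have 1: "r \<cdot> i = zero C (dom i) T" .
  have "p \<cdot> s = (p \<cdot> i) \<cdot> (p \<cdot> s)" using ip(6) by simp
  also have "\<dots> = p \<cdot> ((i \<cdot> p) \<cdot> s)" by (simp add: assoc_cmp)
  also have "\<dots> = zero C T (dom i)" unfolding ip(7) se by simp
  finally show ?thesis using that ip 1 by blast
qed

lemma retract_direct_sum:
  assumes sp: idempotents_split and s: "arr s" "dom s = T" "cod s = X" and r: "arr r" "dom r = X" "cod r = T"
    and rs: "r \<cdot> s = idm C T"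
  obtains Y i p where "is_direct_sum C X [T, Y]" "arr i" "arr p" "dom i = Y" "cod p = Y" "cod i = X" "dom p = X"
    "i \<cdot> p = sub (idm C X) (s \<cdot> r)"
proof -
  obtain i p where ip: "arr i" "arr p" "dom p = X" "cod i = X" "cod p = dom i" "p \<cdot> i = idm C (dom i)"
    "r \<cdot> i = zero C (dom i) T" "p \<cdot> s = zero C T (dom i)" "i \<cdot> p = sub (idm C X) (s \<cdot> r)"
    using retract_complement[OF assms] by blast
  have Ob [simp]: "X \<in> Ob C" "T \<in> Ob C" using s ob_simps(1,2) by blast+
  note [simp] = s r ip(1-5)
  have "biprod X (set [0, 1]) (\<lambda>k. [T, dom i] ! k) (\<lambda>k. if k = 0 then s else i) (\<lambda>k. if k = 0 then r else p)"
  proof (rule biprodI_csum)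
    show "csum C X X (map (\<lambda>k. (if k = 0 then s else i) \<cdot> (if k = 0 then r else p)) [0, 1::nat]) = idm C X"
      using add_sub[of "idm C X" "s \<cdot> r"] add_commute[of "i \<cdot> p" "s \<cdot> r"] ip(9) by (simp add: add_simps)
  qed (use rs ip(6-8) in auto)
  moreover have "set [0, 1] = {..<length [T, dom i]}" by auto
  ultimately have "is_direct_sum C X [T, dom i]" unfolding is_direct_sum_iff_biprod by metis
  then show ?thesis using that ip by blast
qed

lemma is_summandI:
  assumes "idempotents_split" "arr s" "dom s = T" "cod s = X" "arr r" "dom r = X" "cod r = T" "r \<cdot> s = idm C T"
  shows "is_summand C T X"
  using retract_direct_sum[OF assms] unfolding is_summand_def by metis

lemma is_summandE:
  assumes "is_summand C T X"
  obtains s r where "arr s" "dom s = T" "cod s = X" "arr r" "dom r = X" "cod r = T" "r \<cdot> s = idm C T"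
proof -
  obtain Y \<iota> \<pi> where b: "biprod X {..<2} (\<lambda>k. [T, Y] ! k) \<iota> \<pi>"
    using assms by (auto simp: is_summand_def is_direct_sum_iff_biprod numeral_2_eq_2)
  show ?thesis using biprodD(4-9)[OF b, of 0] biprodD(10)[OF b, of 0 0]
    by (intro that[of "\<iota> 0" "\<pi> 0"]) simp_all
qed

end

section \<open>Fusion of simple objects\<close>

context strict_lin_monoidal_dc
begin

definition simple_family :: "(nat \<Rightarrow> 'a) \<Rightarrow> bool" where
  "simple_family P \<longleftrightarrow> (\<forall>k. P k \<in> Ob C) \<and> (\<forall>f a b. arr f \<and> dom f = P a \<and> cod f = P b \<longrightarrow>
    f = zero C (P a) (P b) \<or> a = b \<and> (\<exists>c. f = scale C c (idm C (P a))))"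

lemma simple_familyD:
  assumes "simple_family P" "arr f" "dom f = P a" "cod f = P b" "f \<noteq> zero C (P a) (P b)"
  obtains c where "a = b" "c \<noteq> 0" "f = scale C c (idm C (P a))"
proof -
  obtain c where c: "a = b" "f = scale C c (idm C (P a))" using assms unfolding simple_family_def by blast
  have "P a \<in> Ob C" using assms by (simp add: simple_family_def)
  then have "c \<noteq> 0" using c assms(5) by auto
  then show ?thesis using that c by blast
qed

text \<open>The idempotent \<open>i \<cdot> p\<close> fixes every injection except
  \<open>\<iota> k0\<close>, so the remaining summands pass to the complement unchanged.\<close>

lemma exchange_complement:
  assumes b: "biprod Y K A \<iota> \<pi>" and k: "k0 \<in> K"
    and ip: "arr i" "arr p" "dom p = Y" "cod i = Y" "cod p = dom i" "p \<cdot> i = idm C (dom i)"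
    "\<pi> k0 \<cdot> i = zero C (dom i) (A k0)" "p \<cdot> \<iota> k0 = zero C (A k0) (dom i)" "i \<cdot> p = sub (idm C Y) (\<iota> k0 \<cdot> \<pi> k0)"
  shows "biprod (dom i) (K - {k0}) A (\<lambda>k. p \<cdot> \<iota> k) (\<lambda>k. \<pi> k \<cdot> i)"
proof -
  note [simp] = biprodD(1-9)[OF b] k ip(1-5)
  show ?thesis unfolding biprod_def
  proof (intro conjI ballI allI impI; (elim conjE)?)
    fix k l assume kl: "k \<in> K - {k0}" "l \<in> K - {k0}"
    have "(\<pi> k \<cdot> i) \<cdot> (p \<cdot> \<iota> l) = \<pi> k \<cdot> ((i \<cdot> p) \<cdot> \<iota> l)" using kl by (simp add: assoc_cmp)
    also have "(i \<cdot> p) \<cdot> \<iota> l = \<iota> l" unfolding ip(9) using kl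
      by (auto simp: sub_cmp assoc_cmp biprodD(10)[OF b])
    finally show "(\<pi> k \<cdot> i) \<cdot> (p \<cdot> \<iota> l) = (if k = l then idm C (A k) else zero C (A l) (A k))"
      using kl by (simp add: biprodD(10)[OF b])
  next
    fix f assume f: "arr f" "cod f = dom i" "\<forall>k\<in>K - {k0}. (\<pi> k \<cdot> i) \<cdot> f = zero C (dom f) (A k)"
    have "\<pi> k \<cdot> (i \<cdot> f) = zero C (dom (i \<cdot> f)) (A k)" if "k \<in> K" for k
    proof -
      have "\<pi> k \<cdot> (i \<cdot> f) = (\<pi> k \<cdot> i) \<cdot> f" using that f(1,2) by (simp add: assoc_cmp)
      then show ?thesis using f that ip(7) by (cases "k = k0") simp_all
    qed
    then have "i \<cdot> f = zero C (dom f) Y" using biprod_monic[OF b, of "i \<cdot> f"] f by simp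
    then have "p \<cdot> (i \<cdot> f) = zero C (dom f) (dom i)" using f by simp
    moreover have "p \<cdot> (i \<cdot> f) = f" using f ip(6) by (simp add: assoc_cmp[symmetric])
    ultimately show "f = zero C (dom f) (dom i)" by simp
  qed simp_all
qed

text \<open>Here the complement is taken with respect to a map \<open>r\<close> that need not be a
  projection of the given decomposition and is only known to be a nonzero scalar on
  \<open>B s\<close>. That suffices: its kernel is a complement of \<open>B s\<close>, hence
  isomorphic to the sum of the other summands.\<close>

lemma exchange_simple:
  assumes b: "biprod Y I B \<iota>' \<pi>'" and s: "s \<in> I"
    and r: "arr r" "dom r = Y" "cod r = B s" and c: "r \<cdot> \<iota>' s = scale C c (idm C (B s))" "c \<noteq> 0"
    and u: "arr u" "dom u = B s" "cod u = Y"
    and ip: "arr i" "arr p" "dom p = Y" "cod i = Y" "cod p = dom i" "p \<cdot> i = idm C (dom i)"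
    "r \<cdot> i = zero C (dom i) (B s)" "i \<cdot> p = sub (idm C Y) (u \<cdot> r)"
  shows "\<exists>\<iota>. biprod (dom i) (I - {s}) B \<iota> (\<lambda>k. \<pi>' k \<cdot> i)"
proof -
  note [simp] = biprodD(1-9)[OF b] s r u ip(1-5)
  \<comment> \<open>The projection onto the kernel of \<open>r\<close> along \<open>B s\<close>;
    dividing by \<open>c\<close> makes \<open>r\<close> annihilate it.\<close>
  define h where "h = sub (idm C Y) (\<iota>' s \<cdot> scale C (inverse c) r)"
  have h [simp]: "arr h" "dom h = Y" "cod h = Y" by (simp_all add: h_def)
  have "r \<cdot> (\<iota>' s \<cdot> scale C (inverse c) r) = (r \<cdot> \<iota>' s) \<cdot> scale C (inverse c) r" by (simp add: assoc_cmp)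
  also have "\<dots> = r" unfolding c using c(2) by (simp add: scale_simps)
  finally have rh: "r \<cdot> h = zero C Y (B s)" by (simp add: h_def sub_cmp)
  have iph: "(i \<cdot> p) \<cdot> h = h" unfolding ip(8) by (simp add: sub_cmp assoc_cmp rh)
  have "biprod (dom i) (I - {s}) B (\<lambda>t. p \<cdot> (h \<cdot> \<iota>' t)) (\<lambda>k. \<pi>' k \<cdot> i)" unfolding biprod_def
  proof (intro conjI ballI allI impI; (elim conjE)?)
    fix k l assume kl: "k \<in> I - {s}" "l \<in> I - {s}"
    have "(\<pi>' k \<cdot> i) \<cdot> (p \<cdot> (h \<cdot> \<iota>' l)) = \<pi>' k \<cdot> (((i \<cdot> p) \<cdot> h) \<cdot> \<iota>' l)" using kl by (simp add: assoc_cmp)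
    also have "\<dots> = (\<pi>' k \<cdot> h) \<cdot> \<iota>' l" unfolding iph using kl by (simp add: assoc_cmp)
    also have "\<pi>' k \<cdot> h = sub (\<pi>' k) ((\<pi>' k \<cdot> \<iota>' s) \<cdot> scale C (inverse c) r)"
      unfolding h_def using kl by (simp add: sub_cmp assoc_cmp)
    also have "\<dots> = \<pi>' k" using kl by (simp add: biprodD(10)[OF b])
    finally show "(\<pi>' k \<cdot> i) \<cdot> (p \<cdot> (h \<cdot> \<iota>' l)) = (if k = l then idm C (B k) else zero C (B l) (B k))"
      using kl by (simp add: biprodD(10)[OF b])
  next
    fix f assume f: "arr f" "cod f = dom i" "\<forall>k\<in>I - {s}. (\<pi>' k \<cdot> i) \<cdot> f = zero C (dom f) (B k)"
    define g where "g = i \<cdot> f"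
    have g [simp]: "arr g" "dom g = dom f" "cod g = Y" using f by (simp_all add: g_def)
    have pg: "\<pi>' k \<cdot> g = zero C (dom f) (B k)" if "k \<in> I" "k \<noteq> s" for k
      using f that by (simp add: g_def assoc_cmp[symmetric])
    \<comment> \<open>With its other components zero, \<open>g\<close> passes through
      \<open>B s\<close>, where \<open>r\<close> is multiplication by \<open>c\<close>. As
      \<open>r\<close> also kills \<open>g\<close>, the last component vanishes too.\<close>
    have g_eq: "g = \<iota>' s \<cdot> (\<pi>' s \<cdot> g)"
    proof (rule biprod_eqI[OF b])
      fix k assume k: "k \<in> I"
      have "\<pi>' k \<cdot> (\<iota>' s \<cdot> (\<pi>' s \<cdot> g)) = (\<pi>' k \<cdot> \<iota>' s) \<cdot> (\<pi>' s \<cdot> g)" using k by (simp add: assoc_cmp)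
      then show "\<pi>' k \<cdot> g = \<pi>' k \<cdot> (\<iota>' s \<cdot> (\<pi>' s \<cdot> g))" using k pg f(1) by (simp add: biprodD(10)[OF b])
    qed (use f(1) in simp_all)
    have "r \<cdot> g = r \<cdot> (\<iota>' s \<cdot> (\<pi>' s \<cdot> g))" using g_eq by (rule arg_cong)
    also have "\<dots> = (r \<cdot> \<iota>' s) \<cdot> (\<pi>' s \<cdot> g)" by (simp add: assoc_cmp)
    also have "\<dots> = scale C c (\<pi>' s \<cdot> g)" unfolding c by (simp add: scale_simps)
    finally have "scale C c (\<pi>' s \<cdot> g) = r \<cdot> g" by simp
    also have "\<dots> = (r \<cdot> i) \<cdot> f" using f by (simp add: g_def assoc_cmp)
    also have "\<dots> = zero C (dom f) (B s)" using f by (simp add: ip(7))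
    finally have "scale C (inverse c) (scale C c (\<pi>' s \<cdot> g)) = zero C (dom f) (B s)" using f(1) by simp
    then have "\<pi>' s \<cdot> g = zero C (dom f) (B s)" using c(2) by (simp add: scale_simps)
    then have "\<forall>k\<in>I. \<pi>' k \<cdot> g = zero C (dom g) (B k)" using pg by (metis g(2))
    then have "g = zero C (dom f) Y" using biprod_monic[OF b, of g] by simp
    then have "p \<cdot> (i \<cdot> f) = zero C (dom f) (dom i)" using f by (simp add: g_def)
    moreover have "p \<cdot> (i \<cdot> f) = f" using f ip(6) by (simp add: assoc_cmp[symmetric])
    ultimately show "f = zero C (dom f) (dom i)" by simp
  qed simp_all
  then show ?thesis by blast
qed

text \<open>Steinitz exchange. The projection onto \<open>A k0\<close> is nonzero, hence nonzero on
  some summand of the second decomposition; Schur's condition forces the label \<open>a\<close> and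
  a nonzero scalar there. Both decompositions then lose one summand of the same label over a common
  complement \<open>Z\<close>.\<close>

lemma exchange:
  assumes sp: idempotents_split and P: "simple_family P"
    and b: "biprod Y K A \<iota> \<pi>" and k: "k0 \<in> K" and a: "A k0 = P a" and nz: "idm C (P a) \<noteq> zero C (P a) (P a)"
    and b': "biprod Y I (\<lambda>t. P (lab t)) \<iota>' \<pi>'"
  obtains s Z \<iota>1 \<pi>1 \<iota>2 \<pi>2 where "s \<in> I" "lab s = a" "biprod Z (K - {k0}) A \<iota>1 \<pi>1"
    "biprod Z (I - {s}) (\<lambda>t. P (lab t)) \<iota>2 \<pi>2"
proof -
  note [simp] = biprodD(1-9)[OF b] k biprodD(4-9)[OF b'] a
  have P_Ob [simp]: "P k \<in> Ob C" for k using P by (simp add: simple_family_def)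
  have rs: "\<pi> k0 \<cdot> \<iota> k0 = idm C (P a)" using biprodD(10)[OF b k k] by simp
  have "\<pi> k0 \<noteq> zero C Y (P a)"
  proof
    assume z: "\<pi> k0 = zero C Y (P a)"
    have "\<pi> k0 \<cdot> \<iota> k0 = zero C (P a) (P a)" unfolding z by simp
    then show False using rs nz by simp
  qed
  then obtain s where s: "s \<in> I" "\<pi> k0 \<cdot> \<iota>' s \<noteq> zero C (P (lab s)) (P a)"
    using biprod_epic[OF b', of "\<pi> k0"] by auto
  then obtain c where c: "lab s = a" "c \<noteq> 0" "\<pi> k0 \<cdot> \<iota>' s = scale C c (idm C (P (lab s)))"
    using simple_familyD[OF P, of "\<pi> k0 \<cdot> \<iota>' s" "lab s" a] by auto
  obtain i p where ip: "arr i" "arr p" "dom p = Y" "cod i = Y" "cod p = dom i" "p \<cdot> i = idm C (dom i)"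
    "\<pi> k0 \<cdot> i = zero C (dom i) (P a)" "p \<cdot> \<iota> k0 = zero C (P a) (dom i)" "i \<cdot> p = sub (idm C Y) (\<iota> k0 \<cdot> \<pi> k0)"
    using retract_complement[OF sp, of "\<iota> k0" "P a" Y "\<pi> k0"] rs by auto
  have "biprod (dom i) (K - {k0}) A (\<lambda>k. p \<cdot> \<iota> k) (\<lambda>k. \<pi> k \<cdot> i)"
    by (rule exchange_complement[OF b k]) (use ip in simp_all)
  moreover obtain \<iota>2 where "biprod (dom i) (I - {s}) (\<lambda>t. P (lab t)) \<iota>2 (\<lambda>k. \<pi>' k \<cdot> i)"
    using exchange_simple[OF b' s(1), of "\<pi> k0" c "\<iota> k0" i p] c ip by auto
  ultimately show ?thesis using that s(1) c(1) by blast
qed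

text \<open>Repeated exchange strips off all summands except \<open>A k1\<close>, which need not be
  simple. What is left of the second decomposition decomposes \<open>A k1\<close>, and its labels
  are those of \<open>Y\<close> without the ones removed.\<close>

lemma cancel_simples:
  assumes sp: idempotents_split and P: "simple_family P" and nz: "\<And>a. idm C (P a) \<noteq> zero C (P a) (P a)"
  shows "biprod Y K A \<iota> \<pi> \<Longrightarrow> k1 \<in> K \<Longrightarrow> (\<And>k. k \<in> K - {k1} \<Longrightarrow> A k = P (lab' k)) \<Longrightarrow>
    biprod Y I (\<lambda>t. P (lab t)) \<iota>' \<pi>' \<Longrightarrow>
    \<exists>J \<iota> \<pi>. J \<subseteq> I \<and> biprod (A k1) J (\<lambda>t. P (lab t)) \<iota> \<pi> \<and>
      image_mset lab (mset_set I) = image_mset lab (mset_set J) + image_mset lab' (mset_set (K - {k1}))"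
proof (induction "card (K - {k1})" arbitrary: Y K I \<iota> \<pi> \<iota>' \<pi>')
  case 0
  have "finite K" using biprodD(2)[OF 0(2)] .
  then have "K - {k1} = {}" using 0(1) by simp
  then have "K = {k1}" using 0(3) by blast
  then have "isomorphic C Y (A k1)" using 0(2) biprod_singleton_iso[of Y k1 A \<iota> \<pi>] by simp
  then obtain \<iota>2 \<pi>2 where "biprod (A k1) I (\<lambda>t. P (lab t)) \<iota>2 \<pi>2" using biprod_iso_total[OF 0(5)] by blast
  then show ?case using \<open>K = {k1}\<close> by (intro exI[of _ I] exI[of _ \<iota>2] exI[of _ \<pi>2]) simp
next
  case (Suc n)
  have fin: "finite K" "finite I" using biprodD(2)[OF Suc(3)] biprodD(2)[OF Suc(6)] .
  then obtain k0 where k0: "k0 \<in> K - {k1}" using Suc(2) by (metis card.empty equals0I nat.distinct(1))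
  obtain s Z \<iota>1 \<pi>1 \<iota>2 \<pi>2 where e: "s \<in> I" "lab s = lab' k0" "biprod Z (K - {k0}) A \<iota>1 \<pi>1"
    "biprod Z (I - {s}) (\<lambda>t. P (lab t)) \<iota>2 \<pi>2"
    using exchange[OF sp P Suc(3) _ Suc(5)[OF k0] nz Suc(6)] k0 by blast
  have "n = card (K - {k0} - {k1})" using Suc(2) k0 fin
    by (metis Diff_insert Diff_insert2 card_Diff_singleton diff_Suc_1)
  from Suc(1)[OF this e(3) _ _ e(4)] obtain J \<iota> \<pi> where J: "J \<subseteq> I - {s}"
    "biprod (A k1) J (\<lambda>t. P (lab t)) \<iota> \<pi>"
    "image_mset lab (mset_set (I - {s})) = image_mset lab (mset_set J) + image_mset lab' (mset_set (K - {k0} - {k1}))"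
    using Suc(4,5) k0 by auto
  have "mset_set I = add_mset s (mset_set (I - {s}))" using e(1) fin by (simp add: mset_set.remove)
  moreover have "mset_set (K - {k1}) = add_mset k0 (mset_set (K - {k0} - {k1}))"
    using k0 fin by (metis Diff_insert Diff_insert2 finite_Diff mset_set.remove)
  ultimately show ?case using J e(2) by (intro exI[of _ J] exI[of _ \<iota>] exI[of _ \<pi>]) auto
qed

text \<open>Labels form a multiset because their order is immaterial. The index set consists of
  naturals since an existential quantifier cannot range over types; \<open>decomposesI\<close>
  renumbers any other index set.\<close>

definition decomposes :: "(nat \<Rightarrow> 'a) \<Rightarrow> 'a \<Rightarrow> nat multiset \<Rightarrow> bool" where
  "decomposes P X M \<longleftrightarrow> (\<exists>I :: nat set. \<exists>lab \<iota> \<pi>. biprod X I (\<lambda>t. P (lab t)) \<iota> \<pi> \<and> M = image_mset lab (mset_set I))"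

lemma decomposesI:
  assumes b: "biprod X K (\<lambda>t. P (lab t)) \<iota> \<pi>"
  shows "decomposes P X (image_mset lab (mset_set K))"
proof -
  obtain h where h: "bij_betw h {..<card K} K"
    using ex_bij_betw_nat_finite[OF biprodD(2)[OF b]] by (auto simp: atLeast0LessThan)
  have "image_mset lab (mset_set K) = image_mset (lab \<circ> h) (mset_set {..<card K})"
    using h by (simp add: image_mset_mset_set bij_betw_def image_mset.compositionality[symmetric])
  then show ?thesis unfolding decomposes_def using biprod_reindex[OF b h]
    by (intro exI[of _ "{..<card K}"] exI[of _ "lab \<circ> h"] exI[of _ "\<iota> \<circ> h"] exI[of _ "\<pi> \<circ> h"]) (simp add: comp_def)
qed

lemma decomposes_iso: "decomposes P X M \<Longrightarrow> isomorphic C X Y \<Longrightarrow> decomposes P Y M"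
  unfolding decomposes_def using biprod_iso_total by blast

lemma decomposes_self: "P k \<in> Ob C \<Longrightarrow> decomposes P (P k) {#k#}"
  using decomposesI[of "P k" "{k}" P "\<lambda>_. k"] biprod_singleton[of "P k" k] by simp

lemma decomposes_nested:
  assumes b: "biprod X K A \<iota> \<pi>" and d: "\<And>k. k \<in> K \<Longrightarrow> decomposes P (A k) (M k)"
  shows "decomposes P X (\<Sum>k\<in>K. M k)"
proof -
  from d have "\<forall>k. \<exists>I :: nat set. \<exists>lab \<iota> \<pi>. k \<in> K \<longrightarrow>
    biprod (A k) I (\<lambda>t. P (lab t)) \<iota> \<pi> \<and> M k = image_mset lab (mset_set I)"
    unfolding decomposes_def by metis
  then obtain I lab \<iota>' \<pi>' where "\<forall>k. k \<in> K \<longrightarrow>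
      biprod (A k) (I k :: nat set) (\<lambda>t. P (lab k t)) (\<iota>' k) (\<pi>' k) \<and> M k = image_mset (lab k) (mset_set (I k))"
    unfolding choice_iff by blast
  then have n: "biprod (A k) (I k) (\<lambda>t. P (lab k t)) (\<iota>' k) (\<pi>' k)" and M: "M k = image_mset (lab k) (mset_set (I k))"
    if "k \<in> K" for k using that by auto
  have "biprod X (Sigma K I) (\<lambda>p. P ((\<lambda>(k, t). lab k t) p)) (\<lambda>(k, l). \<iota> k \<cdot> \<iota>' k l) (\<lambda>(k, l). \<pi>' k l \<cdot> \<pi> k)"
    using biprod_nested[OF b n] by (simp add: case_prod_unfold)
  from decomposesI[OF this] show ?thesis
    using M biprodD(2)[OF b] biprodD(2)[OF n] by (simp add: image_mset_Sigma)
qed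

lemma decomposes_tensO:
  assumes d: "decomposes P X M" and Y: "Y \<in> Ob C" and F: "\<And>k. k \<in># M \<Longrightarrow> decomposes P (P k \<odot> Y) (F k)"
  shows "decomposes P (X \<odot> Y) (\<Sum>k\<in>#M. F k)"
proof -
  obtain I :: "nat set" and lab \<iota> \<pi> where b: "biprod X I (\<lambda>t. P (lab t)) \<iota> \<pi>" and M: "M = image_mset lab (mset_set I)"
    using d unfolding decomposes_def by blast
  have "decomposes P (X \<odot> Y) (\<Sum>t\<in>I. F (lab t))"
    by (rule decomposes_nested[OF biprod_tens_right[OF b Y]]) (use F M biprodD(2)[OF b] in simp)
  then show ?thesis by (simp add: M sum_unfold_sum_mset image_mset.compositionality comp_def)
qed

text \<open>Distinct labels make the labelling injective, so an index is determined by its label and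
  can be renumbered by the position of the label in \<open>ls\<close>.\<close>

lemma decomposes_list:
  assumes d: "decomposes P X (mset ls)" and dist: "distinct ls"
  obtains \<iota> \<pi> where "biprod X {..<length ls} (\<lambda>k. P (ls ! k)) \<iota> \<pi>"
proof -
  obtain I :: "nat set" and lab \<iota> \<pi> where b: "biprod X I (\<lambda>t. P (lab t)) \<iota> \<pi>" and M: "mset ls = image_mset lab (mset_set I)"
    using d unfolding decomposes_def by blast
  have fin: "finite I" using biprodD(2)[OF b] .
  have im: "lab ` I = set ls" using arg_cong[OF M, of set_mset] fin by simp
  have "card (lab ` I) = card I"
    using arg_cong[OF M, of size] fin distinct_card[OF dist] im by simp
  then have inj: "inj_on lab I" using fin by (rule eq_card_imp_inj_on[rotated])
  define h where "h = inv_into I lab \<circ> (!) ls"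
  have "bij_betw ((!) ls) {..<length ls} (set ls)" by (rule bij_betw_nth[OF dist]) simp_all
  moreover have "bij_betw (inv_into I lab) (set ls) I" using inj im by (metis bij_betw_def bij_betw_inv_into)
  ultimately have "bij_betw h {..<length ls} I" unfolding h_def by (rule bij_betw_trans)
  from biprod_reindex[OF b this] have b': "biprod X {..<length ls} (\<lambda>k. P (lab (h k))) (\<iota> \<circ> h) (\<pi> \<circ> h)" by (simp add: comp_def)
  have "lab (h k) = ls ! k" if "k < length ls" for k
    using that im by (simp add: h_def f_inv_into_f)
  then have "biprod X {..<length ls} (\<lambda>k. P (ls ! k)) (\<iota> \<circ> h) (\<pi> \<circ> h)"
    by (intro biprod_cong[OF b']) simp
  then show ?thesis using that by blast
qed

lemma decomposes_cancel:
  assumes sp: idempotents_split and P: "simple_family P" and nz: "\<And>a. idm C (P a) \<noteq> zero C (P a) (P a)"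
    and d: "decomposes P Y (M + N)" and b: "biprod Y {False, True} (\<lambda>t. if t then A else B) \<iota> \<pi>"
    and B: "decomposes P B N"
  shows "decomposes P A M"
proof -
  obtain I :: "nat set" and lab \<iota>' \<pi>' where bY: "biprod Y I (\<lambda>t. P (lab t)) \<iota>' \<pi>'" and M: "M + N = image_mset lab (mset_set I)"
    using d unfolding decomposes_def by blast
  obtain I2 :: "nat set" and lab2 \<iota>2 \<pi>2 where b2: "biprod B I2 (\<lambda>t. P (lab2 t)) \<iota>2 \<pi>2" and N: "N = image_mset lab2 (mset_set I2)"
    using B unfolding decomposes_def by blast
  have A: "A \<in> Ob C" using biprodD(3)[OF b, of True] by simp
  \<comment> \<open>\<open>B\<close> is replaced by its simple summands, while \<open>A\<close>
    stays whole under the single index \<open>(True, 0)\<close>; this is the shape that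
    \<open>cancel_simples\<close> asks for.\<close>
  let ?L = "\<lambda>t. if t then {0} else I2" and ?A = "\<lambda>(t, k). if t then A else P (lab2 k)"
  let ?K = "Sigma {False, True} ?L"
  have "biprod (if t then A else B) (?L t) (\<lambda>k. if t then A else P (lab2 k))
      (\<lambda>k. if t then idm C A else \<iota>2 k) (\<lambda>k. if t then idm C A else \<pi>2 k)" for t
    using b2 biprod_singleton[OF A] by (cases t) simp_all
  then have bK: "biprod Y ?K ?A (\<lambda>(t, k). \<iota> t \<cdot> (if t then idm C A else \<iota>2 k)) (\<lambda>(t, k). (if t then idm C A else \<pi>2 k) \<cdot> \<pi> t)"
    using biprod_nested[OF b, of ?L "\<lambda>t k. if t then A else P (lab2 k)"
      "\<lambda>t k. if t then idm C A else \<iota>2 k" "\<lambda>t k. if t then idm C A else \<pi>2 k"] by simp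
  have "?K - {(True, 0)} = Pair False ` I2" by auto
  then have K: "image_mset (\<lambda>(t, k). lab2 k) (mset_set (?K - {(True, 0)})) = N"
    by (simp add: N image_mset_mset_set[symmetric] inj_on_def image_mset.compositionality comp_def)
  obtain J \<iota>3 \<pi>3 where J: "biprod A J (\<lambda>t. P (lab t)) \<iota>3 \<pi>3" "image_mset lab (mset_set I) = image_mset lab (mset_set J) + N"
    using cancel_simples[OF sp P nz bK, of "(True, 0)" "\<lambda>(t, k). lab2 k" I lab \<iota>' \<pi>'] bY K by fastforce
  then have "M = image_mset lab (mset_set J)" using M by simp
  then show ?thesis using decomposesI[of A J P lab \<iota>3 \<pi>3] J(1) by simp
qed

text \<open>The numbers from the distance of \<open>i\<close> and \<open>j\<close> up to
  \<open>i + j\<close> in steps of 2, written as triangle inequalities with a parity condition to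
  avoid truncated subtraction.\<close>

definition clebsch_gordan :: "nat \<Rightarrow> nat \<Rightarrow> nat set" where
  "clebsch_gordan i j = {k. i \<le> j + k \<and> j \<le> i + k \<and> k \<le> i + j \<and> even (i + j + k)}"

lemma finite_clebsch_gordan: "finite (clebsch_gordan i j)"
  by (rule finite_subset[of _ "{..i + j}"]) (auto simp: clebsch_gordan_def)

text \<open>The labels of the tensor product of the simple object \<open>k\<close> with the
  generator; for \<open>k = 0\<close> the lower one is missing.\<close>

definition neighbours :: "nat \<Rightarrow> nat multiset" where
  "neighbours k = (if k = 0 then {#1#} else {#k + 1, k - 1#})"

text \<open>Tensoring with the generator raises or lowers each label by one, so on the left
  \<open>x\<close> is counted once if \<open>x - 1\<close> and once if \<open>x + 1\<close> lies in
  the middle set. Together these two conditions match membership of \<open>x\<close> in the two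
  outer sets.\<close>

lemma sum_neighbours:
  "(\<Sum>k\<in>clebsch_gordan i (Suc j). neighbours k) =
    mset_set (clebsch_gordan i (Suc (Suc j))) + mset_set (clebsch_gordan i j)"
proof (rule multiset_eqI)
  fix x
  have c: "count (neighbours k) x = (if x \<noteq> 0 \<and> k = x - 1 then 1 else 0) + (if k = x + 1 then 1 else 0)" for k
    by (auto simp: neighbours_def)
  let ?S = "clebsch_gordan i (Suc j)"
  have "count (\<Sum>k\<in>?S. neighbours k) x =
      (if x \<noteq> 0 \<and> x - 1 \<in> ?S then 1 else 0) + (if x + 1 \<in> ?S then 1 else 0)"
    unfolding count_sum c sum.distrib using finite_clebsch_gordan[of i "Suc j"] by (cases "x = 0") simp_all
  also have "\<dots> = (if x \<in> clebsch_gordan i (Suc (Suc j)) then 1 else 0) + (if x \<in> clebsch_gordan i j then 1 else 0)"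
  proof (cases "even (i + j + x)")
    case True
    then obtain m where m: "i + j + x = 2 * m" by (rule evenE)
    show ?thesis
    proof (cases x)
      case 0
      then show ?thesis using True m unfolding clebsch_gordan_def by (auto; presburger)
    next
      case (Suc y)
      then show ?thesis using True m unfolding clebsch_gordan_def by (auto; presburger)
    qed
  next
    case False then show ?thesis unfolding clebsch_gordan_def by (cases x) auto
  qed
  finally show "count (\<Sum>k\<in>?S. neighbours k) x =
    count (mset_set (clebsch_gordan i (Suc (Suc j))) + mset_set (clebsch_gordan i j)) x"
    by (simp add: finite_clebsch_gordan count_mset_set')
qed

lemma clebsch_gordan_0: "clebsch_gordan i 0 = {i}"
  by (auto simp: clebsch_gordan_def)

lemma clebsch_gordan_1: "mset_set (clebsch_gordan i (Suc 0)) = neighbours i"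
proof -
  have "clebsch_gordan i (Suc 0) = (if i = 0 then {1} else {i + 1, i - 1})"
    by (auto simp: clebsch_gordan_def) presburger+
  then show ?thesis by (simp add: neighbours_def)
qed

text \<open>The object \<open>P i \<odot> P (j + 1) \<odot> P 1\<close> is decomposed in two ways, and the summand
  \<open>P i \<odot> P j\<close> is cancelled.\<close>

theorem fusion:
  assumes sp: idempotents_split and P: "simple_family P" and nz: "\<And>a. idm C (P a) \<noteq> zero C (P a) (P a)"
    and P0: "P 0 = unit C" and P1: "\<And>k. decomposes P (P k \<odot> P 1) (neighbours k)"
  shows "decomposes P (P i \<odot> P j) (mset_set (clebsch_gordan i j))"
proof (induction j rule: induct_nat_012)
  case 0
  have "P i \<in> Ob C" using P by (simp add: simple_family_def)
  then show ?case using decomposes_self[of P i] by (simp add: P0 clebsch_gordan_0)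
next
  case 1
  then show ?case using P1 by (simp add: clebsch_gordan_1)
next
  case (ge2 j)
  have Ob [simp]: "P k \<in> Ob C" for k using P by (simp add: simple_family_def)
  have "decomposes P (P (Suc j) \<odot> P 1) {#Suc (Suc j), j#}" using P1[of "Suc j"] by (simp add: neighbours_def)
  then have "decomposes P (P (Suc j) \<odot> P 1) (mset [Suc (Suc j), j])" by simp
  then obtain \<iota> \<pi> where "biprod (P (Suc j) \<odot> P 1) {..<length [Suc (Suc j), j]} (\<lambda>k. P ([Suc (Suc j), j] ! k)) \<iota> \<pi>"
    by (rule decomposes_list) simp
  note b = this
  \<comment> \<open>\<open>True\<close> is sent to the new label \<open>j + 2\<close> and
    \<open>False\<close> to the label \<open>j\<close> of the part to be cancelled, as
    \<open>decomposes_cancel\<close> expects.\<close>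
  let ?h = "\<lambda>t. if t then 0 else 1 :: nat"
  have "bij_betw ?h {False, True} {..<length [Suc (Suc j), j]}" by (auto simp: bij_betw_def inj_on_def)
  from biprod_tens_left[OF biprod_reindex[OF b this] Ob[of i]]
  have "biprod (P i \<odot> (P (Suc j) \<odot> P 1)) {False, True} (\<lambda>t. if t then P i \<odot> P (Suc (Suc j)) else P i \<odot> P j)
      (\<lambda>k. idm C (P i) \<otimes> (\<iota> \<circ> ?h) k) (\<lambda>k. idm C (P i) \<otimes> (\<pi> \<circ> ?h) k)"
    by (rule biprod_cong) auto
  then have b: "\<exists>\<iota> \<pi>. biprod (P i \<odot> (P (Suc j) \<odot> P 1)) {False, True} (\<lambda>t. if t then P i \<odot> P (Suc (Suc j)) else P i \<odot> P j) \<iota> \<pi>"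
    by blast
  have "decomposes P ((P i \<odot> P (Suc j)) \<odot> P 1) (\<Sum>k\<in>#mset_set (clebsch_gordan i (Suc j)). neighbours k)"
    by (rule decomposes_tensO) (use ge2 P1 in simp_all)
  then have "decomposes P (P i \<odot> (P (Suc j) \<odot> P 1))
      (mset_set (clebsch_gordan i (Suc (Suc j))) + mset_set (clebsch_gordan i j))"
    using sum_neighbours[of i j] by (simp add: sum_unfold_sum_mset)
  then show ?case using decomposes_cancel[OF sp P nz] b ge2 by blast
qed

text \<open>The idempotent \<open>s \<cdot> r\<close> is nonzero, so one of its matrix entries
  between simple summands is nonzero and hence a scalar times an identity. Rescaling makes
  \<open>P k\<close> a retract of \<open>T\<close>, and indecomposability leaves no room for a
  complement.\<close>

lemma indecomposable_retract:
  assumes sp: idempotents_split and P: "simple_family P" and T: "indecomposable C T"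
    and s: "arr s" "dom s = T" "cod s = X" and r: "arr r" "dom r = X" "cod r = T" and rs: "r \<cdot> s = idm C T"
    and d: "decomposes P X M"
  obtains k where "k \<in># M" "isomorphic C T (P k)" "idm C (P k) \<noteq> zero C (P k) (P k)"
proof -
  obtain I :: "nat set" and lab \<iota> \<pi> where b: "biprod X I (\<lambda>t. P (lab t)) \<iota> \<pi>" and M: "M = image_mset lab (mset_set I)"
    using d unfolding decomposes_def by blast
  have T_Ob [simp]: "T \<in> Ob C" and Tnz: "idm C T \<noteq> zero C T T"
    using T by (auto simp: indecomposable_def is_zero_ob_def)
  have P_Ob [simp]: "P k \<in> Ob C" for k using P by (simp add: simple_family_def)
  note [simp] = biprodD(1-9)[OF b] s r
  have "\<exists>a\<in>I. \<exists>c\<in>I. \<pi> a \<cdot> ((s \<cdot> r) \<cdot> \<iota> c) \<noteq> zero C (P (lab c)) (P (lab a))"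
  proof (rule ccontr)
    assume "\<not> ?thesis"
    then have z: "a \<in> I \<Longrightarrow> c \<in> I \<Longrightarrow> \<pi> a \<cdot> ((s \<cdot> r) \<cdot> \<iota> c) = zero C (P (lab c)) (P (lab a))" for a c by blast
    have "(s \<cdot> r) \<cdot> \<iota> c = zero C (P (lab c)) X" if "c \<in> I" for c
      using biprod_monic[OF b, of "(s \<cdot> r) \<cdot> \<iota> c"] z that by simp
    then have "s \<cdot> r = zero C X X" using biprod_epic[OF b, of "s \<cdot> r"] by simp
    then have "r \<cdot> ((s \<cdot> r) \<cdot> s) = zero C T T" by simp
    moreover have "r \<cdot> ((s \<cdot> r) \<cdot> s) = (r \<cdot> s) \<cdot> (r \<cdot> s)" by (simp add: assoc_cmp)
    ultimately show False using rs Tnz by simp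
  qed
  then obtain a c where ac: "a \<in> I" "c \<in> I" "\<pi> a \<cdot> ((s \<cdot> r) \<cdot> \<iota> c) \<noteq> zero C (P (lab c)) (P (lab a))" by blast
  note [simp] = ac(1,2)
  obtain x where x: "lab c = lab a" "x \<noteq> 0" "\<pi> a \<cdot> ((s \<cdot> r) \<cdot> \<iota> c) = scale C x (idm C (P (lab c)))"
    using simple_familyD[OF P _ _ _ ac(3)] by auto
  define k where "k = lab c"
  have k: "k \<in># M" using M biprodD(2)[OF b] by (simp add: k_def)
  define u v where "u = r \<cdot> \<iota> c" and "v = scale C (inverse x) (\<pi> a \<cdot> s)"
  have uv [simp]: "arr u" "dom u = P k" "cod u = T" "arr v" "dom v = T" "cod v = P k"
    using x(1) by (simp_all add: u_def v_def k_def)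
  have vu: "v \<cdot> u = idm C (P k)"
    using x by (simp add: u_def v_def k_def scale_simps assoc_cmp)
  have nz: "idm C (P k) \<noteq> zero C (P k) (P k)"
    using ac(3) x by (auto simp: k_def)
  obtain Y i p where Y: "is_direct_sum C T [P k, Y]" "arr i" "arr p" "dom i = Y" "cod p = Y" "cod i = T" "dom p = T"
    "i \<cdot> p = sub (idm C T) (u \<cdot> v)"
    using retract_direct_sum[OF sp uv(1-3) uv(4-6) vu] by blast
  then have "is_zero_ob C Y" using T nz by (auto simp: indecomposable_def is_zero_ob_def)
  then have "idm C Y = zero C Y Y" by (simp add: is_zero_ob_def)
  moreover have "i \<cdot> (idm C Y \<cdot> p) = i \<cdot> p" using Y by simp
  moreover have "Y \<in> Ob C" using Y ob_simps(1) by blast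
  ultimately have "i \<cdot> p = zero C T T" using Y by simp
  then have "u \<cdot> v = idm C T" using sub_eq_zero[of "idm C T" "u \<cdot> v"] Y by simp
  then have "inverse_pair C T (P k) v u" using vu by (simp add: inverse_pair_iff)
  then have "isomorphic C T (P k)" by (auto simp: isomorphic_def is_iso_def)
  then show ?thesis using that k nz by blast
qed

end

section \<open>Jones--Wenzl idempotents\<close>

text \<open>What the diagram calculus needs from the presentation: the tensor powers
  \<open>x n\<close> of the generator, the relations, and generation by cup and cap in the form of
  \<open>hom_induct\<close>. The predicate there takes the numbers \<open>m\<close> and
  \<open>n\<close> besides the morphism, since \<open>x\<close> is not assumed injective.\<close>

locale temperley_lieb = strict_lin_monoidal_dc +
  fixes x :: "nat \<Rightarrow> 'a" and cup cap :: 'b and loop :: 'c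
  assumes x_Ob [simp]: "x n \<in> Ob C" and x_0: "x 0 = unit C" and x_add [simp]: "x m \<odot> x n = x (m + n)"
    and cup_simps [simp]: "arr cup" "dom cup = x 0" "cod cup = x 2"
    and cap_simps [simp]: "arr cap" "dom cap = x 2" "cod cap = x 0"
    and zigzag_left: "(cap \<otimes> idm C (x 1)) \<cdot> (idm C (x 1) \<otimes> cup) = idm C (x 1)"
    and zigzag_right: "(idm C (x 1) \<otimes> cap) \<cdot> (cup \<otimes> idm C (x 1)) = idm C (x 1)"
    and circle: "cap \<cdot> cup = scale C loop (idm C (x 0))"
    and hom_induct: "\<And>P f m n. \<lbrakk>arr f; dom f = x m; cod f = x n;
      \<And>n. P n n (idm C (x n)); P 0 2 cup; P 2 0 cap; \<And>m n. P m n (zero C (x m) (x n));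
      \<And>f g l m n. \<lbrakk>arr f; dom f = x l; cod f = x m; arr g; dom g = x m; cod g = x n; P l m f; P m n g\<rbrakk> \<Longrightarrow> P l n (g \<cdot> f);
      \<And>f g m n m' n'. \<lbrakk>arr f; dom f = x m; cod f = x n; arr g; dom g = x m'; cod g = x n'; P m n f; P m' n' g\<rbrakk>
        \<Longrightarrow> P (m + m') (n + n') (f \<otimes> g);
      \<And>f g m n. \<lbrakk>arr f; dom f = x m; cod f = x n; arr g; dom g = x m; cod g = x n; P m n f; P m n g\<rbrakk> \<Longrightarrow> P m n (add C f g);
      \<And>c f m n. \<lbrakk>arr f; dom f = x m; cod f = x n; P m n f\<rbrakk> \<Longrightarrow> P m n (scale C c f)\<rbrakk> \<Longrightarrow> P m n f"
begin

abbreviation ix where "ix n \<equiv> idm C (x n)"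

text \<open>The unit is always rewritten to \<open>x 0\<close>, so that tensor products with it fall
  under \<open>x_add\<close>.\<close>

lemma unit_eq [simp]: "unit C = x 0" by (simp add: x_0)

lemma ix_0 [simp]: "arr f \<Longrightarrow> ix 0 \<otimes> f = f" "arr f \<Longrightarrow> f \<otimes> ix 0 = f"
  using id_simps(4,5)[of f] by simp_all

definition wh :: "nat \<Rightarrow> 'b \<Rightarrow> nat \<Rightarrow> 'b" where "wh a f b = ix a \<otimes> (f \<otimes> ix b)"

lemma wh_simps [simp]:
  "arr f \<Longrightarrow> arr (wh a f b)"
  "dom f = x m \<Longrightarrow> dom (wh a f b) = x (a + (m + b))"
  "cod f = x n \<Longrightarrow> cod (wh a f b) = x (a + (n + b))"
  by (simp_all add: wh_def)

lemma wh_cmp: "arr f \<Longrightarrow> arr g \<Longrightarrow> dom g = cod f \<Longrightarrow> wh a g b \<cdot> wh a f b = wh a (g \<cdot> f) b"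
  by (simp add: wh_def cmp_tensM)

lemma wh_ix: "wh a (ix n) b = ix (a + (n + b))"
  by (simp add: wh_def)

lemma wh_wh: "arr f \<Longrightarrow> wh a (wh a' f b') b = wh (a + a') f (b' + b)"
  by (simp add: wh_def assoc_tens whisker_merge)

lemma wh_linear:
  "arr f \<Longrightarrow> wh a (scale C c f) b = scale C c (wh a f b)"
  "arr f \<Longrightarrow> arr g \<Longrightarrow> dom f = dom g \<Longrightarrow> cod f = cod g \<Longrightarrow> wh a (add C f g) b = add C (wh a f b) (wh a g b)"
  "wh a (zero C (x m) (x n)) b = zero C (x (a + (m + b))) (x (a + (n + b)))"
  by (simp_all add: wh_def scale_simps distrib_simps)

text \<open>Far commutativity: \<open>c\<close> strands separate \<open>f\<close> from
  \<open>g\<close>, so the order in which they act is irrelevant.\<close>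

lemma wh_exchange:
  assumes "arr f" "dom f = x m" "cod f = x n" "arr g" "dom g = x m'" "cod g = x n'"
  shows "wh a f (c + (n' + b)) \<cdot> wh (a + (m + c)) g b = wh (a + (n + c)) g b \<cdot> wh a f (c + (m' + b))"
proof -
  note [simp] = assms
  have e: "wh a f (c + (k + b)) = ix a \<otimes> (f \<otimes> ix (c + (k + b)))" for k by (simp add: wh_def)
  have g: "wh (a + (k + c)) g b = ix a \<otimes> (ix k \<otimes> wh c g b)" for k
    by (simp add: wh_def whisker_merge add.assoc)
  show ?thesis unfolding e g by (simp add: cmp_tensM)
qed

lemma zigzag_wh:
  "wh a cap (1 + b) \<cdot> wh (a + 1) cup b = ix (a + (1 + b))"
  "wh (a + 1) cap b \<cdot> wh a cup (1 + b) = ix (a + (1 + b))"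
proof -
  have 1: "wh a cap (1 + b) = wh a (cap \<otimes> ix 1) b" "wh (a + 1) cup b = wh a (ix 1 \<otimes> cup) b"
    "wh (a + 1) cap b = wh a (ix 1 \<otimes> cap) b" "wh a cup (1 + b) = wh a (cup \<otimes> ix 1) b"
    by (simp_all add: wh_def assoc_tens whisker_merge)
  show "wh a cap (1 + b) \<cdot> wh (a + 1) cup b = ix (a + (1 + b))"
    unfolding 1 by (subst wh_cmp) (simp_all add: zigzag_left[simplified] wh_ix numeral_2_eq_2 numeral_3_eq_3)
  show "wh (a + 1) cap b \<cdot> wh a cup (1 + b) = ix (a + (1 + b))"
    unfolding 1 by (subst wh_cmp) (simp_all add: zigzag_right[simplified] wh_ix numeral_2_eq_2 numeral_3_eq_3)
qed

lemma circle_wh: "wh a cap b \<cdot> wh a cup b = scale C loop (ix (a + b))"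
  by (simp add: wh_cmp circle wh_linear wh_ix)

text \<open>Every morphism is a combination of composites in which all caps precede all cups.\<close>

inductive nf :: "nat \<Rightarrow> nat \<Rightarrow> 'b \<Rightarrow> bool" where
  nf_ix: "nf n n (ix n)"
| nf_zero: "nf m n (zero C (x m) (x n))"
| nf_add: "nf m n f \<Longrightarrow> nf m n g \<Longrightarrow> nf m n (add C f g)"
| nf_scale: "nf m n f \<Longrightarrow> nf m n (scale C c f)"
| nf_cup: "nf m (a + b) f \<Longrightarrow> nf m (a + (2 + b)) (wh a cup b \<cdot> f)"
| nf_cap: "nf (a + b) n f \<Longrightarrow> nf (a + (2 + b)) n (f \<cdot> wh a cap b)"

lemma nf_typing: "nf m n f \<Longrightarrow> arr f \<and> dom f = x m \<and> cod f = x n"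
  by (induction rule: nf.induct) simp_all

text \<open>The cap is pushed past the cups applied last. Against a cup in the same place it gives a
  circle, against one shifted by a single strand a zigzag; otherwise the two commute and the cap
  meets a shorter normal form.\<close>

lemma nf_cap_left: "nf m k f \<Longrightarrow> k = a + (2 + b) \<Longrightarrow> nf m (a + b) (wh a cap b \<cdot> f)"
proof (induction arbitrary: a b rule: nf.induct)
  case (nf_ix n)
  then show ?case using nf_cap[OF nf.nf_ix, of a b] by simp
next
  case (nf_zero m n)
  then show ?case using nf.nf_zero by simp
next
  case (nf_add m n f g)
  then show ?case using nf_typing[OF nf_add(1)] nf_typing[OF nf_add(2)] by (simp add: distrib_simps nf.nf_add)
next
  case (nf_scale m n f c)
  then show ?case using nf_typing[OF nf_scale(1)] by (simp add: scale_simps nf.nf_scale)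
next
  case (nf_cap a' b' n f)
  have "wh a cap b \<cdot> (f \<cdot> wh a' cap b') = (wh a cap b \<cdot> f) \<cdot> wh a' cap b'"
    using nf_typing[OF nf_cap(1)] nf_cap(3) by (simp add: assoc_cmp)
  then show ?case using nf.nf_cap[OF nf_cap.IH[OF nf_cap(3)]] by simp
next
  case (nf_cup m a' b' f)
  have f [simp]: "arr f" "dom f = x m" "cod f = x (a' + b')" using nf_typing[OF nf_cup(1)] by auto
  have eq: "wh a cap b \<cdot> (wh a' cup b' \<cdot> f) = (wh a cap b \<cdot> wh a' cup b') \<cdot> f"
    using nf_cup.prems by (simp add: assoc_cmp)
  \<comment> \<open>\<open>a\<close> and \<open>a'\<close> count the strands to the left of the cap
    and of the cup.\<close>
  consider "a' = a" | "a' = a + 1" | "a = a' + 1" | "a + 2 \<le> a'" | "a' + 2 \<le> a" by linarith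
  then show ?case
  proof cases
    case 1
    then have "b' = b" using nf_cup.prems by simp
    then show ?thesis unfolding eq using 1 nf_cup(1) by (simp add: circle_wh scale_simps nf_scale)
  next
    case 2
    then have b: "b = 1 + b'" using nf_cup.prems by simp
    show ?thesis unfolding eq unfolding 2 b zigzag_wh using nf_cup(1) 2 by (simp add: add.assoc)
  next
    case 3
    then have b: "b' = 1 + b" using nf_cup.prems by simp
    show ?thesis unfolding eq unfolding 3 b zigzag_wh using nf_cup(1) 3 b by (simp add: add.assoc)
  next
    case 4
    then obtain c where a': "a' = a + (2 + c)" by (metis add.assoc le_Suc_ex)
    then have b: "b = c + (2 + b')" using nf_cup.prems by simp
    have "wh a cap b \<cdot> wh a' cup b' = wh (a + (0 + c)) cup b' \<cdot> wh a cap (c + (0 + b'))"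
      unfolding a' b by (rule wh_exchange) simp_all
    moreover have "nf m (a + (c + b')) (wh a cap (c + b') \<cdot> f)"
      by (rule nf_cup.IH) (simp add: a')
    then have "nf m ((a + c) + (2 + b')) (wh (a + c) cup b' \<cdot> (wh a cap (c + b') \<cdot> f))"
      by (intro nf.nf_cup) (simp add: add.assoc)
    ultimately show ?thesis unfolding eq using a' b by (simp add: assoc_cmp add.assoc)
  next
    case 5
    then obtain c where a: "a = a' + (2 + c)" by (metis add.assoc le_Suc_ex)
    then have b': "b' = c + (2 + b)" using nf_cup.prems by simp
    have "wh a cap b \<cdot> wh a' cup b' = wh a' cup (c + (0 + b)) \<cdot> wh (a' + (0 + c)) cap b"
      unfolding a b' by (rule wh_exchange[symmetric]) simp_all
    moreover have "nf m ((a' + c) + b) (wh (a' + c) cap b \<cdot> f)"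
      by (rule nf_cup.IH) (simp add: b')
    then have "nf m (a' + (2 + (c + b))) (wh a' cup (c + b) \<cdot> (wh (a' + c) cap b \<cdot> f))"
      by (intro nf.nf_cup) (simp add: add.assoc)
    ultimately show ?thesis unfolding eq using a b' by (simp add: assoc_cmp ac_simps)
  qed
qed

text \<open>Normal forms are not visibly closed under tensor products. The inductive property is
  \<open>Q\<close>: composing with \<open>f\<close>, padded by strands on both sides, takes normal
  forms to normal forms. The padding takes care of tensor products, the arbitrary normal form below
  of composites.\<close>

lemma nf_all: assumes f: "arr f" "dom f = x m" "cod f = x n" shows "nf m n f"
proof -
  define Q where "Q m n f \<longleftrightarrow> (\<forall>a b k g. nf k (a + (m + b)) g \<longrightarrow> nf k (a + (n + b)) (wh a f b \<cdot> g))" for m n f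
  have QI: "(\<And>a b k g. nf k (a + (m + b)) g \<Longrightarrow> nf k (a + (n + b)) (wh a f b \<cdot> g)) \<Longrightarrow> Q m n f" for m n f
    by (auto simp: Q_def)
  have QD: "Q m n f \<Longrightarrow> nf k (a + (m + b)) g \<Longrightarrow> nf k (a + (n + b)) (wh a f b \<cdot> g)" for m n f a b k g
    by (auto simp: Q_def)
  have "Q m n f" using f
  proof (rule hom_induct[where P = Q])
    fix n show "Q n n (ix n)"
    proof (rule QI)
      fix a b k g assume g: "nf k (a + (n + b)) g"
      then show "nf k (a + (n + b)) (wh a (ix n) b \<cdot> g)" using nf_typing[OF g] by (simp add: wh_ix)
    qed
  next
    show "Q 0 2 cup" by (rule QI) (use nf_cup in simp)
  next
    show "Q 2 0 cap" by (rule QI) (use nf_cap_left in simp)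
  next
    fix m n show "Q m n (zero C (x m) (x n))"
    proof (rule QI)
      fix a b k g assume g: "nf k (a + (m + b)) g"
      then show "nf k (a + (n + b)) (wh a (zero C (x m) (x n)) b \<cdot> g)"
        using nf_typing[OF g] nf_zero by (simp add: wh_linear)
    qed
  next
    fix f g l m n assume fg: "arr f" "dom f = x l" "cod f = x m" "arr g" "dom g = x m" "cod g = x n" "Q l m f" "Q m n g"
    show "Q l n (g \<cdot> f)"
    proof (rule QI)
      fix a b k h assume h: "nf k (a + (l + b)) h"
      have "wh a (g \<cdot> f) b \<cdot> h = wh a g b \<cdot> (wh a f b \<cdot> h)"
        using nf_typing[OF h] fg by (simp add: wh_cmp[symmetric] assoc_cmp)
      then show "nf k (a + (n + b)) (wh a (g \<cdot> f) b \<cdot> h)" using QD[OF fg(8) QD[OF fg(7) h]] by simp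
    qed
  next
    fix f g m n m' n' assume fg: "arr f" "dom f = x m" "cod f = x n" "arr g" "dom g = x m'" "cod g = x n'" "Q m n f" "Q m' n' g"
    show "Q (m + m') (n + n') (f \<otimes> g)"
    proof (rule QI)
      fix a b k h assume h: "nf k (a + (m + m' + b)) h"
      \<comment> \<open>The tensor product as two layers, so that the hypotheses on \<open>g\<close>
        and on \<open>f\<close> apply one after the other.\<close>
      have "wh a (f \<otimes> g) b = wh a f (n' + b) \<cdot> wh (a + m) g b"
      proof -
        have "wh a f (n' + b) = wh a (f \<otimes> ix n') b" "wh (a + m) g b = wh a (ix m \<otimes> g) b"
          using fg by (simp_all add: wh_def assoc_tens whisker_merge)
        then show ?thesis using fg by (simp add: wh_cmp cmp_tensM)
      qed
      then have "wh a (f \<otimes> g) b \<cdot> h = wh a f (n' + b) \<cdot> (wh (a + m) g b \<cdot> h)"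
        using nf_typing[OF h] fg(1-6) by (simp add: assoc_cmp add.assoc)
      moreover have "nf k ((a + m) + (n' + b)) (wh (a + m) g b \<cdot> h)"
        by (rule QD[OF fg(8)]) (use h in \<open>simp add: add.assoc\<close>)
      then have "nf k (a + (n + (n' + b))) (wh a f (n' + b) \<cdot> (wh (a + m) g b \<cdot> h))"
        by (intro QD[OF fg(7)]) (simp add: add.assoc)
      ultimately show "nf k (a + (n + n' + b)) (wh a (f \<otimes> g) b \<cdot> h)" by (simp add: add.assoc)
    qed
  next
    fix f g m n assume fg: "arr f" "dom f = x m" "cod f = x n" "arr g" "dom g = x m" "cod g = x n" "Q m n f" "Q m n g"
    show "Q m n (add C f g)"
    proof (rule QI)
      fix a b k h assume h: "nf k (a + (m + b)) h"
      have "wh a (add C f g) b \<cdot> h = add C (wh a f b \<cdot> h) (wh a g b \<cdot> h)"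
        using nf_typing[OF h] fg(1-6) by (simp add: wh_linear distrib_simps)
      then show "nf k (a + (n + b)) (wh a (add C f g) b \<cdot> h)"
        using nf_add[OF QD[OF fg(7) h] QD[OF fg(8) h]] by simp
    qed
  next
    fix c f m n assume fg: "arr f" "dom f = x m" "cod f = x n" "Q m n f"
    show "Q m n (scale C c f)"
    proof (rule QI)
      fix a b k h assume h: "nf k (a + (m + b)) h"
      have "wh a (scale C c f) b \<cdot> h = scale C c (wh a f b \<cdot> h)"
        using nf_typing[OF h] fg(1-3) by (simp add: wh_linear scale_simps)
      then show "nf k (a + (n + b)) (wh a (scale C c f) b \<cdot> h)"
        using nf_scale[OF QD[OF fg(4) h]] by simp
    qed
  qed
  \<comment> \<open>Without padding and applied to an identity, \<open>Q\<close> is the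
    claim.\<close>
  from QD[OF this, of m 0 0 "ix m"] show ?thesis using f nf_ix[of m] by (simp add: wh_def)
qed

section \<open>Partial traces and Wenzl's recursion\<close>

primrec trace :: "nat \<Rightarrow> 'c" where
  "trace 0 = 0"
| "trace (Suc n) = loop - inverse (trace n)"

text \<open>The Jones--Wenzl idempotents, by Wenzl's recursion; \<open>trace (Suc n)\<close> is the factor by which closing
  the last strand of \<open>jw (Suc n)\<close> multiplies \<open>jw n\<close>. The junk value \<open>inverse 0 = 0\<close> gives \<open>trace 1 = loop\<close>.\<close>

fun jw :: "nat \<Rightarrow> 'b" where
  "jw 0 = ix 0"
| "jw (Suc 0) = ix 1"
| "jw (Suc (Suc n)) = sub (wh 0 (jw (Suc n)) 1) (scale C (inverse (trace (Suc n)))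
     ((wh 0 (jw (Suc n)) 1 \<cdot> wh n cup 0) \<cdot> (wh n cap 0 \<cdot> wh 0 (jw (Suc n)) 1)))"

lemma jw_typing [simp]: "arr (jw n)" "dom (jw n) = x n" "cod (jw n) = x n"
proof -
  have "arr (jw n) \<and> dom (jw n) = x n \<and> cod (jw n) = x n"
  proof (induction n rule: jw.induct)
    case (3 n) then show ?case by (simp add: numeral_2_eq_2)
  qed simp_all
  then show "arr (jw n)" "dom (jw n) = x n" "cod (jw n) = x n" by auto
qed

declare jw.simps(3) [simp del]

lemma sub_scale: "arr f \<Longrightarrow> sub (scale C c f) (scale C e f) = scale C (c - e) f"
  using scale_add[of f c "- e"] by (simp add: sub_def scale_simps)

text \<open>One step of the recursion, for three consecutive idempotents \<open>p\<close>,
  \<open>P\<close>, \<open>p'\<close>. The assumptions, that \<open>P\<close> is idempotent, absorbs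
  \<open>p\<close> and has partial trace \<open>t\<close> times \<open>p\<close>, are reproduced one
  level up as long as \<open>t\<close> is nonzero. The other conclusions, on caps and cups and on
  the two parts of \<open>Q\<close>, feed \<open>jw_cap\<close>, \<open>jw_cup\<close> and
  \<open>J_tens_1\<close>.\<close>

lemma jw_step:
  fixes n
  defines "p \<equiv> jw n" and "P \<equiv> jw (Suc n)" and "t \<equiv> trace (Suc n)"
  defines "Q \<equiv> wh 0 P 1" and "p' \<equiv> jw (Suc (Suc n))"
  assumes idem: "P \<cdot> P = P" and absorb: "P \<cdot> wh 0 p 1 = P" "wh 0 p 1 \<cdot> P = P"
    and tr: "wh n cap 0 \<cdot> (wh 0 P 1 \<cdot> wh n cup 0) = scale C t p" and t: "t \<noteq> 0"
  shows "p' \<cdot> p' = p'" "p' \<cdot> Q = p'" "Q \<cdot> p' = p'" "wh n cap 0 \<cdot> p' = zero C (x (n + 2)) (x n)"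
    "p' \<cdot> wh n cup 0 = zero C (x n) (x (n + 2))"
    "wh (Suc n) cap 0 \<cdot> (wh 0 p' 1 \<cdot> wh (Suc n) cup 0) = scale C (trace (Suc (Suc n))) P"
    "wh n cap 0 \<cdot> Q = p \<cdot> (wh n cap 0 \<cdot> Q)" "Q \<cdot> wh n cup 0 = (Q \<cdot> wh n cup 0) \<cdot> p" "Q \<cdot> Q = Q"
    "p' = sub Q (scale C (inverse t) ((Q \<cdot> wh n cup 0) \<cdot> (wh n cap 0 \<cdot> Q)))"
proof -
  have [simp]: "arr p" "dom p = x n" "cod p = x n" "arr P" "dom P = x (Suc n)" "cod P = x (Suc n)"
    "arr p'" "dom p' = x (Suc (Suc n))" "cod p' = x (Suc (Suc n))"
    by (simp_all only: p_def P_def p'_def jw_typing)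
  have Q [simp]: "arr Q" "dom Q = x (Suc (Suc n))" "cod Q = x (Suc (Suc n))" by (simp_all add: Q_def)
  define u w where "u = wh n cap 0" and "w = wh n cup 0"
  have uw [simp]: "arr u" "dom u = x (Suc (Suc n))" "cod u = x n" "arr w" "dom w = x n" "cod w = x (Suc (Suc n))"
    by (simp_all add: u_def w_def numeral_2_eq_2)
  \<comment> \<open>\<open>\<beta> \<cdot> \<alpha>\<close> will turn out to be \<open>t\<close>
    times \<open>p\<close>, so \<open>\<alpha> \<cdot> \<beta>\<close> divided by \<open>t\<close>
    is the idempotent that the recursion removes from \<open>Q\<close>.\<close>
  define \<alpha> \<beta> where "\<alpha> = Q \<cdot> w" and "\<beta> = u \<cdot> Q"
  have ab [simp]: "arr \<alpha>" "dom \<alpha> = x n" "cod \<alpha> = x (Suc (Suc n))" "arr \<beta>" "dom \<beta> = x (Suc (Suc n))" "cod \<beta> = x n"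
    by (simp_all add: \<alpha>_def \<beta>_def)
  show p': "p' = sub Q (scale C (inverse t) ((Q \<cdot> wh n cup 0) \<cdot> (wh n cap 0 \<cdot> Q)))"
    by (simp add: p'_def Q_def P_def t_def jw.simps(3))
  then have p'_eq: "p' = sub Q (scale C (inverse t) (\<alpha> \<cdot> \<beta>))" by (simp add: \<alpha>_def \<beta>_def u_def w_def)
  show QQ: "Q \<cdot> Q = Q" unfolding Q_def by (simp add: wh_cmp idem)
  have whpp: "wh 0 p 2 = wh 0 (wh 0 p 1) 1" by (simp add: wh_wh numeral_2_eq_2)
  have pw: "wh 0 p 0 = p" by (simp add: wh_def)
  \<comment> \<open>\<open>p\<close> acts on the first \<open>n\<close> strands and the cap on the
    next two, so they commute; \<open>Q\<close> then absorbs \<open>p\<close>.\<close>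
  have "p \<cdot> u = u \<cdot> wh 0 p 2"
    using wh_exchange[of p n n cap 2 0 0 0 0] by (simp add: u_def pw numeral_2_eq_2)
  then have "p \<cdot> \<beta> = u \<cdot> (wh 0 p 2 \<cdot> Q)" by (simp add: \<beta>_def assoc_cmp[symmetric])
  also have "wh 0 p 2 \<cdot> Q = Q" unfolding whpp Q_def by (subst wh_cmp) (simp_all add: absorb[simplified])
  finally have p\<beta>: "p \<cdot> \<beta> = \<beta>" by (simp add: \<beta>_def)
  have "w \<cdot> p = wh 0 p 2 \<cdot> w"
    using wh_exchange[of p n n cup 0 2 0 0 0] by (simp add: w_def pw numeral_2_eq_2)
  then have "\<alpha> \<cdot> p = (Q \<cdot> wh 0 p 2) \<cdot> w" by (simp add: \<alpha>_def assoc_cmp)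
  also have "Q \<cdot> wh 0 p 2 = Q" unfolding whpp Q_def by (subst wh_cmp) (simp_all add: absorb[simplified])
  finally have \<alpha>p: "\<alpha> \<cdot> p = \<alpha>" by (simp add: \<alpha>_def)
  show "wh n cap 0 \<cdot> Q = p \<cdot> (wh n cap 0 \<cdot> Q)" using p\<beta> by (simp add: \<beta>_def u_def)
  show "Q \<cdot> wh n cup 0 = (Q \<cdot> wh n cup 0) \<cdot> p" using \<alpha>p by (simp add: \<alpha>_def w_def)
  have Q\<alpha>: "Q \<cdot> \<alpha> = \<alpha>" using assoc_cmp[of w Q Q] QQ by (simp add: \<alpha>_def)
  have \<beta>Q: "\<beta> \<cdot> Q = \<beta>" using QQ by (simp add: \<beta>_def assoc_cmp)
  have "\<beta> \<cdot> \<alpha> = u \<cdot> ((Q \<cdot> Q) \<cdot> w)" by (simp add: \<alpha>_def \<beta>_def assoc_cmp)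
  then have \<beta>\<alpha>: "\<beta> \<cdot> \<alpha> = scale C t p" using tr by (simp only: QQ) (simp add: u_def w_def Q_def)
  have \<alpha>\<beta>\<alpha>: "(\<alpha> \<cdot> \<beta>) \<cdot> \<alpha> = scale C t \<alpha>" using assoc_cmp[of \<alpha> \<beta> \<alpha>] by (simp add: \<beta>\<alpha> scale_simps \<alpha>p)
  have \<beta>\<alpha>\<beta>: "\<beta> \<cdot> (\<alpha> \<cdot> \<beta>) = scale C t \<beta>" using assoc_cmp[of \<beta> \<alpha> \<beta>] by (simp add: \<beta>\<alpha> scale_simps p\<beta>)
  show p'Q: "p' \<cdot> Q = p'" unfolding p'_eq by (simp add: sub_cmp scale_simps QQ assoc_cmp \<beta>Q)
  show Qp': "Q \<cdot> p' = p'" unfolding p'_eq by (simp add: sub_cmp scale_simps QQ assoc_cmp[symmetric] Q\<alpha>)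
  have \<beta>p': "\<beta> \<cdot> p' = zero C (x (Suc (Suc n))) (x n)" unfolding p'_eq using t by (simp add: sub_cmp scale_simps \<beta>Q \<beta>\<alpha>\<beta>)
  have p'\<alpha>: "p' \<cdot> \<alpha> = zero C (x n) (x (Suc (Suc n)))" unfolding p'_eq using t by (simp add: sub_cmp scale_simps Q\<alpha> \<alpha>\<beta>\<alpha>)
  have "u \<cdot> p' = u \<cdot> (Q \<cdot> p')" by (simp add: Qp')
  then have up': "u \<cdot> p' = zero C (x (Suc (Suc n))) (x n)" using \<beta>p' by (simp add: \<beta>_def assoc_cmp)
  then show "wh n cap 0 \<cdot> p' = zero C (x (n + 2)) (x n)" by (simp add: u_def)
  have "p' \<cdot> w = (p' \<cdot> Q) \<cdot> w" by (simp add: p'Q)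
  also have "\<dots> = p' \<cdot> \<alpha>" by (subst assoc_cmp) (simp_all add: \<alpha>_def)
  finally show "p' \<cdot> wh n cup 0 = zero C (x n) (x (n + 2))" using p'\<alpha> by (simp add: w_def)
  have "p' \<cdot> p' = sub (Q \<cdot> p') (scale C (inverse t) (\<alpha> \<cdot> (\<beta> \<cdot> p')))"
    by (subst (1) p'_eq) (simp add: sub_cmp scale_simps assoc_cmp)
  then show "p' \<cdot> p' = p'" by (simp add: Qp' \<beta>p')
  \<comment> \<open>Closing the last strand of \<open>p'\<close>: in the term \<open>Q\<close> it
    becomes a free circle and contributes \<open>loop\<close>; in the correction term cup and cap
    are straightened by zigzags and leave \<open>P\<close> times the inverse of
    \<open>t\<close>.\<close>
  define u' w' where "u' = wh (Suc n) cap 0" and "w' = wh (Suc n) cup 0"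
  have uw' [simp]: "arr u'" "dom u' = x (Suc (Suc (Suc n)))" "cod u' = x (Suc n)"
      "arr w'" "dom w' = x (Suc n)" "cod w' = x (Suc (Suc (Suc n)))"
    by (simp_all add: u'_def w'_def numeral_2_eq_2)
  define R where "R = wh 0 P 2"
  have R [simp]: "arr R" "dom R = x (Suc (Suc (Suc n)))" "cod R = x (Suc (Suc (Suc n)))" by (simp_all add: R_def)
  have RQ: "wh 0 Q 1 = R" by (simp add: Q_def R_def wh_wh numeral_2_eq_2)
  have Pw: "wh 0 P 0 = P" by (simp add: wh_def)
  have uR: "u' \<cdot> R = P \<cdot> u'" using wh_exchange[of P "Suc n" "Suc n" cap 2 0 0 0 0] by (simp add: u'_def R_def Pw numeral_2_eq_2)
  have Rw: "R \<cdot> w' = w' \<cdot> P" using wh_exchange[of P "Suc n" "Suc n" cup 0 2 0 0 0] by (simp add: w'_def R_def Pw numeral_2_eq_2)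
  define c1 k1 where "c1 = wh n cup 1" and "k1 = wh n cap 1"
  have c1 [simp]: "arr c1" "dom c1 = x (Suc n)" "cod c1 = x (Suc (Suc (Suc n)))"
     "arr k1" "dom k1 = x (Suc (Suc (Suc n)))" "cod k1 = x (Suc n)"
    by (simp_all add: c1_def k1_def numeral_2_eq_2)
  have z: "u' \<cdot> c1 = ix (Suc n)" "k1 \<cdot> w' = ix (Suc n)"
    using zigzag_wh[of n 0] by (simp_all add: u'_def w'_def c1_def k1_def)
  have uw'_loop: "u' \<cdot> w' = scale C loop (ix (Suc n))" using circle_wh[of "Suc n" 0] by (simp add: u'_def w'_def)
  have wE: "wh 0 (\<alpha> \<cdot> \<beta>) 1 = (R \<cdot> c1) \<cdot> (k1 \<cdot> R)"
    by (simp add: \<alpha>_def \<beta>_def wh_cmp[symmetric] RQ[symmetric] c1_def k1_def u_def w_def wh_wh)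
  have "wh 0 p' 1 = sub (wh 0 Q 1) (scale C (inverse t) (wh 0 (\<alpha> \<cdot> \<beta>) 1))"
    unfolding p'_eq by (simp add: sub_def wh_linear scale_simps)
  then have "wh 0 p' 1 = sub R (scale C (inverse t) ((R \<cdot> c1) \<cdot> (k1 \<cdot> R)))"
    unfolding RQ wE .
  then have "u' \<cdot> (wh 0 p' 1 \<cdot> w') = sub (u' \<cdot> (R \<cdot> w')) (scale C (inverse t) ((u' \<cdot> R) \<cdot> (c1 \<cdot> (k1 \<cdot> (R \<cdot> w')))))"
    by (simp add: sub_cmp scale_simps assoc_cmp)
  also have "u' \<cdot> (R \<cdot> w') = scale C loop P"
    unfolding Rw using assoc_cmp[of P w' u'] by (simp add: uw'_loop scale_simps)
  also have "(u' \<cdot> R) \<cdot> (c1 \<cdot> (k1 \<cdot> (R \<cdot> w'))) = P \<cdot> ((u' \<cdot> c1) \<cdot> ((k1 \<cdot> w') \<cdot> P))"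
    unfolding uR Rw by (simp add: assoc_cmp)
  also have "\<dots> = P" unfolding z by (simp add: idem)
  finally show "wh (Suc n) cap 0 \<cdot> (wh 0 p' 1 \<cdot> wh (Suc n) cup 0) = scale C (trace (Suc (Suc n))) P"
    by (simp add: u'_def w'_def sub_scale t_def)
qed

end

text \<open>The one condition on the loop value: no denominator of Wenzl's recursion
  vanishes.\<close>

locale temperley_lieb_generic = temperley_lieb +
  assumes trace_nonzero: "trace (Suc n) \<noteq> 0"
begin

text \<open>The properties are carried along jointly because \<open>jw_step\<close> needs all of
  them to produce any of them at the next level.\<close>

lemma jw_props:
  "jw (Suc n) \<cdot> jw (Suc n) = jw (Suc n) \<and> jw (Suc n) \<cdot> wh 0 (jw n) 1 = jw (Suc n) \<and>
    wh 0 (jw n) 1 \<cdot> jw (Suc n) = jw (Suc n) \<and>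
    wh n cap 0 \<cdot> (wh 0 (jw (Suc n)) 1 \<cdot> wh n cup 0) = scale C (trace (Suc n)) (jw n)"
proof (induction n)
  case 0
  have "wh 0 f 0 = f" if "arr f" for f using that by (simp add: wh_def)
  then show ?case by (simp add: wh_ix circle numeral_2_eq_2)
next
  case (Suc n)
  note h = jw_step[of n, OF _ _ _ _ trace_nonzero]
  show ?case using Suc h(1,2,3,6) by blast
qed

lemma jw_idem: "jw n \<cdot> jw n = jw n"
  using jw_props by (cases n) auto

text \<open>At the last two strands the recursion kills the cap. Further to the left the cap stays
  within the first \<open>n\<close> strands, where \<open>jw (Suc n)\<close> absorbs
  \<open>jw n\<close>, and induction applies.\<close>

lemma jw_cap: "wh a cap b \<cdot> jw (a + (2 + b)) = zero C (x (a + (2 + b))) (x (a + b))"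
proof (induction b)
  case 0
  have "wh a cap 0 \<cdot> jw (Suc (Suc a)) = zero C (x (a + 2)) (x a)"
    by (rule jw_step(4)) (use jw_props[of a] trace_nonzero in blast)+
  then show ?case by simp
next
  case (Suc b)
  define n where "n = a + (2 + b)"
  have [simp]: "x n = x (a + (2 + b))" by (simp add: n_def)
  have "wh a cap (Suc b) \<cdot> jw (Suc n) = wh 0 (wh a cap b) 1 \<cdot> (wh 0 (jw n) 1 \<cdot> jw (Suc n))"
    using jw_props[of n] by (simp add: wh_wh)
  also have "\<dots> = (wh 0 (wh a cap b) 1 \<cdot> wh 0 (jw n) 1) \<cdot> jw (Suc n)"
    by (rule assoc_cmp[symmetric]) (simp_all add: n_def)
  also have "wh 0 (wh a cap b) 1 \<cdot> wh 0 (jw n) 1 = wh 0 (zero C (x (a + (2 + b))) (x (a + b))) 1"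
    using Suc by (simp add: wh_cmp n_def)
  finally show ?case by (simp add: n_def wh_linear)
qed

lemma jw_cup: "jw (a + (2 + b)) \<cdot> wh a cup b = zero C (x (a + b)) (x (a + (2 + b)))"
proof (induction b)
  case 0
  have "jw (Suc (Suc a)) \<cdot> wh a cup 0 = zero C (x a) (x (a + 2))"
    by (rule jw_step(5)) (use jw_props[of a] trace_nonzero in blast)+
  then show ?case by simp
next
  case (Suc b)
  define n where "n = a + (2 + b)"
  have [simp]: "x n = x (a + (2 + b))" by (simp add: n_def)
  have "jw (Suc n) \<cdot> wh a cup (Suc b) = (jw (Suc n) \<cdot> wh 0 (jw n) 1) \<cdot> wh 0 (wh a cup b) 1"
    using jw_props[of n] by (simp add: wh_wh)
  also have "\<dots> = jw (Suc n) \<cdot> (wh 0 (jw n) 1 \<cdot> wh 0 (wh a cup b) 1)"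
    by (rule assoc_cmp) (simp_all add: n_def)
  also have "wh 0 (jw n) 1 \<cdot> wh 0 (wh a cup b) 1 = wh 0 (zero C (x (a + b)) (x (a + (2 + b)))) 1"
    using Suc by (simp add: wh_cmp n_def)
  finally show ?case by (simp add: n_def wh_linear)
qed

text \<open>A cup applied last or a cap applied first is killed by the idempotent next to it; what
  remains of a normal form is a multiple of an identity.\<close>

lemma jw_hom:
  "nf m n f \<Longrightarrow> jw n \<cdot> (f \<cdot> jw m) = zero C (x m) (x n) \<or> m = n \<and> (\<exists>c. jw n \<cdot> (f \<cdot> jw m) = scale C c (jw n))"
proof (induction rule: nf.induct)
  case (nf_ix n)
  have "jw n \<cdot> (ix n \<cdot> jw n) = scale C 1 (jw n)" by (simp add: jw_idem scale_simps)
  then show ?case by blast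
next
  case (nf_zero m n) then show ?case by simp
next
  case (nf_add m n f g)
  note [simp] = nf_typing[OF nf_add(1)] nf_typing[OF nf_add(2)]
  have e: "jw n \<cdot> (add C f g \<cdot> jw m) = add C (jw n \<cdot> (f \<cdot> jw m)) (jw n \<cdot> (g \<cdot> jw m))"
    by (simp add: distrib_simps)
  \<comment> \<open>For \<open>m = n\<close> zero is the multiple by 0, so both summands are
    multiples of \<open>jw n\<close>; otherwise both are zero.\<close>
  show ?case
  proof (cases "m = n")
    case True
    obtain c where "jw n \<cdot> (f \<cdot> jw m) = scale C c (jw n)"
      using nf_add.IH(1) True zero_simps(6)[of "jw n"] by (metis jw_typing)
    moreover obtain e where "jw n \<cdot> (g \<cdot> jw m) = scale C e (jw n)"
      using nf_add.IH(2) True zero_simps(6)[of "jw n"] by (metis jw_typing)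
    ultimately have "jw n \<cdot> (add C f g \<cdot> jw m) = scale C (c + e) (jw n)"
      unfolding e using scale_add[of "jw n" c e] by simp
    then show ?thesis using True by blast
  next
    case False then show ?thesis using nf_add.IH by (simp add: e add_simps)
  qed
next
  case (nf_scale m n f c)
  note [simp] = nf_typing[OF nf_scale(1)]
  have e: "jw n \<cdot> (scale C c f \<cdot> jw m) = scale C c (jw n \<cdot> (f \<cdot> jw m))" by (simp add: scale_simps)
  show ?case using nf_scale.IH unfolding e by (auto simp: scale_simps)
next
  case (nf_cup m a b f)
  note [simp] = nf_typing[OF nf_cup(1)]
  have "jw (a + (2 + b)) \<cdot> ((wh a cup b \<cdot> f) \<cdot> jw m) = (jw (a + (2 + b)) \<cdot> wh a cup b) \<cdot> (f \<cdot> jw m)"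
    by (simp add: assoc_cmp)
  then show ?case by (simp add: jw_cup[simplified])
next
  case (nf_cap a b n f)
  note [simp] = nf_typing[OF nf_cap(1)]
  have "jw n \<cdot> ((f \<cdot> wh a cap b) \<cdot> jw (a + (2 + b))) = jw n \<cdot> (f \<cdot> (wh a cap b \<cdot> jw (a + (2 + b))))"
    by (simp add: assoc_cmp)
  then show ?case by (simp add: jw_cap[simplified])
qed

end

section \<open>Clebsch--Gordan rule\<close>

context temperley_lieb_generic
begin

text \<open>The images of the idempotents are arbitrary choices, except that \<open>J 0\<close> and
  \<open>J 1\<close> are the unit and the generator themselves, to fit \<open>fusion\<close> and the
  comparison with \<open>T 0\<close> and \<open>T 1\<close>.\<close>

definition jw_splitting :: "(nat \<Rightarrow> 'a) \<Rightarrow> (nat \<Rightarrow> 'b) \<Rightarrow> (nat \<Rightarrow> 'b) \<Rightarrow> bool" where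
  "jw_splitting J i r \<longleftrightarrow> J 0 = x 0 \<and> J 1 = x 1 \<and> (\<forall>n. J n \<in> Ob C \<and> arr (i n) \<and> dom (i n) = J n \<and> cod (i n) = x n \<and>
    arr (r n) \<and> dom (r n) = x n \<and> cod (r n) = J n \<and> r n \<cdot> i n = idm C (J n) \<and> i n \<cdot> r n = jw n)"

lemma jw_splitting_exists:
  assumes sp: idempotents_split
  obtains J i r where "jw_splitting J i r"
proof -
  have "\<forall>n. \<exists>X i r. (n \<le> 1 \<longrightarrow> X = x n) \<and> X \<in> Ob C \<and> arr i \<and> dom i = X \<and> cod i = x n \<and>
    arr r \<and> dom r = x n \<and> cod r = X \<and> r \<cdot> i = idm C X \<and> i \<cdot> r = jw n" (is "\<forall>n. ?P n")
  proof
    fix n show "?P n"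
    proof (cases "n \<le> 1")
      case True
      then have "jw n = ix n" by (cases n) auto
      then show ?thesis using True by (intro exI[of _ "x n"] exI[of _ "ix n"]) simp
    next
      case False
      obtain i p where "arr i" "arr p" "dom p = x n" "cod i = x n" "cod p = dom i" "p \<cdot> i = idm C (dom i)" "i \<cdot> p = jw n"
        using sp[unfolded idempotents_split_def, rule_format, of "jw n"] jw_idem[of n] by auto
      then show ?thesis using False by (intro exI[of _ "dom i"] exI[of _ i] exI[of _ p]) simp
    qed
  qed
  then obtain J i r where h: "\<forall>n. (n \<le> 1 \<longrightarrow> J n = x n) \<and> J n \<in> Ob C \<and> arr (i n) \<and> dom (i n) = J n \<and> cod (i n) = x n \<and>
    arr (r n) \<and> dom (r n) = x n \<and> cod (r n) = J n \<and> r n \<cdot> i n = idm C (J n) \<and> i n \<cdot> r n = jw n"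
    unfolding choice_iff by blast
  have "J 0 = x 0" "J 1 = x 1" using h[THEN spec, of 0] h[THEN spec, of 1] by simp_all
  then have "jw_splitting J i r" unfolding jw_splitting_def using h by blast
  then show ?thesis using that by blast
qed

context
  fixes J i r assumes J: "jw_splitting J i r"
begin

lemma J_simps [simp]: "J n \<in> Ob C" "arr (i n)" "dom (i n) = J n" "cod (i n) = x n"
    "arr (r n)" "dom (r n) = x n" "cod (r n) = J n"
  and J_eqs: "r n \<cdot> i n = idm C (J n)" "i n \<cdot> r n = jw n" and J_01: "J 0 = x 0" "J 1 = x 1"
  using J unfolding jw_splitting_def by blast+

lemma jw_i: "jw n \<cdot> i n = i n" and jw_r: "r n \<cdot> jw n = r n"
proof -
  show "jw n \<cdot> i n = i n" using assoc_cmp[of "i n" "r n" "i n"] by (simp add: J_eqs)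
  show "r n \<cdot> jw n = r n" using assoc_cmp[of "r n" "i n" "r n"] by (simp add: J_eqs)
qed

text \<open>Composing with the splitting maps turns \<open>f\<close> into a morphism between tensor
  powers that is fixed by the idempotents on both sides. There \<open>jw_hom\<close> applies, and
  the splitting maps carry the result back.\<close>

lemma simple_family_J: "simple_family J"
  unfolding simple_family_def
proof (intro conjI allI impI; (elim conjE)?)
  fix f a b assume f [simp]: "arr f" "dom f = J a" "cod f = J b"
  let ?g = "i b \<cdot> (f \<cdot> r a)"
  have g: "jw b \<cdot> (?g \<cdot> jw a) = ?g"
  proof -
    have "jw b \<cdot> (?g \<cdot> jw a) = (jw b \<cdot> i b) \<cdot> (f \<cdot> (r a \<cdot> jw a))" by (simp add: assoc_cmp)
    then show ?thesis by (simp add: jw_i jw_r)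
  qed
  have f_eq: "r b \<cdot> (?g \<cdot> i a) = f"
  proof -
    have "r b \<cdot> (?g \<cdot> i a) = (r b \<cdot> i b) \<cdot> (f \<cdot> (r a \<cdot> i a))" by (simp add: assoc_cmp)
    then show ?thesis by (simp add: J_eqs)
  qed
  have "?g = zero C (x a) (x b) \<or> a = b \<and> (\<exists>c. ?g = scale C c (jw b))"
    using jw_hom[OF nf_all, of ?g a b] g by simp
  then show "f = zero C (J a) (J b) \<or> a = b \<and> (\<exists>c. f = scale C c (idm C (J a)))"
  proof
    assume "?g = zero C (x a) (x b)"
    then have "f = zero C (J a) (J b)" using f_eq by simp
    then show ?thesis by blast
  next
    assume "a = b \<and> (\<exists>c. ?g = scale C c (jw b))"
    then obtain c where c: "a = b" "?g = scale C c (jw b)" by blast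
    have "r b \<cdot> (scale C c (jw b) \<cdot> i b) = scale C c (idm C (J b))"
      by (simp add: scale_simps jw_i J_eqs)
    then have "f = scale C c (idm C (J a))" using f_eq c by simp
    then show ?thesis using c(1) by blast
  qed
qed simp

text \<open>Wenzl's recursion read as a decomposition: for \<open>n = m + 1\<close> the idempotent
  \<open>Q\<close> of \<open>J n \<odot> x 1\<close> is the sum of \<open>p'\<close>, with image
  \<open>J (m + 2)\<close>, and a second idempotent that factors through \<open>jw m\<close> by way
  of a cup and a cap, with image \<open>J m\<close>.\<close>

lemma J_tens_1: "decomposes J (J n \<odot> x 1) (neighbours n)"
proof (cases n)
  case 0
  then show ?thesis using decomposes_self[of J 1] by (simp add: neighbours_def J_01[simplified])
next
  case (Suc m)
  define P Q p' t where "P = jw (Suc m)" and "Q = wh 0 P 1" and "p' = jw (Suc (Suc m))" and "t = trace (Suc m)"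
  have [simp]: "arr P" "dom P = x (Suc m)" "cod P = x (Suc m)"
    "arr p'" "dom p' = x (Suc (Suc m))" "cod p' = x (Suc (Suc m))"
    by (simp_all only: P_def p'_def jw_typing)
  have [simp]: "arr Q" "dom Q = x (Suc (Suc m))" "cod Q = x (Suc (Suc m))" by (simp_all add: Q_def)
  define u w where "u = wh m cap 0" and "w = wh m cup 0"
  have [simp]: "arr u" "dom u = x (Suc (Suc m))" "cod u = x m" "arr w" "dom w = x m" "cod w = x (Suc (Suc m))"
    by (simp_all add: u_def w_def numeral_2_eq_2)
  note s = jw_step[of m, folded P_def, folded Q_def t_def p'_def u_def w_def]
  have h: "P \<cdot> P = P" "P \<cdot> wh 0 (jw m) 1 = P" "wh 0 (jw m) 1 \<cdot> P = P" "u \<cdot> (Q \<cdot> w) = scale C t (jw m)" "t \<noteq> 0"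
    using jw_props[of m] trace_nonzero[of m] by (simp_all add: P_def Q_def t_def u_def w_def)
  note s = s(2-5,7-10)[OF h]
  define I R where "I = i n \<otimes> ix 1" and "R = r n \<otimes> ix 1"
  have [simp]: "arr I" "dom I = J n \<odot> x 1" "cod I = x (Suc (Suc m))" "arr R" "dom R = x (Suc (Suc m))" "cod R = J n \<odot> x 1"
    by (simp_all add: I_def R_def Suc)
  have RI: "R \<cdot> I = idm C (J n \<odot> x 1)" by (simp add: I_def R_def cmp_tensM J_eqs)
  have IR: "I \<cdot> R = Q" by (simp add: I_def R_def cmp_tensM J_eqs Q_def P_def Suc wh_def)
  have RQ: "R \<cdot> Q = R" unfolding IR[symmetric] using assoc_cmp[of R I R] by (simp add: RI)
  define m2 where "m2 = Suc (Suc m)"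
  have [simp]: "x m2 = x (Suc (Suc m))" by (simp add: m2_def)
  have ir2: "jw m2 = p'" by (simp add: m2_def p'_def)
  have r2: "r m2 \<cdot> p' = r m2" "p' \<cdot> i m2 = i m2" using jw_i[of m2] jw_r[of m2] by (simp_all only: ir2)
  let ?\<iota> = "\<lambda>k. if k = m2 then R \<cdot> i m2 else R \<cdot> (w \<cdot> i m)"
  \<comment> \<open>Cup, then \<open>Q\<close>, then cap is \<open>t\<close> times
    \<open>jw m\<close>, so one of the two maps belonging to \<open>J m\<close> has to be divided by
    \<open>t\<close>.\<close>
  let ?\<pi> = "\<lambda>k. if k = m2 then r m2 \<cdot> I else scale C (inverse t) (r m \<cdot> (u \<cdot> I))"
  have "biprod (J n \<odot> x 1) (set [m2, m]) J ?\<iota> ?\<pi>"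
  proof (rule biprodI_csum)
    show "distinct [m2, m]" by (simp add: m2_def)
    have "(r m2 \<cdot> I) \<cdot> (R \<cdot> i m2) = r m2 \<cdot> ((I \<cdot> R) \<cdot> i m2)" by (simp add: assoc_cmp)
    also have "\<dots> = r m2 \<cdot> ((Q \<cdot> p') \<cdot> i m2)" unfolding IR by (simp add: assoc_cmp r2)
    also have "\<dots> = idm C (J m2)" by (simp add: s(1-4) r2 J_eqs)
    finally have o1: "(r m2 \<cdot> I) \<cdot> (R \<cdot> i m2) = idm C (J m2)" .
    have "(r m2 \<cdot> I) \<cdot> (R \<cdot> (w \<cdot> i m)) = ((r m2 \<cdot> p') \<cdot> (I \<cdot> R)) \<cdot> (w \<cdot> i m)" by (simp add: assoc_cmp r2)
    also have "\<dots> = r m2 \<cdot> (((p' \<cdot> Q) \<cdot> w) \<cdot> i m)" unfolding IR by (simp add: assoc_cmp)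
    also have "\<dots> = zero C (J m) (J m2)" by (simp add: s(1-4))
    finally have o2: "(r m2 \<cdot> I) \<cdot> (R \<cdot> (w \<cdot> i m)) = zero C (J m) (J m2)" .
    have "(r m \<cdot> (u \<cdot> I)) \<cdot> (R \<cdot> i m2) = r m \<cdot> ((u \<cdot> ((I \<cdot> R) \<cdot> p')) \<cdot> i m2)" by (simp add: assoc_cmp r2)
    also have "\<dots> = zero C (J m2) (J m)" unfolding IR by (simp add: s(1-4))
    finally have o3: "(r m \<cdot> (u \<cdot> I)) \<cdot> (R \<cdot> i m2) = zero C (J m2) (J m)" .
    have "(r m \<cdot> (u \<cdot> I)) \<cdot> (R \<cdot> (w \<cdot> i m)) = r m \<cdot> ((u \<cdot> ((I \<cdot> R) \<cdot> w)) \<cdot> i m)" by (simp add: assoc_cmp)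
    also have "\<dots> = scale C t (idm C (J m))" unfolding IR h(4) by (simp add: scale_simps jw_i J_eqs)
    finally have o4: "(r m \<cdot> (u \<cdot> I)) \<cdot> (R \<cdot> (w \<cdot> i m)) = scale C t (idm C (J m))" .
    show "?\<pi> k \<cdot> ?\<iota> l = (if k = l then idm C (J k) else zero C (J l) (J k))"
      if "k \<in> set [m2, m]" "l \<in> set [m2, m]" for k l
      using that o1 o2 o3 o4 h(5) by (auto simp: scale_simps)
    define \<alpha> \<beta> where "\<alpha> = Q \<cdot> w" and "\<beta> = u \<cdot> Q"
    have [simp]: "arr \<alpha>" "dom \<alpha> = x m" "cod \<alpha> = x (Suc (Suc m))" "arr \<beta>" "dom \<beta> = x (Suc (Suc m))" "cod \<beta> = x m"
      by (simp_all add: \<alpha>_def \<beta>_def)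
    have QI: "Q \<cdot> I = I" unfolding IR[symmetric] by (simp add: RI assoc_cmp)
    have "R \<cdot> w = (R \<cdot> Q) \<cdot> w" by (simp add: RQ)
    then have Rw: "R \<cdot> w = R \<cdot> \<alpha>" by (simp add: \<alpha>_def assoc_cmp)
    have "u \<cdot> I = u \<cdot> (Q \<cdot> I)" by (simp add: QI)
    then have uI: "u \<cdot> I = \<beta> \<cdot> I" by (simp add: \<beta>_def assoc_cmp)
    have p\<beta>: "jw m \<cdot> \<beta> = \<beta>" using s(5) by (simp add: \<beta>_def)
    have "(R \<cdot> (w \<cdot> i m)) \<cdot> (r m \<cdot> (u \<cdot> I)) = (R \<cdot> w) \<cdot> ((i m \<cdot> r m) \<cdot> (u \<cdot> I))" by (simp add: assoc_cmp)
    also have "\<dots> = R \<cdot> ((\<alpha> \<cdot> (jw m \<cdot> \<beta>)) \<cdot> I)" unfolding Rw uI J_eqs by (simp add: assoc_cmp)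
    finally have c1: "(R \<cdot> (w \<cdot> i m)) \<cdot> (r m \<cdot> (u \<cdot> I)) = R \<cdot> ((\<alpha> \<cdot> \<beta>) \<cdot> I)" by (simp add: p\<beta>)
    have c2: "(R \<cdot> i m2) \<cdot> (r m2 \<cdot> I) = R \<cdot> (p' \<cdot> I)"
    proof -
      have "(R \<cdot> i m2) \<cdot> (r m2 \<cdot> I) = R \<cdot> ((i m2 \<cdot> r m2) \<cdot> I)" by (simp add: assoc_cmp)
      then show ?thesis by (simp only: J_eqs ir2)
    qed
    \<comment> \<open>The recursion solved for \<open>Q\<close>; composing with \<open>R\<close> and
      \<open>I\<close> turns it into completeness of the two summands.\<close>
    have "Q = add C p' (scale C (inverse t) (\<alpha> \<cdot> \<beta>))"
      using add_sub[of Q "scale C (inverse t) (\<alpha> \<cdot> \<beta>)"] s(8) by (simp add: \<alpha>_def \<beta>_def)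
    then have "R \<cdot> (Q \<cdot> I) = add C (R \<cdot> (p' \<cdot> I)) (scale C (inverse t) (R \<cdot> ((\<alpha> \<cdot> \<beta>) \<cdot> I)))"
      by (simp add: distrib_simps scale_simps)
    then have "add C (R \<cdot> (p' \<cdot> I)) (scale C (inverse t) (R \<cdot> ((\<alpha> \<cdot> \<beta>) \<cdot> I))) = idm C (J n \<odot> x 1)"
      by (simp add: QI RI)
    then show "csum C (J n \<odot> x 1) (J n \<odot> x 1) (map (\<lambda>k. ?\<iota> k \<cdot> ?\<pi> k) [m2, m]) = idm C (J n \<odot> x 1)"
      using c1 c2 by (simp add: m2_def add_simps scale_simps)
  qed (auto simp: m2_def)
  then have "decomposes J (J n \<odot> x 1) (image_mset (\<lambda>k. k) (mset_set (set [m2, m])))"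
    by (intro decomposesI) 
  then show ?thesis by (simp add: neighbours_def Suc m2_def)
qed

primrec tensor_power_labels :: "nat \<Rightarrow> nat multiset" where
  "tensor_power_labels 0 = {#0#}"
| "tensor_power_labels (Suc n) = (\<Sum>k\<in>#tensor_power_labels n. neighbours k)"

lemma decomposes_x: "decomposes J (x n) (tensor_power_labels n)"
proof (induction n)
  case 0 then show ?case using decomposes_self[of J 0] by (simp add: J_01)
next
  case (Suc n)
  have "decomposes J (x n \<odot> x 1) (\<Sum>k\<in>#tensor_power_labels n. neighbours k)"
    by (rule decomposes_tensO[OF Suc]) (simp_all add: J_tens_1[simplified])
  then show ?case by simp
qed

text \<open>Which labels occur is all that matters later, not how often: for
  \<open>n \<ge> 2\<close> every label of \<open>x n\<close> other than \<open>n\<close> occurs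
  already in \<open>x (n - 2)\<close>.\<close>

lemma tensor_power_labels_iff: "k \<in># tensor_power_labels n \<longleftrightarrow> k \<le> n \<and> even (n + k)"
proof (induction n arbitrary: k)
  case 0 then show ?case by auto
next
  case (Suc n)
  have "k \<in># tensor_power_labels (Suc n) \<longleftrightarrow> (\<exists>l. l \<le> n \<and> even (n + l) \<and> k \<in># neighbours l)"
    using Suc by auto
  also have "\<dots> \<longleftrightarrow> (\<exists>l. l \<le> n \<and> even (n + l) \<and> (k = l + 1 \<or> l = k + 1))"
    unfolding neighbours_def by (intro iff_exI conj_cong HOL.refl) auto
  also have "\<dots> \<longleftrightarrow> k \<le> Suc n \<and> even (Suc n + k)"
    by presburger
  finally show ?case .
qed

end

section \<open>Identification of the given objects \<open>T n\<close> and their fusion\<close>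

context
  fixes T :: "nat \<Rightarrow> 'a"
  assumes sp: idempotents_split
    and T_01: "T 0 = x 0" "T 1 = x 1"
    and T: "\<And>n. 2 \<le> n \<Longrightarrow> indecomposable C (T n) \<and> is_summand C (T n) (x n) \<and> \<not> is_summand C (T n) (x (n - 2))"
begin

text \<open>An indecomposable retract of \<open>x n\<close> is some \<open>J k\<close> with
  \<open>k\<close> among the labels of \<open>x n\<close>. If \<open>k\<close> were different from
  \<open>n\<close>, it would also be a label of \<open>x (n - 2)\<close>, and \<open>T n\<close>
  would be a summand there, which is excluded.\<close>

lemma T_iso_J:
  assumes J: "jw_splitting J i r" and n: "2 \<le> n"
  shows "isomorphic C (T n) (J n) \<and> idm C (J n) \<noteq> zero C (J n) (J n)"
proof -
  note Js = J_simps[OF J] and P = simple_family_J[OF J]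
  obtain s t where st: "arr s" "dom s = T n" "cod s = x n" "arr t" "dom t = x n" "cod t = T n" "t \<cdot> s = idm C (T n)"
    using T[OF n] is_summandE by metis
  obtain k where k: "k \<in># tensor_power_labels n" "isomorphic C (T n) (J k)" "idm C (J k) \<noteq> zero C (J k) (J k)"
    using indecomposable_retract[OF sp P _ st decomposes_x[OF J]] T[OF n] by blast
  have "k = n"
  proof (rule ccontr)
    assume "k \<noteq> n"
    then have "k \<in># tensor_power_labels (n - 2)"
      using k(1) n unfolding tensor_power_labels_iff[OF J] by presburger
    moreover obtain I :: "nat set" and lab \<iota> \<pi> where b: "biprod (x (n - 2)) I (\<lambda>t. J (lab t)) \<iota> \<pi>"
      "tensor_power_labels (n - 2) = image_mset lab (mset_set I)"
      using decomposes_x[OF J, of "n - 2"] unfolding decomposes_def by blast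
    ultimately obtain a where a: "a \<in> I" "lab a = k" using biprodD(2)[OF b(1)] by auto
    obtain u v where "T n \<in> Ob C" "inverse_pair C (T n) (J k) u v" using k(2) by (auto simp: isomorphic_def is_iso_def)
    then have uv: "arr u" "dom u = T n" "cod u = J k" "arr v" "dom v = J k" "cod v = T n" "v \<cdot> u = idm C (T n)"
      using Js(1) by (auto simp: inverse_pair_iff)
    note bs = biprodD(4-9)[OF b(1) a(1)] biprodD(10)[OF b(1) a(1) a(1)]
    have "(v \<cdot> \<pi> a) \<cdot> (\<iota> a \<cdot> u) = v \<cdot> ((\<pi> a \<cdot> \<iota> a) \<cdot> u)" using uv bs(1-6) a(2) by (simp add: assoc_cmp)
    also have "\<dots> = idm C (T n)" using uv bs(7) a(2) by simp
    finally have "is_summand C (T n) (x (n - 2))"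
      using is_summandI[OF sp, of "\<iota> a \<cdot> u" "T n" "x (n - 2)" "v \<cdot> \<pi> a"] uv bs(1-6) a(2) by simp
    then show False using T[OF n] by blast
  qed
  then show ?thesis using k by blast
qed

text \<open>For \<open>n \<ge> 2\<close> nonvanishing is inherited from \<open>T n\<close>. The
  nonzero object \<open>T 2\<close> is a retract of \<open>x 2\<close>, and \<open>x 2\<close> is
  \<open>x 0 \<odot> x 2\<close> as well as \<open>x 1 \<odot> x 1\<close>, so neither
  \<open>x 0\<close> nor \<open>x 1\<close> can vanish.\<close>

lemma J_nonzero: assumes J: "jw_splitting J i r" shows "idm C (J n) \<noteq> zero C (J n) (J n)"
proof -
  have x2: "ix 2 \<noteq> zero C (x 2) (x 2)"
  proof
    assume z: "ix 2 = zero C (x 2) (x 2)"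
    obtain s t where st: "arr s" "dom s = T 2" "cod s = x 2" "arr t" "dom t = x 2" "cod t = T 2" "t \<cdot> s = idm C (T 2)"
      using T[of 2] is_summandE by (metis order_refl)
    have "t \<cdot> s = t \<cdot> (ix 2 \<cdot> s)" using st by simp
    also have "\<dots> = zero C (T 2) (T 2)" unfolding z using st ob_simps(1)[of s] by simp
    finally show False using T[of 2] st(7) by (simp add: indecomposable_def is_zero_ob_def)
  qed
  consider "n = 0" | "n = 1" | "2 \<le> n" by linarith
  then show ?thesis
  proof cases
    case 1
    have "ix 0 \<otimes> ix 2 = ix 2" by (rule ix_0(1)) simp
    moreover have "zero C (x 0) (x 0) \<otimes> ix 2 = zero C (x 2) (x 2)"
      using tensM_zero_left[OF arrow_idm[OF x_Ob[of 2]] x_Ob[of 0] x_Ob[of 0]] unfolding x_add add_0 .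
    ultimately show ?thesis using 1 x2 J_01[OF J] by metis
  next
    case 2
    have "ix 1 \<otimes> ix 1 = ix 2" "zero C (x 1) (x 1) \<otimes> ix 1 = zero C (x 2) (x 2)"
      using id_simps(3)[OF x_Ob[of 1] x_Ob[of 1]] tensM_zero_left[OF arrow_idm[OF x_Ob[of 1]] x_Ob[of 1] x_Ob[of 1]]
      unfolding x_add one_add_one .
    then show ?thesis using 2 x2 J_01[OF J] by metis
  next
    case 3 then show ?thesis using T_iso_J[OF J] by blast
  qed
qed

theorem T_fusion:
  obtains \<iota> \<pi> where "biprod (T i \<odot> T j) {..<min i j + 1} (\<lambda>m. T (i + j - 2 * m)) \<iota> \<pi>"
proof -
  obtain J e r where J: "jw_splitting J e r" using jw_splitting_exists[OF sp] by blast
  note P = simple_family_J[OF J] and nz = J_nonzero[OF J]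
  have iso: "isomorphic C (T n) (J n)" for n
  proof -
    consider "n = 0" | "n = 1" | "2 \<le> n" by linarith
    then show ?thesis
      using T_iso_J[OF J] T_01 J_01[OF J] isomorphic_refl[of "x 0"] isomorphic_refl[of "x 1"] by cases auto
  qed
  \<comment> \<open>\<open>m\<close> counts the steps down from the top label \<open>i + j\<close>,
    the indexing used in the theorem; \<open>clebsch_gordan\<close> describes the same labels as a
    set.\<close>
  let ?ls = "map (\<lambda>m. i + j - 2 * m) [0..<min i j + 1]"
  have dist: "distinct ?ls" by (auto simp: distinct_map inj_on_def)
  have "clebsch_gordan i j = set ?ls"
  proof (intro equalityI subsetI)
    fix k assume "k \<in> clebsch_gordan i j"
    then have k: "k = i + j - 2 * ((i + j - k) div 2)" and "(i + j - k) div 2 < min i j + 1"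
      unfolding clebsch_gordan_def by (auto; presburger)+
    from this(2) have "(i + j - k) div 2 \<in> set [0..<min i j + 1]" by (simp del: upt_Suc)
    with k show "k \<in> set ?ls" unfolding set_map by (rule image_eqI)
  qed (auto simp: clebsch_gordan_def)
  then have "mset_set (clebsch_gordan i j) = mset ?ls" using mset_set_set[OF dist] by simp
  then have "decomposes J (J i \<odot> J j) (mset ?ls)"
    using fusion[OF sp P nz, of i j] J_01[OF J] J_tens_1[OF J] by simp
  moreover have "isomorphic C (J i \<odot> J j) (T i \<odot> T j)"
    using isomorphic_tensO iso isomorphic_sym by blast
  ultimately obtain \<iota> \<pi> where "biprod (T i \<odot> T j) {..<length ?ls} (\<lambda>m. J (?ls ! m)) \<iota> \<pi>"
    using decomposes_iso decomposes_list dist by metis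
  from biprod_iso_summands[OF this, of "\<lambda>m. T (?ls ! m)"] iso isomorphic_sym
  obtain \<iota> \<pi> where "biprod (T i \<odot> T j) {..<length ?ls} (\<lambda>m. T (?ls ! m)) \<iota> \<pi>" by blast
  then have "biprod (T i \<odot> T j) {..<length ?ls} (\<lambda>m. T (i + j - 2 * m)) \<iota> \<pi>"
    by (rule biprod_cong) (simp del: upt_Suc)
  then show ?thesis using that by simp
qed

end

end

section \<open>The Cauchy completion of the Temperley--Lieb category\<close>

context strict_lin_monoidal
begin

definition single :: "'o \<Rightarrow> 'o \<Rightarrow> 'm \<Rightarrow> ('o list, nat \<times> nat \<Rightarrow> 'm) arr" where
  "single X Y f = Arr [X] [Y] (\<lambda>p\<in>{(0, 0)}. f)"

lemma single_sel [simp]: "src (single X Y f) = [X]" "tgt (single X Y f) = [Y]" "dat (single X Y f) (0, 0) = f"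
  by (simp_all add: single_def)

lemma arrow_single: assumes f: "arrow C f X Y" shows "arrow AddC (single X Y f) [X] [Y]"
proof -
  have "single X Y f \<in> Hom AddC [X] [Y]"
    by (rule additive_HomI) (use f arrow_Ob[OF f] in \<open>auto simp: single_def\<close>)
  then show ?thesis using arrow_Ob[OF f] by (simp add: arrow_def additive_sel)
qed

lemma single_eqI: "arrow AddC g [X] [Y] \<Longrightarrow> dat g (0, 0) = f \<Longrightarrow> arrow C f X Y \<Longrightarrow> g = single X Y f"
  by (rule additive_arrow_eqI[OF _ arrow_single]) auto

lemma additive_arrow_single: assumes g: "arrow AddC g [X] [Y]"
  shows "arrow C (dat g (0, 0)) X Y" "g = single X Y (dat g (0, 0))"
proof -
  show a: "arrow C (dat g (0, 0)) X Y" using additive_arrowD(6)[OF g, of 0 0] by simp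
  show "g = single X Y (dat g (0, 0))" by (rule single_eqI[OF g HOL.refl a])
qed

lemma single_ops:
  "X \<in> Ob C \<Longrightarrow> idm AddC [X] = single X X (idm C X)"
  "X \<in> Ob C \<Longrightarrow> Y \<in> Ob C \<Longrightarrow> zero AddC [X] [Y] = single X Y (zero C X Y)"
  "arrow C f X Y \<Longrightarrow> arrow C g Y W \<Longrightarrow> single Y W g \<cdot>\<^bsub>AddC\<^esub> single X Y f = single X W (g \<cdot> f)"
  "arrow C f X Y \<Longrightarrow> arrow C f' X Y \<Longrightarrow> add AddC (single X Y f) (single X Y f') = single X Y (add C f f')"
  "arrow C f X Y \<Longrightarrow> scale AddC c (single X Y f) = single X Y (scale C c f)"
  "arrow C f X Y \<Longrightarrow> arrow C h X' Y' \<Longrightarrow> single X Y f \<otimes>\<^bsub>AddC\<^esub> single X' Y' h = single (X \<odot> X') (Y \<odot> Y') (f \<otimes> h)"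
proof -
  interpret add: strict_lin_monoidal AddC by (rule additive_completion_monoidal)
  show "idm AddC [X] = single X X (idm C X)" if "X \<in> Ob C"
    by (rule single_eqI) (use that in \<open>auto simp: additive_entry intro!: additive_arrow arrow_idm\<close>)
  show "zero AddC [X] [Y] = single X Y (zero C X Y)" if "X \<in> Ob C" "Y \<in> Ob C"
    by (rule single_eqI) (use that in \<open>auto simp: additive_entry additive_sel intro!: add.arrow_zero arrow_zero\<close>)
  show "single Y W g \<cdot>\<^bsub>AddC\<^esub> single X Y f = single X W (g \<cdot> f)" if f: "arrow C f X Y" and g: "arrow C g Y W"
    by (rule single_eqI[OF additive_arrow(2)[OF arrow_single[OF f] arrow_single[OF g]]])
      (use add_zero[OF arrow_cmp[OF f g]] arrow_cmp[OF f g] in \<open>simp_all add: additive_entry\<close>)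
  show "add AddC (single X Y f) (single X Y f') = single X Y (add C f f')" if f: "arrow C f X Y" and g: "arrow C f' X Y"
    by (rule single_eqI[OF additive_arrow_add[OF arrow_single[OF f] arrow_single[OF g]]])
      (use arrow_add[OF f g] in \<open>simp_all add: additive_entry\<close>)
  show "scale AddC c (single X Y f) = single X Y (scale C c f)" if f: "arrow C f X Y"
    by (rule single_eqI[OF additive_arrow_scale[OF arrow_single[OF f]]])
      (use arrow_scale[OF f] in \<open>simp_all add: additive_entry\<close>)
  show "single X Y f \<otimes>\<^bsub>AddC\<^esub> single X' Y' h = single (X \<odot> X') (Y \<odot> Y') (f \<otimes> h)"
    if f: "arrow C f X Y" and h: "arrow C h X' Y'"
    by (rule single_eqI[OF additive_arrow(3)[OF arrow_single[OF f] arrow_single[OF h], simplified]])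
      (use arrow_tensM[OF f h] in \<open>simp_all add: additive_entry\<close>)
qed

abbreviation CC where "CC \<equiv> cauchy_completion C"

lemma cauchy_mor_eq: "cauchy_mor C X Y f = Arr (cauchy_ob C X) (cauchy_ob C Y) (single X Y f)"
  by (simp add: cauchy_mor_def single_def)

lemma cauchy_ob_eq: "X \<in> Ob C \<Longrightarrow> cauchy_ob C X = ([X], single X X (idm C X))"
  by (simp add: cauchy_ob_def single_ops)

lemma cauchy_arrow: "arrow C f X Y \<Longrightarrow> arrow CC (cauchy_mor C X Y f) (cauchy_ob C X) (cauchy_ob C Y)"
  and cauchy_Ob: "X \<in> Ob C \<Longrightarrow> cauchy_ob C X \<in> Ob CC"
proof -
  interpret add: strict_lin_monoidal AddC by (rule additive_completion_monoidal)
  show Ob: "cauchy_ob C X \<in> Ob CC" if "X \<in> Ob C" for X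
    using that arrow_single[OF arrow_idm[OF that]] idm_left[OF arrow_idm[OF that]] arrow_idm[OF that]
    by (simp add: cauchy_completion_def add.idempotent_Ob cauchy_ob_eq single_ops)
  show "arrow CC (cauchy_mor C X Y f) (cauchy_ob C X) (cauchy_ob C Y)" if f: "arrow C f X Y"
    using f Ob[OF arrow_Ob(1)[OF f]] Ob[OF arrow_Ob(2)[OF f]] arrow_Ob[OF f] arrow_single[OF f]
      single_ops(3)[OF f arrow_idm[OF arrow_Ob(2)[OF f]]] single_ops(3)[OF arrow_idm[OF arrow_Ob(1)[OF f]] f]
    unfolding cauchy_completion_def
    by (simp add: add.idempotent_arrow cauchy_ob_eq cauchy_mor_eq idm_left idm_right)
qed

text \<open>The canonical functor is full: between one-element lists a matrix is a single entry, and
  the idempotents there are identities.\<close>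

lemma cauchy_arrow_cases:
  assumes "arrow CC f (cauchy_ob C X) (cauchy_ob C Y)"
  obtains g where "arrow C g X Y" "f = cauchy_mor C X Y g"
proof -
  interpret add: strict_lin_monoidal AddC by (rule additive_completion_monoidal)
  have f: "src f = cauchy_ob C X" "tgt f = cauchy_ob C Y" "arrow AddC (dat f) [X] [Y]"
    using assms by (simp_all add: cauchy_completion_def add.idempotent_arrow cauchy_ob_def)
  show ?thesis
    by (rule that[OF additive_arrow_single(1)[OF f(3)]])
      (use f additive_arrow_single(2)[OF f(3)] in \<open>cases f, auto simp: cauchy_mor_eq\<close>)
qed

text \<open>The canonical functor is linear and strictly monoidal, with equalities on objects too;
  hence the tensor powers of the generator add up on the nose in \<open>TL q\<close>.\<close>

lemma cauchy_ops:
  "X \<in> Ob C \<Longrightarrow> idm CC (cauchy_ob C X) = cauchy_mor C X X (idm C X)"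
  "X \<in> Ob C \<Longrightarrow> Y \<in> Ob C \<Longrightarrow> zero CC (cauchy_ob C X) (cauchy_ob C Y) = cauchy_mor C X Y (zero C X Y)"
  "arrow C f X Y \<Longrightarrow> arrow C g Y W \<Longrightarrow> cauchy_mor C Y W g \<cdot>\<^bsub>CC\<^esub> cauchy_mor C X Y f = cauchy_mor C X W (g \<cdot> f)"
  "arrow C f X Y \<Longrightarrow> arrow C f' X Y \<Longrightarrow> add CC (cauchy_mor C X Y f) (cauchy_mor C X Y f') = cauchy_mor C X Y (add C f f')"
  "arrow C f X Y \<Longrightarrow> scale CC c (cauchy_mor C X Y f) = cauchy_mor C X Y (scale C c f)"
  "arrow C f X Y \<Longrightarrow> arrow C h X' Y' \<Longrightarrow>
    cauchy_mor C X Y f \<otimes>\<^bsub>CC\<^esub> cauchy_mor C X' Y' h = cauchy_mor C (X \<odot> X') (Y \<odot> Y') (f \<otimes> h)"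
  "X \<in> Ob C \<Longrightarrow> Y \<in> Ob C \<Longrightarrow> cauchy_ob C X \<odot>\<^bsub>CC\<^esub> cauchy_ob C Y = cauchy_ob C (X \<odot> Y)"
  "unit CC = cauchy_ob C (unit C)"
proof -
  interpret add: strict_lin_monoidal AddC by (rule additive_completion_monoidal)
  note s = cauchy_completion_def cauchy_mor_eq add.idempotent_sel single_ops
  show ob: "cauchy_ob C X \<odot>\<^bsub>CC\<^esub> cauchy_ob C Y = cauchy_ob C (X \<odot> Y)" if "X \<in> Ob C" "Y \<in> Ob C" for X Y
    using that by (simp add: cauchy_completion_def add.idempotent_sel additive_sel cauchy_ob_eq single_ops
        arrow_idm tensO_Ob tensM_idm)
  show "idm CC (cauchy_ob C X) = cauchy_mor C X X (idm C X)" if "X \<in> Ob C"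
    using that by (intro arr.expand) (simp add: s, simp add: cauchy_ob_eq)
  show "zero CC (cauchy_ob C X) (cauchy_ob C Y) = cauchy_mor C X Y (zero C X Y)" if "X \<in> Ob C" "Y \<in> Ob C"
    using that by (intro arr.expand) (simp add: s, simp add: cauchy_ob_eq single_ops)
  show "cauchy_mor C Y W g \<cdot>\<^bsub>CC\<^esub> cauchy_mor C X Y f = cauchy_mor C X W (g \<cdot> f)" if "arrow C f X Y" "arrow C g Y W"
    using that by (intro arr.expand) (simp add: s)
  show "add CC (cauchy_mor C X Y f) (cauchy_mor C X Y f') = cauchy_mor C X Y (add C f f')"
    if "arrow C f X Y" "arrow C f' X Y"
    using that by (intro arr.expand) (simp add: s)
  show "scale CC c (cauchy_mor C X Y f) = cauchy_mor C X Y (scale C c f)" if "arrow C f X Y"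
    using that by (intro arr.expand) (simp add: s)
  show "cauchy_mor C X Y f \<otimes>\<^bsub>CC\<^esub> cauchy_mor C X' Y' h = cauchy_mor C (X \<odot> X') (Y \<odot> Y') (f \<otimes> h)"
    if f: "arrow C f X Y" and h: "arrow C h X' Y'"
    using f h ob[OF arrow_Ob(1)[OF f] arrow_Ob(1)[OF h]] ob[OF arrow_Ob(2)[OF f] arrow_Ob(2)[OF h]]
    by (intro arr.expand) (simp add: s)
  show "unit CC = cauchy_ob C (unit C)"
    by (simp add: cauchy_completion_def add.idempotent_sel additive_sel cauchy_ob_def)
qed

text \<open>The image of \<open>e\<close> is the formal object with the same underlying sum and the
  idempotent \<open>dat e\<close>; inclusion and projection are both \<open>dat e\<close>, with
  different endpoints.\<close>

lemma cauchy_splits: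
  assumes e: "arrow CC e A A" "e \<cdot>\<^bsub>CC\<^esub> e = e"
  obtains B i p where "arrow CC i B A" "arrow CC p A B" "p \<cdot>\<^bsub>CC\<^esub> i = idm CC B" "i \<cdot>\<^bsub>CC\<^esub> p = e"
proof -
  interpret add: strict_lin_monoidal AddC by (rule additive_completion_monoidal)
  let ?B = "(fst A, dat e)"
  have ee: "dat e \<cdot>\<^bsub>AddC\<^esub> dat e = dat e" using arg_cong[OF e(2), of dat]
    by (simp add: cauchy_completion_def add.idempotent_sel)
  have es: "src e = A" "tgt e = A" using e(1) by (simp_all add: cauchy_completion_def add.idempotent_arrow)
  show ?thesis
  proof (rule that[of "Arr ?B A (dat e)" ?B "Arr A ?B (dat e)"])
    show "arrow CC (Arr ?B A (dat e)) ?B A" "arrow CC (Arr A ?B (dat e)) A ?B"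
      using e(1) ee unfolding cauchy_completion_def by (simp_all add: add.idempotent_arrow add.idempotent_Ob)
    show "Arr A ?B (dat e) \<cdot>\<^bsub>CC\<^esub> Arr ?B A (dat e) = idm CC ?B"
      by (intro arr.expand) (simp add: cauchy_completion_def add.idempotent_sel ee)
    show "Arr ?B A (dat e) \<cdot>\<^bsub>CC\<^esub> Arr A ?B (dat e) = e"
      by (intro arr.expand) (simp add: cauchy_completion_def add.idempotent_sel ee es)
  qed
qed

text \<open>It suffices to test against the columns of the idempotent defining \<open>A\<close>.\<close>

lemma cauchy_epic:
  assumes g: "arrow CC g A B" and g': "arrow CC g' A B"
    and eq: "\<And>X f. X \<in> Ob C \<Longrightarrow> arrow CC f (cauchy_ob C X) A \<Longrightarrow> g \<cdot>\<^bsub>CC\<^esub> f = g' \<cdot>\<^bsub>CC\<^esub> f"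
  shows "g = g'"
proof -
  interpret add: strict_lin_monoidal AddC by (rule additive_completion_monoidal)
  obtain Xs e where A: "A = (Xs, e)" by fastforce
  obtain Ys e' where B: "B = (Ys, e')" by fastforce
  have A_Ob: "A \<in> Ob CC" using g by (simp add: arrow_def)
  have e: "arrow AddC e Xs Xs" "e \<cdot>\<^bsub>AddC\<^esub> e = e"
    using A_Ob A by (simp_all add: cauchy_completion_def add.idempotent_Ob)
  have gd: "src g = A" "tgt g = B" "arrow AddC (dat g) Xs Ys" "dat g \<cdot>\<^bsub>AddC\<^esub> e = dat g"
    and gd': "src g' = A" "tgt g' = B" "arrow AddC (dat g') Xs Ys" "dat g' \<cdot>\<^bsub>AddC\<^esub> e = dat g'"
    using g g' A B by (simp_all add: cauchy_completion_def add.idempotent_arrow)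
  note ed = additive_arrowD[OF e(1)]
  define col where "col j = Arr [Xs ! j] Xs (\<lambda>(i, k)\<in>mat_index [Xs ! j] Xs. dat e (i, j))" for j
  have col_sel [simp]: "src (col j) = [Xs ! j]" "tgt (col j) = Xs"
    "i < length Xs \<Longrightarrow> dat (col j) (i, 0) = dat e (i, j)" for i j
    by (simp_all add: col_def)
  have XsOb: "Xs ! j \<in> Ob C" if "j < length Xs" for j using ed(3) that by auto
  have col: "arrow AddC (col j) [Xs ! j] Xs" if j: "j < length Xs" for j
  proof -
    have "col j \<in> Hom AddC [Xs ! j] Xs"
      by (rule additive_HomI) (use ed j XsOb in \<open>auto simp: col_def\<close>)
    then show ?thesis using XsOb[OF j] e(1) by (simp add: arrow_def additive_sel)
  qed
  have h_col: "dat (h \<cdot>\<^bsub>AddC\<^esub> col j) (i, 0) = dat (h \<cdot>\<^bsub>AddC\<^esub> e) (i, j)"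
    if "arrow AddC h Xs Zs" "i < length Zs" "j < length Xs" for h Zs i j
    using that additive_arrowD(1,2)[OF that(1)] ed(1,2)
    by (auto simp: additive_entry additive_sel intro!: arg_cong[where f = "csum C _ _"])
  \<comment> \<open>Idempotency of \<open>e\<close> makes its columns morphisms into
    \<open>A\<close>; and since \<open>g\<close> equals its composite with \<open>e\<close>, its
    entries can be read off from the composites with the columns.\<close>
  have e_col: "e \<cdot>\<^bsub>AddC\<^esub> col j = col j" if j: "j < length Xs" for j
    by (rule additive_arrow_eqI[OF additive_arrow(2)[OF col[OF j] e(1)] col[OF j]])
      (use h_col[OF e(1) _ j] e(2) in simp)
  let ?f = "\<lambda>j. Arr (cauchy_ob C (Xs ! j)) A (col j)"
  have f: "arrow CC (?f j) (cauchy_ob C (Xs ! j)) A" if j: "j < length Xs" for j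
    using col[OF j] e_col[OF j] additive_idm_right[OF col[OF j]] A_Ob cauchy_Ob[OF XsOb[OF j]] A
    unfolding cauchy_completion_def by (simp add: add.idempotent_arrow cauchy_ob_def)
  have "dat g = dat g'"
  proof (rule additive_arrow_eqI[OF gd(3) gd'(3)])
    fix i j assume ij: "i < length Ys" "j < length Xs"
    have "dat g \<cdot>\<^bsub>AddC\<^esub> col j = dat g' \<cdot>\<^bsub>AddC\<^esub> col j"
      using arg_cong[OF eq[OF XsOb[OF ij(2)] f[OF ij(2)]], of dat] by (simp add: cauchy_completion_def add.idempotent_sel)
    then show "dat (dat g) (i, j) = dat (dat g') (i, j)"
      using h_col[OF gd(3) ij] h_col[OF gd'(3) ij] gd(4) gd'(4) by simp
  qed
  then show ?thesis using gd gd' by (intro arr.expand) simp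
qed

end

text \<open>The quantum integer \<open>[n]\<close> up to the factor \<open>q - inverse q\<close>;
  its vanishing would give \<open>q ^ (2 * n) = 1\<close>.\<close>

lemma quantum_number_nonzero:
  fixes q :: complex assumes "q \<noteq> 0" "\<forall>n>0. q ^ n \<noteq> 1" "0 < n"
  shows "q ^ n - inverse (q ^ n) \<noteq> 0"
proof
  assume "q ^ n - inverse (q ^ n) = 0"
  then have "q ^ n * q ^ n = 1" using assms(1) by (metis eq_iff_diff_eq_0 power_not_zero right_inverse)
  then have "q ^ (n + n) = 1" by (simp add: power_add)
  then show False using assms(2,3) by simp
qed

context temperley_lieb
begin

text \<open>\<open>trace n\<close> is \<open>- [n + 1] / [n]\<close> in quantum integers.\<close>

lemma trace_eq:
  fixes q :: 'c
  assumes q: "q \<noteq> 0" "\<And>n. 0 < n \<Longrightarrow> q ^ n - inverse (q ^ n) \<noteq> 0" and l: "loop = - (q + inverse q)"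
  shows "trace (Suc n) = - (q ^ Suc (Suc n) - inverse (q ^ Suc (Suc n))) / (q ^ Suc n - inverse (q ^ Suc n))"
proof (induction n)
  case 0
  let ?b = "\<lambda>n. q ^ n - inverse (q ^ n)"
  have "?b (Suc (Suc 0)) = (q + inverse q) * ?b (Suc 0)"
    using q(1) by (simp add: field_simps)
  then have "?b (Suc (Suc 0)) / ?b (Suc 0) = q + inverse q"
    using q(2)[of "Suc 0"] nonzero_divide_eq_eq by blast
  moreover have "trace (Suc 0) = loop" by simp
  ultimately show ?case unfolding l by (metis minus_divide_left)
next
  case (Suc n)
  let ?b = "\<lambda>n. q ^ n - inverse (q ^ n)"
  have b: "?b (Suc n) \<noteq> 0" "?b (Suc (Suc n)) \<noteq> 0" using q(2)[of "Suc n"] q(2)[of "Suc (Suc n)"] by simp_all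
  \<comment> \<open>The recursion \<open>[2] [k] = [k + 1] + [k - 1]\<close> of quantum integers at
    \<open>k = n + 2\<close>, with the common denominator cleared; division by
    \<open>[n + 2]\<close> yields the recursion of \<open>trace\<close> up to sign.\<close>
  have "(q + inverse q) * ?b (Suc (Suc n)) = ?b (Suc (Suc (Suc n))) + ?b (Suc n)"
    using q(1) by (simp add: field_simps)
  moreover have aux: "u - e / v = w / v" if "u * v = w + e" "v \<noteq> 0" for u v w e :: 'c
    using that by (simp add: field_simps)
  ultimately have "(q + inverse q) - ?b (Suc n) / ?b (Suc (Suc n)) = ?b (Suc (Suc (Suc n))) / ?b (Suc (Suc n))"
    using b(2) aux by blast
  then have "- (q + inverse q) + ?b (Suc n) / ?b (Suc (Suc n)) = - (?b (Suc (Suc (Suc n))) / ?b (Suc (Suc n)))"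
    by (metis add.inverse_inverse add_uminus_conv_diff minus_add_distrib)
  moreover have "inverse (trace (Suc n)) = - (?b (Suc n) / ?b (Suc (Suc n)))"
    unfolding Suc inverse_divide by (rule divide_minus_right)
  moreover have "trace (Suc (Suc n)) = - (q + inverse q) - inverse (trace (Suc n))"
    using trace.simps(2)[of "Suc n"] arg_cong[OF l, of "\<lambda>z. z - inverse (trace (Suc n))"] by (rule HOL.trans)
  ultimately show ?case by (metis diff_minus_eq_add minus_divide_left)
qed

text \<open>The hypotheses fix \<open>\<xi>\<close> only on the unit and the generator.
  Multiplicativity makes it the sign \<open>(- 1) ^ n\<close> on \<open>x n\<close>, and by
  naturality its square at \<open>Y\<close> acts trivially on every morphism from some
  \<open>x n\<close> to \<open>Y\<close>. The assumption \<open>epic\<close> says that such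
  morphisms detect equality.\<close>

lemma sign_half_braiding_square:
  assumes h: "half_braiding C (x 0) \<xi>" and \<xi>0: "\<xi> (x 0) = ix 0" and \<xi>1: "\<xi> (x 1) = scale C (- 1) (ix 1)"
    and epic: "\<And>g g'. arr g \<Longrightarrow> arr g' \<Longrightarrow> dom g = dom g' \<Longrightarrow> cod g = cod g' \<Longrightarrow>
      (\<And>n f. arr f \<Longrightarrow> dom f = x n \<Longrightarrow> cod f = dom g \<Longrightarrow> g \<cdot> f = g' \<cdot> f) \<Longrightarrow> g = g'"
    and Y: "Y \<in> Ob C"
  shows "\<xi> Y \<cdot> \<xi> Y = idm C Y"
proof -
  have X0: "x 0 \<odot> X = X" "X \<odot> x 0 = X" if "X \<in> Ob C" for X
    using that ob_simps(5,6)[of X] by simp_all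
  note hD = half_braidingD[OF h]
  have \<xi>t [simp]: "arr (\<xi> X)" "dom (\<xi> X) = X" "cod (\<xi> X) = X" if "X \<in> Ob C" for X
    using hD(4-6)[OF that] X0[OF that] by simp_all
  have nat: "\<xi> (cod f) \<cdot> f = f \<cdot> \<xi> (dom f)" if "arr f" for f
    using hD(7)[OF that] that by simp
  have \<xi>n: "\<xi> (x n) = scale C ((- 1) ^ n) (ix n)" for n
  proof (induction n)
    case 0 then show ?case by (simp add: \<xi>0 scale_simps)
  next
    case (Suc n)
    have "\<xi> (x n \<odot> x 1) = (ix n \<otimes> \<xi> (x 1)) \<cdot> (\<xi> (x n) \<otimes> ix 1)" by (rule hD(8)) simp_all
    then show ?case unfolding Suc \<xi>1 by (simp add: scale_simps)
  qed
  show ?thesis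
  proof (rule epic)
    fix n f assume "arr f" "dom f = x n" "cod f = dom (\<xi> Y \<cdot> \<xi> Y)"
    then have f [simp]: "arr f" "dom f = x n" "cod f = Y" using Y by simp_all
    have s: "\<xi> Y \<cdot> f = scale C ((- 1) ^ n) f" using nat[OF f(1)] by (simp add: \<xi>n scale_simps)
    have "(\<xi> Y \<cdot> \<xi> Y) \<cdot> f = scale C ((- 1) ^ n * (- 1) ^ n) f"
      using Y by (simp add: assoc_cmp s scale_simps)
    also have "(- 1 :: 'c) ^ n * (- 1) ^ n = 1" by (simp flip: power_mult_distrib)
    finally show "(\<xi> Y \<cdot> \<xi> Y) \<cdot> f = idm C Y \<cdot> f" using Y by (simp add: scale_simps)
  qed (use Y in simp_all)
qed

end

section \<open>The category \<open>TL q\<close> as an instance of the abstract setting\<close>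

lemma tl_ob_Ob: "tl_ob q n \<in> Ob (TL q)"
  using strict_lin_monoidal.cauchy_Ob[OF tl_pre_monoidal[of q], of n] by (simp add: TL_def tl_ob_def tl_pre_simps)

lemma TL_temperley_lieb: "temperley_lieb (TL q) src tgt (tl_ob q) (tl_cup q) (tl_cap q) (- (q + inverse q))"
proof -
  interpret pre: strict_lin_monoidal "tl_pre q" by (rule tl_pre_monoidal)
  interpret TL: strict_lin_monoidal_dc "TL q" src tgt by (rule TL_monoidal_dc)
  let ?m = "\<lambda>m n e. cauchy_mor (tl_pre q) m n (tl_class q e)"
  have ar: "arrow (tl_pre q) (tl_class q e) (tl_dom e) (tl_cod e)" if "tl_wf e" for e
    using that by (auto simp: tl_pre_arrow)
  have car: "TL.arr (?m m n e) \<and> src (?m m n e) = tl_ob q m \<and> tgt (?m m n e) = tl_ob q n"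
    if "tl_wf e" "tl_dom e = m" "tl_cod e = n" for e m n
    using pre.cauchy_arrow[OF ar[OF that(1)], folded TL_def tl_ob_def] that TL.arrow_iff by simp
  note ops = pre.cauchy_ops[folded TL_def tl_ob_def, unfolded tl_pre_simps tl_ob_def[symmetric]]
  have cmp: "?m k n g \<cdot>\<^bsub>TL q\<^esub> ?m m k f = ?m m n (g \<bullet>\<^sub>T f)"
    if "tl_wf f" "tl_wf g" "tl_dom f = m" "tl_cod f = k" "tl_dom g = k" "tl_cod g = n" for f g k m n
    using ops(3)[OF ar[OF that(1)], of "tl_class q g" n] ar[OF that(2)] that by (simp add: tl_pre_cmp)
  have tens: "?m m n f \<otimes>\<^bsub>TL q\<^esub> ?m m' n' g = ?m (m + m') (n + n') (f \<otimes>\<^sub>T g)"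
    if "tl_wf f" "tl_wf g" "tl_dom f = m" "tl_cod f = n" "tl_dom g = m'" "tl_cod g = n'" for f g m m' n n'
    using ops(6)[OF ar[OF that(1)] ar[OF that(2)]] that by (simp add: tl_pre_tensM)
  have add: "add (TL q) (?m m n f) (?m m n g) = ?m m n (f +\<^sub>T g)"
    if "tl_wf f" "tl_wf g" "tl_dom f = m" "tl_cod f = n" "tl_dom g = m" "tl_cod g = n" for f g m n
    using ops(4)[OF ar[OF that(1)], of "tl_class q g"] ar[OF that(2)] that by (simp add: tl_pre_add)
  have scale: "scale (TL q) c (?m m n f) = ?m m n (c *\<^sub>T f)"
    if "tl_wf f" "tl_dom f = m" "tl_cod f = n" for f m n c
    using ops(5)[OF ar[OF that(1)]] that by (simp add: tl_pre_scale)
  have idm: "idm (TL q) (tl_ob q n) = ?m n n (TId n)" for n using ops(1) by simp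
  have zero: "zero (TL q) (tl_ob q m) (tl_ob q n) = ?m m n (TZero m n)" for m n using ops(2) by simp
  have cc: "tl_cup q = ?m 0 2 TCup" "tl_cap q = ?m 2 0 TCap" by (simp_all add: tl_cup_def tl_cap_def)
  show ?thesis
  proof (unfold_locales, goal_cases)
    case (1 n) show ?case by (rule tl_ob_Ob)
  next
    case 2 show ?case using ops(8) by simp
  next
    case (3 m n) show ?case using ops(7) by simp
  next
    case 4 show ?case using car[of TCup 0 2] by (simp add: cc)
  next
    case 5 show ?case using car[of TCup 0 2] by (simp add: cc)
  next
    case 6 show ?case using car[of TCup 0 2] by (simp add: cc)
  next
    case 7 show ?case using car[of TCap 2 0] by (simp add: cc)
  next
    case 8 show ?case using car[of TCap 2 0] by (simp add: cc)
  next
    case 9 show ?case using car[of TCap 2 0] by (simp add: cc)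
  next
    case 10
    show ?case unfolding cc idm
      by (simp add: tens cmp tl_class_eqI[OF tl_eq.zigzag_left, simplified] numeral_3_eq_3)
  next
    case 11
    show ?case unfolding cc idm
      by (simp add: tens cmp tl_class_eqI[OF tl_eq.zigzag_right, simplified] numeral_3_eq_3)
  next
    case 12
    show ?case unfolding cc idm
      by (simp add: cmp scale tl_class_eqI[OF tl_eq.circle, simplified])
  next
    case (13 P f m n)
    note c = 13(4-)
    \<comment> \<open>By fullness of the canonical functor \<open>f\<close> comes from an
      expression; the closure properties of \<open>P\<close> are then the cases of an induction over
      expressions.\<close>
    have "arrow (TL q) f (tl_ob q m) (tl_ob q n)" using 13(1-3) by (simp add: TL.arrow_iff)
    then obtain F where "arrow (tl_pre q) F m n" "f = cauchy_mor (tl_pre q) m n F"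
      using pre.cauchy_arrow_cases unfolding TL_def tl_ob_def by blast
    then obtain e where e: "tl_wf e" "tl_dom e = m" "tl_cod e = n" "f = ?m m n e" by (auto simp: tl_pre_arrow)
    have "tl_wf e \<Longrightarrow> P (tl_dom e) (tl_cod e) (?m (tl_dom e) (tl_cod e) e)" for e
    proof (induction e)
      case (TId n) then show ?case using c(1)[of n] by (simp add: idm)
    next
      case TCup then show ?case using c(2) by (simp add: cc)
    next
      case TCap then show ?case using c(3) by (simp add: cc)
    next
      case (TComp g f)
      then show ?case using c(5)[of "?m (tl_dom f) (tl_cod f) f" "tl_dom f" "tl_cod f"
          "?m (tl_cod f) (tl_cod g) g" "tl_cod g"] by (simp add: car cmp)
    next
      case (TTens f g)
      then show ?case using c(6)[of "?m (tl_dom f) (tl_cod f) f" "tl_dom f" "tl_cod f"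
          "?m (tl_dom g) (tl_cod g) g" "tl_dom g" "tl_cod g"] by (simp add: car tens)
    next
      case (TZero m n) then show ?case using c(4)[of m n] by (simp add: zero)
    next
      case (TAdd f g)
      then show ?case using c(7)[of "?m (tl_dom f) (tl_cod f) f" "tl_dom f" "tl_cod f"
          "?m (tl_dom f) (tl_cod f) g"] by (simp add: car add)
    next
      case (TScale a f)
      then show ?case using c(8)[of "?m (tl_dom f) (tl_cod f) f" "tl_dom f" "tl_cod f" a] by (simp add: car scale)
    qed
    from this[OF e(1)] show ?case using e by simp
  qed
qed

lemma TL_temperley_lieb_generic:
  fixes q :: complex assumes "q \<noteq> 0" "\<forall>n>0. q ^ n \<noteq> 1"
  shows "temperley_lieb_generic (TL q) src tgt (tl_ob q) (tl_cup q) (tl_cap q) (- (q + inverse q))"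
proof -
  interpret temperley_lieb "TL q" src tgt "tl_ob q" "tl_cup q" "tl_cap q" "- (q + inverse q)"
    by (rule TL_temperley_lieb)
  show ?thesis
  proof
    fix n
    note nz = quantum_number_nonzero[OF assms]
    have "trace (Suc n) = - (q ^ Suc (Suc n) - inverse (q ^ Suc (Suc n))) / (q ^ Suc n - inverse (q ^ Suc n))"
      by (rule trace_eq[OF assms(1) nz HOL.refl])
    then show "trace (Suc n) \<noteq> 0"
      using nz[of "Suc n"] nz[of "Suc (Suc n)"] by (simp del: power_Suc trace.simps)
  qed
qed

lemma TL_idempotents_split: "strict_lin_monoidal_dc.idempotents_split (TL q) src tgt"
proof -
  interpret pre: strict_lin_monoidal "tl_pre q" by (rule tl_pre_monoidal)
  interpret TL: strict_lin_monoidal_dc "TL q" src tgt by (rule TL_monoidal_dc)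
  show ?thesis unfolding TL.idempotents_split_def
  proof (intro allI impI; elim conjE)
    fix e assume e: "TL.arr e" "tgt e = src e" "e \<cdot>\<^bsub>TL q\<^esub> e = e"
    then have "arrow (TL q) e (src e) (src e)" by (simp add: TL.arrow_iff)
    from pre.cauchy_splits[folded TL_def, OF this e(3)]
    obtain B i p where "arrow (TL q) i B (src e)" "arrow (TL q) p (src e) B" "p \<cdot>\<^bsub>TL q\<^esub> i = idm (TL q) B" "i \<cdot>\<^bsub>TL q\<^esub> p = e"
      by blast
    note ip = this[unfolded TL.arrow_iff]
    show "\<exists>i p. TL.arr i \<and> TL.arr p \<and> src p = src e \<and> tgt i = src e \<and> tgt p = src i \<and>
        p \<cdot>\<^bsub>TL q\<^esub> i = idm (TL q) (src i) \<and> i \<cdot>\<^bsub>TL q\<^esub> p = e"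
      by (intro exI[of _ i] exI[of _ p]) (use ip in simp)
  qed
qed

lemma TL_epic:
  assumes "strict_lin_monoidal_dc.arr (TL q) src tgt g" "strict_lin_monoidal_dc.arr (TL q) src tgt g'"
    "src g = src g'" "tgt g = tgt g'"
    and eq: "\<And>n f. strict_lin_monoidal_dc.arr (TL q) src tgt f \<Longrightarrow> src f = tl_ob q n \<Longrightarrow> tgt f = src g \<Longrightarrow>
      g \<cdot>\<^bsub>TL q\<^esub> f = g' \<cdot>\<^bsub>TL q\<^esub> f"
  shows "g = g'"
proof -
  interpret pre: strict_lin_monoidal "tl_pre q" by (rule tl_pre_monoidal)
  interpret TL: strict_lin_monoidal_dc "TL q" src tgt by (rule TL_monoidal_dc)
  show ?thesis
    by (rule pre.cauchy_epic[folded TL_def tl_ob_def, of g "src g" "tgt g" g'])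
      (use assms in \<open>auto simp: TL.arrow_iff\<close>)
qed

section \<open>Decompositions in the Drinfeld center\<close>

lemma mult_add_less:
  fixes a b m n :: nat assumes "m < a" "n < b" shows "m * b + n < a * b"
proof -
  have "m * b + n < Suc m * b" using assms(2) by simp
  also have "\<dots> \<le> a * b" using assms(1) by (intro mult_le_mono1) simp
  finally show ?thesis .
qed

context strict_lin_monoidal_dc
begin

text \<open>The list comprehension runs through the pairs in row-major order, so position
  \<open>k\<close> belongs to \<open>(k div b, k mod b)\<close>.\<close>

lemma is_direct_sum_product:
  assumes b: "biprod X ({..<a} \<times> {..<b}) (\<lambda>(m, n). F m n) \<iota> \<pi>"
  shows "is_direct_sum C X [F m n. m \<leftarrow> [0..<a], n \<leftarrow> [0..<b]]"
proof -
  let ?l = "[F m n. m \<leftarrow> [0..<a], n \<leftarrow> [0..<b]]"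
  have len: "length ?l = a * b" using length_concat_const[of "\<lambda>m. map (F m) [0..<b]" b "[0..<a]"] by simp
  have "bij_betw (\<lambda>k. (k div b, k mod b)) {..<a * b} ({..<a} \<times> {..<b})"
    by (rule bij_betwI[where g = "\<lambda>(m, n). m * b + n"])
      (auto simp: split_index div_mult_add mult_add_less)
  from biprod_reindex[OF b this]
  have b': "biprod X {..<a * b} ((\<lambda>(m, n). F m n) \<circ> (\<lambda>k. (k div b, k mod b))) (\<iota> \<circ> (\<lambda>k. (k div b, k mod b))) (\<pi> \<circ> (\<lambda>k. (k div b, k mod b)))" .
  have "biprod X {..<a * b} (\<lambda>k. ?l ! k) (\<iota> \<circ> (\<lambda>k. (k div b, k mod b))) (\<pi> \<circ> (\<lambda>k. (k div b, k mod b)))"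
  proof (rule biprod_cong[OF b'])
    fix k assume "k \<in> {..<a * b}"
    then have k: "k < a * b" by simp
    show "((\<lambda>(m, n). F m n) \<circ> (\<lambda>k. (k div b, k mod b))) k = ?l ! k"
      using nth_concat_const[of k "[0..<a]" b "\<lambda>m. map (F m) [0..<b]"] k split_index[OF k] by simp
  qed
  then show ?thesis unfolding is_direct_sum_iff_biprod len by blast
qed

text \<open>An inverse in \<open>C\<close> of a morphism of the center is automatically compatible
  with the half-braidings: insert \<open>dat f \<cdot> g\<close> and slide \<open>dat f\<close>
  through.\<close>

lemma center_iso:
  assumes f: "arrow CenC f A B" and i: "inverse_pair C (fst A) (fst B) (dat f) g"
  shows "isomorphic CenC A B"
proof -
  interpret Z: strict_lin_monoidal_dc CenC src tgt by (rule center_monoidal_dc)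
  note f' = f[unfolded center_arrow]
  then have AB [simp]: "A \<in> Ob CenC" "B \<in> Ob CenC" by auto
  note D = half_braidingD[OF iffD1[OF center_Ob]]
  note [simp] = D(1,4,5,6)
  have fs [simp]: "arr (dat f)" "dom (dat f) = fst A" "cod (dat f) = fst B" using f' by auto
  have gs [simp]: "arr g" "dom g = fst B" "cod g = fst A" and gf: "g \<cdot> dat f = idm C (fst A)" "dat f \<cdot> g = idm C (fst B)"
    using i by (simp_all add: inverse_pair_iff)
  have "(idm C Y \<otimes> g) \<cdot> snd B Y = snd A Y \<cdot> (g \<otimes> idm C Y)" if [simp]: "Y \<in> Ob C" for Y
  proof -
    have "(idm C Y \<otimes> g) \<cdot> snd B Y = (idm C Y \<otimes> g) \<cdot> (snd B Y \<cdot> ((dat f \<otimes> idm C Y) \<cdot> (g \<otimes> idm C Y)))"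
      by (simp add: cmp_tensM gf)
    also have "\<dots> = (idm C Y \<otimes> g) \<cdot> ((snd B Y \<cdot> (dat f \<otimes> idm C Y)) \<cdot> (g \<otimes> idm C Y))"
      by (simp add: assoc_cmp)
    also have "snd B Y \<cdot> (dat f \<otimes> idm C Y) = (idm C Y \<otimes> dat f) \<cdot> snd A Y" using f' by simp
    also have "(idm C Y \<otimes> g) \<cdot> (((idm C Y \<otimes> dat f) \<cdot> snd A Y) \<cdot> (g \<otimes> idm C Y)) =
      ((idm C Y \<otimes> g) \<cdot> (idm C Y \<otimes> dat f)) \<cdot> (snd A Y \<cdot> (g \<otimes> idm C Y))"
      by (simp add: assoc_cmp)
    also have "\<dots> = snd A Y \<cdot> (g \<otimes> idm C Y)" by (simp add: cmp_tensM gf)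
    finally show ?thesis .
  qed
  then have g: "arrow CenC (Arr B A g) B A" by (simp add: center_arrow)
  have "inverse_pair CenC A B f (Arr B A g)"
    unfolding Z.inverse_pair_iff[OF AB] using f g
    by (auto simp: Z.arrow_iff center_sel gf intro!: arr.expand)
  then show ?thesis by (auto simp: isomorphic_def is_iso_def)
qed

text \<open>\<open>F\<close> is a functorial choice of half-braidings that leaves underlying objects
  and morphisms alone. Composites and zero morphisms of the center are computed in \<open>C\<close>,
  so biproducts lift along \<open>F\<close>; this is meant for \<open>over\<close> and
  \<open>under\<close>.\<close>

lemma center_biprod:
  assumes F: "\<And>X. X \<in> Ob C \<Longrightarrow> F X \<in> Ob CenC" "\<And>X. fst (F X) = X"
    and Fm: "\<And>f. arr f \<Longrightarrow> arrow CenC (Arr (F (dom f)) (F (cod f)) f) (F (dom f)) (F (cod f))"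
    and b: "biprod X K A \<iota> \<pi>"
  shows "strict_lin_monoidal_dc.biprod CenC src tgt (F X) K (\<lambda>k. F (A k))
    (\<lambda>k. Arr (F (A k)) (F X) (\<iota> k)) (\<lambda>k. Arr (F X) (F (A k)) (\<pi> k))"
proof -
  interpret Z: strict_lin_monoidal_dc CenC src tgt by (rule center_monoidal_dc)
  note bD = biprodD[OF b]
  have a: "arrow CenC (Arr (F X) (F Y) f) (F X) (F Y)" if "arr f" "dom f = X" "cod f = Y" for f X Y
    using Fm[OF that(1)] that by simp
  show ?thesis unfolding Z.biprod_def
  proof (intro conjI ballI allI impI; (elim conjE)?)
    show "F X \<in> Ob CenC" "finite K" using F bD(1,2) by auto
    fix k assume k: "k \<in> K"
    show "F (A k) \<in> Ob CenC" using F bD(3)[OF k] by blast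
    have "arrow CenC (Arr (F (A k)) (F X) (\<iota> k)) (F (A k)) (F X)" "arrow CenC (Arr (F X) (F (A k)) (\<pi> k)) (F X) (F (A k))"
      by (intro a bD k)+
    then show "Z.arr (Arr (F (A k)) (F X) (\<iota> k))" "Z.arr (Arr (F X) (F (A k)) (\<pi> k))"
      by (simp_all add: Z.arrow_iff)
    fix l assume l: "l \<in> K"
    show "Arr (F X) (F (A k)) (\<pi> k) \<cdot>\<^bsub>CenC\<^esub> Arr (F (A l)) (F X) (\<iota> l) =
      (if k = l then idm CenC (F (A k)) else zero CenC (F (A l)) (F (A k)))"
      by (intro arr.expand) (use bD(10)[OF k l] F(2) in \<open>simp add: center_sel\<close>)
  next
    fix f assume f: "Z.arr f" "tgt f = F X"
      and z: "\<forall>k\<in>K. Arr (F X) (F (A k)) (\<pi> k) \<cdot>\<^bsub>CenC\<^esub> f = zero CenC (src f) (F (A k))"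
    have fa: "arrow CenC f (src f) (F X)" using f by (simp add: Z.arrow_iff)
    then have d: "arr (dat f)" "dom (dat f) = fst (src f)" "cod (dat f) = X" using F(2) by (auto simp: center_arrow)
    have "\<pi> k \<cdot> dat f = zero C (dom (dat f)) (A k)" if "k \<in> K" for k
      using arg_cong[OF z[rule_format, OF that], of dat] F(2) d by (simp add: center_sel)
    then have "dat f = zero C (dom (dat f)) X" using biprod_monic[OF b d(1,3)] by blast
    then show "f = zero CenC (src f) (F X)"
      using f(2) F(2) d by (intro arr.expand) (simp add: center_sel)
  qed simp_all
qed

section \<open>The two half-braidings given by a braiding\<close>

context
  fixes \<sigma> :: "'a \<Rightarrow> 'a \<Rightarrow> 'b"
  assumes \<sigma>: "braiding C \<sigma>"
begin

definition "inv_braid X Y = inv_mor C (X \<odot> Y) (Y \<odot> X) (\<sigma> X Y)"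

lemma braid_inverse:
  assumes "X \<in> Ob C" "Y \<in> Ob C" shows "inverse_pair C (X \<odot> Y) (Y \<odot> X) (\<sigma> X Y) (inv_braid X Y)"
  using \<sigma> assms unfolding inv_braid_def braiding_def by (intro inv_mor_inverse_pair) auto

lemma braid_simps [simp]:
  assumes "X \<in> Ob C" "Y \<in> Ob C"
  shows "arr (\<sigma> X Y)" "dom (\<sigma> X Y) = X \<odot> Y" "cod (\<sigma> X Y) = Y \<odot> X"
    "arr (inv_braid X Y)" "dom (inv_braid X Y) = Y \<odot> X" "cod (inv_braid X Y) = X \<odot> Y"
    "inv_braid X Y \<cdot> \<sigma> X Y = idm C (X \<odot> Y)" "\<sigma> X Y \<cdot> inv_braid X Y = idm C (Y \<odot> X)"
  using braid_inverse[OF assms] assms by (simp_all add: inverse_pair_iff)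

lemma braid_natural: "arr f \<Longrightarrow> arr g \<Longrightarrow> \<sigma> (cod f) (cod g) \<cdot> (f \<otimes> g) = (g \<otimes> f) \<cdot> \<sigma> (dom f) (dom g)"
  using \<sigma> unfolding braiding_def by (simp add: Hom_iff)

lemma braid_hexagon:
  assumes "X \<in> Ob C" "Y \<in> Ob C" "W \<in> Ob C"
  shows "\<sigma> X (Y \<odot> W) = (idm C Y \<otimes> \<sigma> X W) \<cdot> (\<sigma> X Y \<otimes> idm C W)"
    "\<sigma> (X \<odot> Y) W = (\<sigma> X W \<otimes> idm C Y) \<cdot> (idm C X \<otimes> \<sigma> Y W)"
  using \<sigma> assms unfolding braiding_def by blast+

lemma inv_braid_natural: assumes [simp]: "arr f" "arr g"
  shows "inv_braid (cod f) (cod g) \<cdot> (g \<otimes> f) = (f \<otimes> g) \<cdot> inv_braid (dom f) (dom g)"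
proof -
  have "inv_braid (cod f) (cod g) \<cdot> (g \<otimes> f) =
    inv_braid (cod f) (cod g) \<cdot> (((g \<otimes> f) \<cdot> \<sigma> (dom f) (dom g)) \<cdot> inv_braid (dom f) (dom g))"
    by (simp add: assoc_cmp)
  also have "\<dots> = inv_braid (cod f) (cod g) \<cdot> ((\<sigma> (cod f) (cod g) \<cdot> (f \<otimes> g)) \<cdot> inv_braid (dom f) (dom g))"
    by (simp add: braid_natural)
  also have "\<dots> = inv_braid (cod f) (cod g) \<cdot> (\<sigma> (cod f) (cod g) \<cdot> ((f \<otimes> g) \<cdot> inv_braid (dom f) (dom g)))"
    by (simp add: assoc_cmp)
  also have "\<dots> = (inv_braid (cod f) (cod g) \<cdot> \<sigma> (cod f) (cod g)) \<cdot> ((f \<otimes> g) \<cdot> inv_braid (dom f) (dom g))"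
    by (rule assoc_cmp[symmetric]) simp_all
  finally show ?thesis by simp
qed

text \<open>The hexagons inverted factor by factor; uniqueness of inverses identifies the result
  with the inverse braiding.\<close>

lemma inv_braid_hexagon:
  assumes [simp]: "X \<in> Ob C" "Y \<in> Ob C" "W \<in> Ob C"
  shows "inv_braid X (Y \<odot> W) = (inv_braid X Y \<otimes> idm C W) \<cdot> (idm C Y \<otimes> inv_braid X W)"
    "inv_braid (X \<odot> Y) W = (idm C X \<otimes> inv_braid Y W) \<cdot> (inv_braid X W \<otimes> idm C Y)"
proof -
  have "inverse_pair C (X \<odot> Y \<odot> W) ((Y \<odot> W) \<odot> X) (\<sigma> X (Y \<odot> W)) ((inv_braid X Y \<otimes> idm C W) \<cdot> (idm C Y \<otimes> inv_braid X W))"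
    unfolding braid_hexagon(1)[OF assms]
    by (rule inverse_pair_cmp[of _ "(Y \<odot> X) \<odot> W"])
      (use inverse_pair_tensM[OF _ _ _ _ braid_inverse[of X Y] inverse_pair_idm[of W]]
        inverse_pair_tensM[OF _ _ _ _ inverse_pair_idm[of Y] braid_inverse[of X W]] in simp_all)
  then show "inv_braid X (Y \<odot> W) = (inv_braid X Y \<otimes> idm C W) \<cdot> (idm C Y \<otimes> inv_braid X W)"
    using inverse_pair_unique[OF _ _ braid_inverse[of X "Y \<odot> W"]] by simp
  have "inverse_pair C ((X \<odot> Y) \<odot> W) (W \<odot> X \<odot> Y) (\<sigma> (X \<odot> Y) W) ((idm C X \<otimes> inv_braid Y W) \<cdot> (inv_braid X W \<otimes> idm C Y))"
    unfolding braid_hexagon(2)[OF assms]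
    by (rule inverse_pair_cmp[of _ "X \<odot> W \<odot> Y"])
      (use inverse_pair_tensM[OF _ _ _ _ braid_inverse[of X W] inverse_pair_idm[of Y]]
        inverse_pair_tensM[OF _ _ _ _ inverse_pair_idm[of X] braid_inverse[of Y W]] in simp_all)
  then show "inv_braid (X \<odot> Y) W = (idm C X \<otimes> inv_braid Y W) \<cdot> (inv_braid X W \<otimes> idm C Y)"
    using inverse_pair_unique[OF _ _ braid_inverse[of "X \<odot> Y" W]] by simp
qed

definition over :: "'a \<Rightarrow> 'a \<times> ('a \<Rightarrow> 'b)" where "over X = (X, \<lambda>Y\<in>Ob C. \<sigma> X Y)"

definition under :: "'a \<Rightarrow> 'a \<times> ('a \<Rightarrow> 'b)" where "under X = (X, \<lambda>Y\<in>Ob C. inv_braid Y X)"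

lemma fst_over [simp]: "fst (over X) = X" and fst_under [simp]: "fst (under X) = X"
  by (simp_all add: over_def under_def)

lemma over_Ob [simp]: assumes [simp]: "X \<in> Ob C" shows "over X \<in> Ob CenC"
proof -
  have "\<sigma> X (cod f) \<cdot> (idm C X \<otimes> f) = (f \<otimes> idm C X) \<cdot> \<sigma> X (dom f)" if "arr f" for f
    using braid_natural[of "idm C X" f] that by simp
  moreover have "is_iso C (X \<odot> Y) (Y \<odot> X) (\<sigma> X Y)" if "Y \<in> Ob C" for Y
    using braid_inverse[of X Y] that by (auto simp: is_iso_def)
  ultimately show ?thesis
    unfolding center_Ob half_braiding_iff over_def by (auto simp: braid_hexagon)
qed

lemma under_Ob [simp]: assumes [simp]: "X \<in> Ob C" shows "under X \<in> Ob CenC"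
proof -
  have "inv_braid (cod f) X \<cdot> (idm C X \<otimes> f) = (f \<otimes> idm C X) \<cdot> inv_braid (dom f) X" if "arr f" for f
    using inv_braid_natural[of f "idm C X"] that by simp
  moreover have "is_iso C (X \<odot> Y) (Y \<odot> X) (inv_braid Y X)" if "Y \<in> Ob C" for Y
    using inverse_pair_sym[OF braid_inverse[of Y X]] that by (auto simp: is_iso_def)
  ultimately show ?thesis
    unfolding center_Ob half_braiding_iff under_def by (auto simp: inv_braid_hexagon)
qed

lemma over_arrow: assumes f [simp]: "arr f" shows "arrow CenC (Arr (over (dom f)) (over (cod f)) f) (over (dom f)) (over (cod f))"
proof -
  have "(idm C Y \<otimes> f) \<cdot> \<sigma> (dom f) Y = \<sigma> (cod f) Y \<cdot> (f \<otimes> idm C Y)" if "Y \<in> Ob C" for Y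
    using braid_natural[of f "idm C Y"] that by simp
  then show ?thesis unfolding center_arrow by (simp add: over_def[of "dom f"] over_def[of "cod f"] over_Ob[unfolded over_def])
qed

lemma under_arrow: assumes f [simp]: "arr f" shows "arrow CenC (Arr (under (dom f)) (under (cod f)) f) (under (dom f)) (under (cod f))"
proof -
  have "(idm C Y \<otimes> f) \<cdot> inv_braid Y (dom f) = inv_braid Y (cod f) \<cdot> (f \<otimes> idm C Y)" if "Y \<in> Ob C" for Y
    using inv_braid_natural[of "idm C Y" f] that by simp
  then show ?thesis unfolding center_arrow by (simp add: under_def[of "dom f"] under_def[of "cod f"] under_Ob[unfolded under_def])
qed

text \<open>An equality and not just an isomorphism: the hexagon in the first argument has literally
  the form of the half-braiding on a tensor product in the center.\<close>

lemma over_tensor: assumes [simp]: "X \<in> Ob C" "Y \<in> Ob C" shows "over X \<odot>\<^bsub>CenC\<^esub> over Y = over (X \<odot> Y)"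
  by (auto simp: center_sel over_def braid_hexagon intro!: restrict_ext)

lemma under_tensor: assumes [simp]: "X \<in> Ob C" "Y \<in> Ob C" shows "under X \<odot>\<^bsub>CenC\<^esub> under Y = under (X \<odot> Y)"
  by (auto simp: center_sel under_def inv_braid_hexagon intro!: restrict_ext)

text \<open>Naturality of \<open>\<sigma> X _\<close> along \<open>\<sigma> W Y\<close>, with both
  braidings of \<open>X\<close> past a tensor product expanded by the hexagon.\<close>

lemma yang_baxter:
  assumes [simp]: "X \<in> Ob C" "Y \<in> Ob C" "W \<in> Ob C"
  shows "(\<sigma> W Y \<otimes> idm C X) \<cdot> ((idm C W \<otimes> \<sigma> X Y) \<cdot> (\<sigma> X W \<otimes> idm C Y)) =
    (idm C Y \<otimes> \<sigma> X W) \<cdot> ((\<sigma> X Y \<otimes> idm C W) \<cdot> (idm C X \<otimes> \<sigma> W Y))"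
proof -
  have "(\<sigma> W Y \<otimes> idm C X) \<cdot> \<sigma> X (W \<odot> Y) = \<sigma> X (Y \<odot> W) \<cdot> (idm C X \<otimes> \<sigma> W Y)"
    using braid_natural[of "idm C X" "\<sigma> W Y"] by simp
  then show ?thesis by (simp add: braid_hexagon assoc_cmp)
qed

lemma under_over_swap:
  assumes [simp]: "X \<in> Ob C" "Y \<in> Ob C"
  shows "isomorphic CenC (under Y \<odot>\<^bsub>CenC\<^esub> over X) (over X \<odot>\<^bsub>CenC\<^esub> under Y)"
proof -
  interpret Z: strict_lin_monoidal_dc CenC src tgt by (rule center_monoidal_dc)
  let ?A = "under Y \<odot>\<^bsub>CenC\<^esub> over X" and ?B = "over X \<odot>\<^bsub>CenC\<^esub> under Y"
  \<comment> \<open>Compatibility of \<open>inv_braid X Y\<close> with the half-braidings: the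
    Yang--Baxter equation with two crossings of each side moved across as inverses.\<close>
  have "(idm C W \<otimes> inv_braid X Y) \<cdot> ((inv_braid W Y \<otimes> idm C X) \<cdot> (idm C Y \<otimes> \<sigma> X W)) =
    ((\<sigma> X W \<otimes> idm C Y) \<cdot> (idm C X \<otimes> inv_braid W Y)) \<cdot> (inv_braid X Y \<otimes> idm C W)" if [simp]: "W \<in> Ob C" for W
  proof -
    let ?a = "\<sigma> W Y \<otimes> idm C X" and ?b = "idm C W \<otimes> \<sigma> X Y" and ?c = "\<sigma> X W \<otimes> idm C Y"
      and ?a' = "idm C Y \<otimes> \<sigma> X W" and ?b' = "\<sigma> X Y \<otimes> idm C W" and ?c' = "idm C X \<otimes> \<sigma> W Y"
    let ?ai = "inv_braid W Y \<otimes> idm C X" and ?bi = "idm C W \<otimes> inv_braid X Y"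
      and ?bi' = "inv_braid X Y \<otimes> idm C W" and ?ci' = "idm C X \<otimes> inv_braid W Y"
    have i: "?ai \<cdot> ?a = idm C (W \<odot> Y \<odot> X)" "?bi \<cdot> ?b = idm C (W \<odot> X \<odot> Y)"
      "?b' \<cdot> ?bi' = idm C (Y \<odot> X \<odot> W)" "?c' \<cdot> ?ci' = idm C (X \<odot> Y \<odot> W)"
      by (simp_all add: cmp_tensM)
    have "?bi \<cdot> (?ai \<cdot> ?a') = ?bi \<cdot> (?ai \<cdot> (?a' \<cdot> (?b' \<cdot> ((?c' \<cdot> ?ci') \<cdot> ?bi'))))"
      unfolding i by (simp add: i)
    also have "\<dots> = ?bi \<cdot> (?ai \<cdot> ((?a' \<cdot> (?b' \<cdot> ?c')) \<cdot> (?ci' \<cdot> ?bi')))"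
      by (simp add: assoc_cmp)
    also have "?a' \<cdot> (?b' \<cdot> ?c') = ?a \<cdot> (?b \<cdot> ?c)" by (rule yang_baxter[symmetric]) simp_all
    also have "?bi \<cdot> (?ai \<cdot> ((?a \<cdot> (?b \<cdot> ?c)) \<cdot> (?ci' \<cdot> ?bi'))) = ?bi \<cdot> ((?ai \<cdot> ?a) \<cdot> (?b \<cdot> (?c \<cdot> (?ci' \<cdot> ?bi'))))"
      by (simp add: assoc_cmp)
    also have "\<dots> = ?bi \<cdot> (?b \<cdot> (?c \<cdot> (?ci' \<cdot> ?bi')))" unfolding i by simp
    also have "\<dots> = (?bi \<cdot> ?b) \<cdot> (?c \<cdot> (?ci' \<cdot> ?bi'))" by (rule assoc_cmp[symmetric]) simp_all
    also have "\<dots> = (?c \<cdot> ?ci') \<cdot> ?bi'" unfolding i by (simp add: assoc_cmp)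
    finally show ?thesis .
  qed
  then have "arrow CenC (Arr ?A ?B (inv_braid X Y)) ?A ?B"
    unfolding center_arrow by (simp add: Z.ob_simps(4)) (simp add: center_sel over_def under_def)
  moreover have "inverse_pair C (fst ?A) (fst ?B) (dat (Arr ?A ?B (inv_braid X Y))) (\<sigma> X Y)"
    using inverse_pair_sym[OF braid_inverse[of X Y]] by (simp add: center_sel)
  ultimately show ?thesis by (rule center_iso)
qed

lemma M_ob_eq: "M_ob C \<sigma> T i j = over (T i) \<odot>\<^bsub>CenC\<^esub> under (T j)"
  by (auto simp: M_ob_def center_sel over_def under_def inv_braid_def intro!: restrict_ext)

theorem M_ob_tensor:
  assumes T [simp]: "\<And>n. T n \<in> Ob C"
    and fusion: "\<And>i j. \<exists>\<iota> \<pi>. biprod (T i \<odot> T j) {..<min i j + 1} (\<lambda>m. T (i + j - 2 * m)) \<iota> \<pi>"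
  shows "\<exists>D \<iota> \<pi>. isomorphic CenC (M_ob C \<sigma> T i j \<odot>\<^bsub>CenC\<^esub> M_ob C \<sigma> T i' j') D \<and>
    strict_lin_monoidal_dc.biprod CenC src tgt D ({..<min i i' + 1} \<times> {..<min j j' + 1})
      (\<lambda>(m, n). M_ob C \<sigma> T (i + i' - 2 * m) (j + j' - 2 * n)) \<iota> \<pi>"
proof -
  interpret Z: strict_lin_monoidal_dc CenC src tgt by (rule center_monoidal_dc)
  let ?D = "over (T i \<odot> T i') \<odot>\<^bsub>CenC\<^esub> under (T j \<odot> T j')"
  have o [simp]: "over (T k) \<in> Ob CenC" "under (T k) \<in> Ob CenC" for k by simp_all
  have "M_ob C \<sigma> T i j \<odot>\<^bsub>CenC\<^esub> M_ob C \<sigma> T i' j' =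
    over (T i) \<odot>\<^bsub>CenC\<^esub> ((under (T j) \<odot>\<^bsub>CenC\<^esub> over (T i')) \<odot>\<^bsub>CenC\<^esub> under (T j'))"
    by (simp add: M_ob_eq Z.ob_simps)
  moreover have "?D = over (T i) \<odot>\<^bsub>CenC\<^esub> ((over (T i') \<odot>\<^bsub>CenC\<^esub> under (T j)) \<odot>\<^bsub>CenC\<^esub> under (T j'))"
    by (simp add: over_tensor[symmetric] under_tensor[symmetric] Z.ob_simps)
  ultimately have iso: "isomorphic CenC (M_ob C \<sigma> T i j \<odot>\<^bsub>CenC\<^esub> M_ob C \<sigma> T i' j') ?D"
    using Z.isomorphic_tensO[OF Z.isomorphic_refl[OF o(1)] Z.isomorphic_tensO[OF under_over_swap[OF T T] Z.isomorphic_refl[OF o(2)]]]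
    by simp
  obtain \<iota>1 \<pi>1 where b1: "biprod (T i \<odot> T i') {..<min i i' + 1} (\<lambda>m. T (i + i' - 2 * m)) \<iota>1 \<pi>1"
    using fusion by blast
  obtain \<iota>2 \<pi>2 where b2: "biprod (T j \<odot> T j') {..<min j j' + 1} (\<lambda>m. T (j + j' - 2 * m)) \<iota>2 \<pi>2"
    using fusion by blast
  show ?thesis
    using iso Z.biprod_tens[OF center_biprod[OF over_Ob fst_over over_arrow b1]
      center_biprod[OF under_Ob fst_under under_arrow b2]] unfolding M_ob_eq by blast
qed

end

text \<open>At \<open>Y\<close> the half-braiding \<open>\<xi>\<close> is an endomorphism of
  \<open>Y\<close>, so naturality of the half-braiding of \<open>A\<close> moves one past the other.
  Strictness of the unit turns this into an equality of objects.\<close>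

lemma center_unit_commute:
  assumes A: "A \<in> Ob CenC" and \<xi>: "half_braiding C (unit C) \<xi>"
  shows "(unit C, \<xi>) \<odot>\<^bsub>CenC\<^esub> A = A \<odot>\<^bsub>CenC\<^esub> (unit C, \<xi>)"
proof -
  note [simp] = half_braidingD(1)[OF iffD1[OF center_Ob A]] half_braidingD(4-6)[OF iffD1[OF center_Ob A]]
    half_braidingD(4-6)[OF \<xi>]
  have "snd A Y \<cdot> (idm C (fst A) \<otimes> \<xi> Y) = (\<xi> Y \<otimes> idm C (fst A)) \<cdot> snd A Y" if "Y \<in> Ob C" for Y
    using half_braidingD(7)[OF iffD1[OF center_Ob A], of "\<xi> Y"] that by simp
  then show ?thesis by (auto simp: center_sel intro!: restrict_ext)
qed

lemma center_unit_square:
  assumes \<xi>: "half_braiding C (unit C) \<xi>" and sq: "\<And>Y. Y \<in> Ob C \<Longrightarrow> \<xi> Y \<cdot> \<xi> Y = idm C Y"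
  shows "(unit C, \<xi>) \<odot>\<^bsub>CenC\<^esub> (unit C, \<xi>) = unit CenC"
proof -
  note [simp] = half_braidingD(4-6)[OF \<xi>]
  show ?thesis by (auto simp: center_sel sq intro!: restrict_ext)
qed

end

theorem corollary5p15:
  fixes q a :: complex
    and \<sigma> :: "complex tl_ob \<Rightarrow> complex tl_ob \<Rightarrow> complex tl_mor"
    and \<xi> :: "complex tl_ob \<Rightarrow> complex tl_mor"
    and T :: "nat \<Rightarrow> complex tl_ob"
  assumes "q \<noteq> 0" and "\<forall>n>0. q ^ n \<noteq> 1"
    and "tl_indecomposables q T"
    and "tl_braiding q a \<sigma>"
    and "sign_half_braiding q T \<xi>"
  defines "Z \<equiv> drinfeld_center (TL q)"
    and "M \<equiv> M_ob (TL q) \<sigma> T"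
    and "W \<equiv> W_ob (TL q) \<sigma> \<xi> T"
  shows "\<forall>i j i' j'.
    isomorphic Z (M i j \<odot>\<^bsub>Z\<^esub> M i' j') (W i j \<odot>\<^bsub>Z\<^esub> W i' j') \<and>
    iso_direct_sum Z (W i j \<odot>\<^bsub>Z\<^esub> W i' j')
      [M (i + i' - 2 * m) (j + j' - 2 * n). m \<leftarrow> [0..<min i i' + 1], n \<leftarrow> [0..<min j j' + 1]] \<and>
    iso_direct_sum Z (W i j \<odot>\<^bsub>Z\<^esub> M i' j')
      [W (i + i' - 2 * m) (j + j' - 2 * n). m \<leftarrow> [0..<min i i' + 1], n \<leftarrow> [0..<min j j' + 1]]"
proof -
  interpret TL: temperley_lieb_generic "TL q" src tgt "tl_ob q" "tl_cup q" "tl_cap q" "- (q + inverse q)"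
    using assms(1,2) by (rule TL_temperley_lieb_generic)
  interpret Z: strict_lin_monoidal_dc Z src tgt unfolding Z_def by (rule TL.center_monoidal_dc)
  have T01: "T 0 = tl_ob q 0" "T 1 = tl_ob q 1"
    and T2: "\<And>n. 2 \<le> n \<Longrightarrow> indecomposable (TL q) (T n) \<and> is_summand (TL q) (T n) (tl_ob q n) \<and>
      \<not> is_summand (TL q) (T n) (tl_ob q (n - 2))"
    using assms(3) by (auto simp: tl_indecomposables_def)
  have T_Ob: "T n \<in> Ob (TL q)" for n
  proof -
    consider "n = 0" | "n = 1" | "2 \<le> n" by linarith
    then show ?thesis using T01 T2[of n] by cases (simp_all add: indecomposable_def)
  qed
  have fusion: "\<exists>\<iota> \<pi>. TL.biprod (T i \<odot>\<^bsub>TL q\<^esub> T j) {..<min i j + 1} (\<lambda>m. T (i + j - 2 * m)) \<iota> \<pi>" for i j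
    by (rule TL.T_fusion[OF TL_idempotents_split T01 T2, of i j]) blast+
  have \<sigma>: "braiding (TL q) \<sigma>" using assms(4) by (simp add: tl_braiding_def)
  have \<xi>: "half_braiding (TL q) (unit (TL q)) \<xi>"
    and \<xi>T: "\<xi> (T n) = scale (TL q) ((- 1) ^ n) (idm (TL q) (T n))" for n
    using assms(5) by (simp_all add: sign_half_braiding_def)
  \<comment> \<open>\<open>T 0\<close> and \<open>T 1\<close> are the unit and the generator, where
    the values of \<open>\<xi>\<close> can be read off.\<close>
  have sq: "\<xi> Y \<cdot>\<^bsub>TL q\<^esub> \<xi> Y = idm (TL q) Y" if "Y \<in> Ob (TL q)" for Y
  proof (rule TL.sign_half_braiding_square[OF _ _ _ _ that])
    show "half_braiding (TL q) (tl_ob q 0) \<xi>" using \<xi> by simp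
    show "\<xi> (tl_ob q 0) = idm (TL q) (tl_ob q 0)" using \<xi>T[of 0] T01 by (simp add: TL.scale_simps)
    show "\<xi> (tl_ob q 1) = scale (TL q) (- 1) (idm (TL q) (tl_ob q 1))" using \<xi>T[of 1] T01 by simp
  qed (rule TL_epic)
  define E where "E = (unit (TL q), \<xi>)"
  have E [simp]: "E \<in> Ob Z" using \<xi> by (simp add: Z_def E_def TL.center_Ob)
  have M [simp]: "M i j \<in> Ob Z" for i j
    unfolding M_def Z_def TL.M_ob_eq[OF \<sigma>] using T_Ob Z.ob_simps(4)[unfolded Z_def]
      TL.over_Ob[OF \<sigma>] TL.under_Ob[OF \<sigma>] by blast
  have W: "W i j = M i j \<odot>\<^bsub>Z\<^esub> E" for i j by (simp add: W_def W_ob_def M_def Z_def E_def)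
  have EM: "E \<odot>\<^bsub>Z\<^esub> M i j = M i j \<odot>\<^bsub>Z\<^esub> E" for i j
    using TL.center_unit_commute[OF M[unfolded Z_def] \<xi>] by (simp add: E_def Z_def)
  have EE: "E \<odot>\<^bsub>Z\<^esub> E = unit Z"
    using TL.center_unit_square[OF \<xi> sq] by (simp add: E_def Z_def)
  have WM: "W i j \<odot>\<^bsub>Z\<^esub> M i' j' = (M i j \<odot>\<^bsub>Z\<^esub> M i' j') \<odot>\<^bsub>Z\<^esub> E" for i j i' j'
    using EM[of i' j'] by (simp add: W)
  \<comment> \<open>Both copies of \<open>E\<close> can be moved to the right, where they cancel;
    the first isomorphism of the theorem thus holds as an equality.\<close>
  have WW: "W i j \<odot>\<^bsub>Z\<^esub> W i' j' = M i j \<odot>\<^bsub>Z\<^esub> M i' j'" for i j i' j'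
  proof -
    have "W i j \<odot>\<^bsub>Z\<^esub> W i' j' = (W i j \<odot>\<^bsub>Z\<^esub> M i' j') \<odot>\<^bsub>Z\<^esub> E" by (simp add: W)
    also have "\<dots> = (M i j \<odot>\<^bsub>Z\<^esub> M i' j') \<odot>\<^bsub>Z\<^esub> (E \<odot>\<^bsub>Z\<^esub> E)" unfolding WM by simp
    finally show ?thesis by (simp add: EE)
  qed
  show ?thesis
  proof (intro allI)
    fix i j i' j'
    obtain D \<iota> \<pi> where D: "isomorphic Z (M i j \<odot>\<^bsub>Z\<^esub> M i' j') D"
      "Z.biprod D ({..<min i i' + 1} \<times> {..<min j j' + 1}) (\<lambda>(m, n). M (i + i' - 2 * m) (j + j' - 2 * n)) \<iota> \<pi>"
      using TL.M_ob_tensor[OF \<sigma> T_Ob fusion, of i j i' j'] unfolding M_def Z_def by blast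
    \<comment> \<open>Tensoring the decomposition with \<open>E\<close> on the right turns every
      \<open>M\<close> into a \<open>W\<close>; by \<open>WM\<close> this is the decomposition
      wanted for the mixed product.\<close>
    have "Z.biprod (D \<odot>\<^bsub>Z\<^esub> E) ({..<min i i' + 1} \<times> {..<min j j' + 1})
        (\<lambda>(m, n). W (i + i' - 2 * m) (j + j' - 2 * n)) (\<lambda>k. \<iota> k \<otimes>\<^bsub>Z\<^esub> idm Z E) (\<lambda>k. \<pi> k \<otimes>\<^bsub>Z\<^esub> idm Z E)"
      by (rule Z.biprod_cong[OF Z.biprod_tens_right[OF D(2) E]]) (auto simp: W)
    moreover have "isomorphic Z (W i j \<odot>\<^bsub>Z\<^esub> M i' j') (D \<odot>\<^bsub>Z\<^esub> E)"
      unfolding WM by (rule Z.isomorphic_tensO[OF D(1) Z.isomorphic_refl[OF E]])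
    moreover have "isomorphic Z (M i j \<odot>\<^bsub>Z\<^esub> M i' j') (W i j \<odot>\<^bsub>Z\<^esub> W i' j')"
      unfolding WW by (rule Z.isomorphic_refl) simp
    ultimately show "isomorphic Z (M i j \<odot>\<^bsub>Z\<^esub> M i' j') (W i j \<odot>\<^bsub>Z\<^esub> W i' j') \<and>
      iso_direct_sum Z (W i j \<odot>\<^bsub>Z\<^esub> W i' j')
        [M (i + i' - 2 * m) (j + j' - 2 * n). m \<leftarrow> [0..<min i i' + 1], n \<leftarrow> [0..<min j j' + 1]] \<and>
      iso_direct_sum Z (W i j \<odot>\<^bsub>Z\<^esub> M i' j')
        [W (i + i' - 2 * m) (j + j' - 2 * n). m \<leftarrow> [0..<min i i' + 1], n \<leftarrow> [0..<min j j' + 1]]"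
      using D Z.is_direct_sum_product unfolding iso_direct_sum_def WW by blast
  qed
qed

end
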